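(* Let $E$ be a countable set and let $(M_i : i\in\Theta)$ be a family of matroids on the common ground set $E$ such that every $M_i$ belongs to $\mathfrak F\oplus\mathfrak F^{*}$. Then there is a partition $E=E_p\sqcup E_c$ such that the family $(M_i\upharpoonright E_p : i\in\Theta)$ admits a packing and the family $(M_i . E_c : i\in\Theta)$ admits a covering.
   Context: Matroids are possibly infinite: a matroid is a pair $M=(E,\mathcal I)$ with $\mathcal I\subseteq\mathcal P(E)$ such that (1) $\varnothing\in\mathcal I$; (2) $\mathcal I$ is closed under subsets; (3) for all $I,J\in\mathcal I$ with $J$ maximal in $\mathcal I$ and $I$ not maximal, there is $e\in J\setminus I$ with $I\cup\{e\}\in\mathcal I$; (4) for every $X\subseteq E$, every $I\in\mathcal I$ with $I\subseteq X$ extends to a maximal element of $\{J\in\mathcal I: J\subseteq X\}$. Bases are maximal independent sets, circuits are minimal dependent sets. The dual $M^*$ has as bases the complements of bases of $M$. $M\upharpoonright X$ is the restriction to $X$, $M/X:=(M^*\upharpoonright(E\setminus X))^*$ is contraction, and $M.X:=M/(E\setminus X)$ (a matroid on $X$). $\mathsf{span}_M(X)$ consists of the elements of $X$ together with those $e$ for which there is a circuit $C\ni e$ with $C\setminus\{e\}\subseteq X$; $S$ is spanning if $\mathsf{span}_M(S)=E$. A matroid is finitary if all its circuits are finite, cofinitary if its dual is finitary; $\mathfrak F\oplus\mathfrak F^*$ is the class of matroids that are a direct sum of a finitary and a cofinitary matroid (equivalently, each connected component of the circuit hypergraph is finitary or cofinitary). For a family $(K_i:i\in\Theta)$ of matroids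 on a common set $F$: a packing is a family $(S_i:i\in\Theta)$ of pairwise disjoint subsets of $F$ with $S_i$ spanning in $K_i$; a covering is a family $(I_i:i\in\Theta)$ with $I_i$ independent in $K_i$ and $\bigcup_i I_i=F$. *)

theory Defs
  imports "HOL-Library.Countable_Set"
begin

definition is_maximal_in :: "'a set set \<Rightarrow> 'a set \<Rightarrow> bool" where
  "is_maximal_in \<F> B \<longleftrightarrow> B \<in> \<F> \<and> (\<forall>J\<in>\<F>. B \<subseteq> J \<longrightarrow> J = B)"

definition matroid :: "'a set \<Rightarrow> 'a set set \<Rightarrow> bool" where
  "matroid E \<I> \<longleftrightarrow>
     (\<forall>I\<in>\<I>. I \<subseteq> E) \<and>
     {} \<in> \<I> \<and>
     (\<forall>I\<in>\<I>. \<forall>J. J \<subseteq> I \<longrightarrow> J \<in> \<I>) \<and>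
     (\<forall>I\<in>\<I>. \<forall>J\<in>\<I>. is_maximal_in \<I> J \<and> \<not> is_maximal_in \<I> I \<longrightarrow>
        (\<exists>e\<in>J - I. insert e I \<in> \<I>)) \<and>
     (\<forall>X. X \<subseteq> E \<longrightarrow> (\<forall>I\<in>\<I>. I \<subseteq> X \<longrightarrow>
        (\<exists>B. I \<subseteq> B \<and> is_maximal_in {J\<in>\<I>. J \<subseteq> X} B)))"

definition basis :: "'a set set \<Rightarrow> 'a set \<Rightarrow> bool" where
  "basis \<I> B \<longleftrightarrow> is_maximal_in \<I> B"

text \<open>Dual: bases are complements of bases, so independent sets are subsets of them.\<close>
definition dual_indep :: "'a set \<Rightarrow> 'a set set \<Rightarrow> 'a set set" where
  "dual_indep E \<I> = {J. J \<subseteq> E \<and> (\<exists>B. basis \<I> B \<and> J \<subseteq> E - B)}"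

definition restr_indep :: "'a set set \<Rightarrow> 'a set \<Rightarrow> 'a set set" where
  "restr_indep \<I> X = {J\<in>\<I>. J \<subseteq> X}"

definition contr_indep :: "'a set \<Rightarrow> 'a set set \<Rightarrow> 'a set \<Rightarrow> 'a set set" where
  "contr_indep E \<I> X = dual_indep (E - X) (restr_indep (dual_indep E \<I>) (E - X))"

definition dot_indep :: "'a set \<Rightarrow> 'a set set \<Rightarrow> 'a set \<Rightarrow> 'a set set" where
  "dot_indep E \<I> X = contr_indep E \<I> (E - X)"

definition circuits :: "'a set \<Rightarrow> 'a set set \<Rightarrow> 'a set set" where
  "circuits E \<I> = {C. C \<subseteq> E \<and> C \<notin> \<I> \<and> (\<forall>D. D \<subset> C \<longrightarrow> D \<in> \<I>)}"

definition span :: "'a set \<Rightarrow> 'a set set \<Rightarrow> 'a set \<Rightarrow> 'a set" where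
  "span E \<I> X = X \<union> {e. \<exists>C\<in>circuits E \<I>. e \<in> C \<and> C - {e} \<subseteq> X}"

definition spanning :: "'a set \<Rightarrow> 'a set set \<Rightarrow> 'a set \<Rightarrow> bool" where
  "spanning E \<I> S \<longleftrightarrow> span E \<I> S = E"

definition finitary :: "'a set \<Rightarrow> 'a set set \<Rightarrow> bool" where
  "finitary E \<I> \<longleftrightarrow> (\<forall>C\<in>circuits E \<I>. finite C)"

definition cofinitary :: "'a set \<Rightarrow> 'a set set \<Rightarrow> bool" where
  "cofinitary E \<I> \<longleftrightarrow> finitary E (dual_indep E \<I>)"

definition in_F_plus_Fstar :: "'a set \<Rightarrow> 'a set set \<Rightarrow> bool" where
  "in_F_plus_Fstar E \<I> \<longleftrightarrow>
     (\<exists>A B. A \<inter> B = {} \<and> A \<union> B = E \<and>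
        (\<forall>J. J \<subseteq> E \<longrightarrow> (J \<in> \<I> \<longleftrightarrow> J \<inter> A \<in> \<I> \<and> J \<inter> B \<in> \<I>)) \<and>
        finitary A (restr_indep \<I> A) \<and> cofinitary B (restr_indep \<I> B))"

definition has_packing :: "'i set \<Rightarrow> 'a set \<Rightarrow> ('i \<Rightarrow> 'a set set) \<Rightarrow> bool" where
  "has_packing \<Theta> F K \<longleftrightarrow>
     (\<exists>S. (\<forall>i\<in>\<Theta>. S i \<subseteq> F \<and> spanning F (K i) (S i)) \<and>
          (\<forall>i\<in>\<Theta>. \<forall>j\<in>\<Theta>. i \<noteq> j \<longrightarrow> S i \<inter> S j = {}))"

definition has_covering :: "'i set \<Rightarrow> 'a set \<Rightarrow> ('i \<Rightarrow> 'a set set) \<Rightarrow> bool" where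
  "has_covering \<Theta> F K \<longleftrightarrow>
     (\<exists>I. (\<forall>i\<in>\<Theta>. I i \<in> K i) \<and> (\<Union>i\<in>\<Theta>. I i) = F)"

end

theory Submission
  imports Defs "HOL-Library.Disjoint_Sets"
begin

text \<open>
  Splitting every matroid into its finitary and its cofinitary part (the other part becoming loops)
  we may assume that each member of the family is finitary or cofinitary. Let \<open>E\<^sub>p\<close> be a
  maximal set carrying a packing; after contracting it no nonempty set carries a packing, and the
  remaining countable set has to be covered.

  Call a family unhindered if every packing of a subset uses all its elements. If no nonempty set
  carries a packing, then committing one element to one of the matroids leaves an unhindered family:
  in a packing with a leftover element, augmenting paths from the leftover either repair the
  committed rank or sweep out a hindrance of the original family. Absorbing a maximal packing
  restores the stronger property, so the elements can be committed one by one. For finitary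
  matroids the union of the committed sets is independent.

  For a cofinitary matroid \<open>i\<close> each element \<open>e\<close> of its committed set must moreover be secured:
  at a finite stage \<open>e\<close> must be spanned, in the dual of matroid \<open>i\<close>, by elements committed
  elsewhere. Suppose this fails. Consider all stages reachable by augmentations and call an element
  permanently safe if at no later stage an augmenting path starts from it. Every finite cocircuit
  through \<open>e\<close>, or through a permanently safe element committed elsewhere, acquires a further
  permanently safe element that is not committed elsewhere; here one minimises the part of the
  cocircuit that is not yet cospanned. Handling the countably many cocircuits in turn, the
  permanently safe elements carry a packing that omits \<open>e\<close>, a hindrance.
\<close>

section \<open>Matroids as closure operators\<close>

text \<open>A closure operator on the whole type lets contraction and the conversion of elements
  into loops act over one fixed ground set, so a family can be modified repeatedly. The stronger
  invariant, that only the empty set is packed, is what permits a commitment: it lowers the rank of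
  one matroid by at most one, and repairing that rank turns a packing with a leftover into a packing
  of a nonempty set, which unhinderedness alone would tolerate. Cofinitary matroids need care
  because an increasing union of independent sets may contain an infinite circuit. A circuit never
  meets a cocircuit in exactly one element, so once \<open>e\<close> is in the dual span of the
  elements committed elsewhere, no circuit through \<open>e\<close> can arise in the limit. To find
  such a stage, the set already committed to matroid \<open>i\<close> is released and made into
  loops of all other matroids; every packed set then initially lies inside these loops. Countability
  enters twice: elements are committed one by one, and the finite cocircuits form a countable list
  of tasks.\<close>

definition ind :: "('a set \<Rightarrow> 'a set) \<Rightarrow> 'a set \<Rightarrow> bool" where
  "ind c I \<longleftrightarrow> (\<forall>x\<in>I. x \<notin> c (I - {x}))"

text \<open>The last clause is the maximality axiom of infinite matroids: idempotence and exchange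
  alone do not provide bases.\<close>

definition matroid_closure :: "('a set \<Rightarrow> 'a set) \<Rightarrow> bool" where
  "matroid_closure c \<longleftrightarrow>
     (\<forall>X. X \<subseteq> c X) \<and> (\<forall>X Y. X \<subseteq> Y \<longrightarrow> c X \<subseteq> c Y) \<and> (\<forall>X. c (c X) \<subseteq> c X) \<and>
     (\<forall>a b X. b \<in> c (insert a X) \<longrightarrow> b \<notin> c X \<longrightarrow> a \<in> c (insert b X)) \<and>
     (\<forall>I X. I \<subseteq> X \<longrightarrow> ind c I \<longrightarrow> (\<exists>B. I \<subseteq> B \<and> B \<subseteq> X \<and> ind c B \<and> X \<subseteq> c B))"

lemma matroid_closureI:
  assumes "\<And>X. X \<subseteq> c X" "\<And>X Y. X \<subseteq> Y \<Longrightarrow> c X \<subseteq> c Y" "\<And>X. c (c X) \<subseteq> c X"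
    and "\<And>a b X. b \<in> c (insert a X) \<Longrightarrow> b \<notin> c X \<Longrightarrow> a \<in> c (insert b X)"
    and "\<And>I X. I \<subseteq> X \<Longrightarrow> ind c I \<Longrightarrow> \<exists>B. I \<subseteq> B \<and> B \<subseteq> X \<and> ind c B \<and> X \<subseteq> c B"
  shows "matroid_closure c"
  unfolding matroid_closure_def using assms by simp

lemma mc_ext: "matroid_closure c \<Longrightarrow> X \<subseteq> c X"
  by (simp add: matroid_closure_def)

lemma mc_in: "matroid_closure c \<Longrightarrow> x \<in> X \<Longrightarrow> x \<in> c X"
  using mc_ext by blast

lemma mc_mono: "matroid_closure c \<Longrightarrow> X \<subseteq> Y \<Longrightarrow> c X \<subseteq> c Y"
  by (simp add: matroid_closure_def)

lemma mc_monoD: "matroid_closure c \<Longrightarrow> x \<in> c X \<Longrightarrow> X \<subseteq> Y \<Longrightarrow> x \<in> c Y"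
  using mc_mono by blast

lemma mc_idem: "matroid_closure c \<Longrightarrow> c (c X) = c X"
  by (meson matroid_closure_def subset_antisym)

lemma mc_sub: "matroid_closure c \<Longrightarrow> X \<subseteq> c Y \<Longrightarrow> c X \<subseteq> c Y"
  using mc_idem mc_mono by metis

lemma mc_subD: "matroid_closure c \<Longrightarrow> x \<in> c X \<Longrightarrow> X \<subseteq> c Y \<Longrightarrow> x \<in> c Y"
  using mc_sub by blast

lemma mc_exchange:
  "matroid_closure c \<Longrightarrow> b \<in> c (insert a X) \<Longrightarrow> b \<notin> c X \<Longrightarrow> a \<in> c (insert b X)"
  unfolding matroid_closure_def by blast

lemma mc_base:
  "matroid_closure c \<Longrightarrow> ind c I \<Longrightarrow> I \<subseteq> X \<Longrightarrow>
    \<exists>B. I \<subseteq> B \<and> B \<subseteq> X \<and> ind c B \<and> X \<subseteq> c B"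
  unfolding matroid_closure_def by blast

lemma ind_empty [simp]: "ind c {}"
  by (simp add: ind_def)

lemma indD: "ind c I \<Longrightarrow> x \<in> I \<Longrightarrow> x \<notin> c (I - {x})"
  by (simp add: ind_def)

lemma ind_subset:
  assumes "matroid_closure c" "ind c I" "J \<subseteq> I"
  shows "ind c J"
  unfolding ind_def
proof
  fix x assume "x \<in> J"
  then have "x \<notin> c (I - {x})" using assms by (auto dest: indD)
  then show "x \<notin> c (J - {x})" using mc_monoD[OF assms(1), of x "J - {x}" "I - {x}"] assms(3) by blast
qed

lemma mc_base_of: "matroid_closure c \<Longrightarrow> \<exists>B. B \<subseteq> X \<and> ind c B \<and> X \<subseteq> c B"
  using mc_base[of c "{}" X] by auto

lemma ind_insert:
  assumes m: "matroid_closure c" and i: "ind c I" and x: "x \<notin> c I"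
  shows "ind c (insert x I)"
  unfolding ind_def
proof
  fix y assume y: "y \<in> insert x I"
  have xI: "x \<notin> I" using mc_in[OF m] x by blast
  show "y \<notin> c (insert x I - {y})"
  proof (cases "y = x")
    case True
    then show ?thesis using x xI by simp
  next
    case False
    then have yI: "y \<in> I" and eq: "insert x I - {y} = insert x (I - {y})" using y by auto
    show ?thesis
    proof
      assume "y \<in> c (insert x I - {y})"
      then have "x \<in> c (insert y (I - {y}))"
        using mc_exchange[OF m, of y x "I - {y}"] indD[OF i yI] eq by simp
      then show False using x yI by (simp add: insert_absorb)
    qed
  qed
qed

text \<open>For \<open>x \<notin> I\<close> the set is the fundamental circuit of \<open>x\<close>
  without \<open>x\<close>. If it did not span \<open>x\<close>, it could be completed together with
  \<open>x\<close> to a base of \<open>insert x I\<close>. That base drops some \<open>y\<close> of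
  \<open>I\<close>; but \<open>I - {y}\<close> still spans \<open>x\<close>, hence the base, hence
  \<open>y\<close>.\<close>

lemma fundamental_circuit:
  assumes m: "matroid_closure c" and i: "ind c I" and x: "x \<in> c I"
  shows "x \<in> c {y \<in> I. x \<notin> c (I - {y})}"
proof (rule ccontr)
  define C where "C = {y \<in> I. x \<notin> c (I - {y})}"
  assume "x \<notin> c {y \<in> I. x \<notin> c (I - {y})}"
  then have xC: "x \<notin> c C" by (simp add: C_def)
  have "ind c C" by (rule ind_subset[OF m i]) (auto simp: C_def)
  then have "ind c (insert x C)" using ind_insert[OF m _ xC] by simp
  moreover have "insert x C \<subseteq> insert x I" by (auto simp: C_def)
  ultimately obtain B where B: "insert x C \<subseteq> B" "B \<subseteq> insert x I" "ind c B" "insert x I \<subseteq> c B"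
    using mc_base[OF m, of "insert x C" "insert x I"] by blast
  have xI: "x \<notin> I"
  proof
    assume "x \<in> I"
    then have "x \<in> C" using indD[OF i] by (simp add: C_def)
    then show False using xC mc_in[OF m] by blast
  qed
  have "\<not> I \<subseteq> B"
  proof
    assume "I \<subseteq> B"
    then have "I \<subseteq> B - {x}" using xI by blast
    then have "x \<in> c (B - {x})" using mc_monoD[OF m x] by blast
    then show False using indD[OF B(3)] B(1) by blast
  qed
  then obtain y where y: "y \<in> I" "y \<notin> B" by blast
  have "x \<in> c (I - {y})" using y B(1) by (auto simp: C_def)
  then have "B \<subseteq> c (I - {y})" using B(2) y mc_ext[OF m, of "I - {y}"] by blast
  then have "y \<in> c (I - {y})" using B(4) y mc_subD[OF m, of y B] by blast
  then show False using indD[OF i] y by blast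
qed

lemma span_insert_eq:
  assumes m: "matroid_closure c" and a: "a \<in> c (insert w J)" "a \<notin> c J"
  shows "c (insert a J) = c (insert w J)"
proof
  show "c (insert a J) \<subseteq> c (insert w J)"
    by (rule mc_sub[OF m]) (use a mc_ext[OF m, of "insert w J"] in auto)
  have "w \<in> c (insert a J)" using mc_exchange[OF m a] .
  then show "c (insert w J) \<subseteq> c (insert a J)"
    by (intro mc_sub[OF m]) (use mc_ext[OF m, of "insert a J"] in auto)
qed

section \<open>Contraction, and turning elements into loops\<close>

lemma mc_union_cong:
  assumes m: "matroid_closure c" and "c Y = c Z"
  shows "c (X \<union> Y) = c (X \<union> Z)"
proof -
  have "X \<union> Y \<subseteq> c (X \<union> Z)" if "c Y = c Z" for Y Z
    using mc_ext[OF m, of "X \<union> Z"] mc_ext[OF m, of Y] mc_mono[OF m, of Z "X \<union> Z"] that by auto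
  from this[of Y Z] this[of Z Y] show ?thesis
    using mc_sub[OF m] assms(2) by (metis subset_antisym)
qed

text \<open>A base of \<open>I \<union> B\<close> above \<open>B\<close> cannot omit an
  \<open>x\<close> of \<open>I\<close>: it would lie in \<open>(I - {x}) \<union> Y\<close>, whose
  closure misses \<open>x\<close>.\<close>

lemma ind_contract_union:
  assumes m: "matroid_closure c" and I: "ind (\<lambda>X. c (X \<union> Y)) I" and B: "ind c B" "B \<subseteq> Y"
  shows "ind c (I \<union> B)"
proof -
  obtain B1 where B1: "B \<subseteq> B1" "B1 \<subseteq> I \<union> B" "ind c B1" "I \<union> B \<subseteq> c B1"
    using mc_base[OF m B(1), of "I \<union> B"] by blast
  have "I \<subseteq> B1"
  proof
    fix x assume x: "x \<in> I"
    show "x \<in> B1"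
    proof (rule ccontr)
      assume "x \<notin> B1"
      then have "B1 \<subseteq> (I - {x}) \<union> Y" using B1 B by blast
      moreover have "x \<in> c B1" using x B1 by blast
      ultimately have "x \<in> c ((I - {x}) \<union> Y)" using mc_monoD[OF m] by blast
      then show False using indD[OF I x] by simp
    qed
  qed
  then have "B1 = I \<union> B" using B1 by blast
  then show ?thesis using B1 by simp
qed

lemma ind_contract_self:
  assumes "matroid_closure c" "ind c J" "ind (\<lambda>X. c (X \<union> J)) T"
  shows "ind c (J \<union> T)"
  using ind_contract_union[OF assms(1,3,2)] by (simp add: Un_commute)

text \<open>Only bases need an argument: a base of \<open>Y\<close> is joined to \<open>I\<close>,
  extended with respect to \<open>c\<close>, and the part in \<open>Y\<close> is removed
  again.\<close>

lemma matroid_closure_contract: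
  assumes m: "matroid_closure c"
  shows "matroid_closure (\<lambda>X. c (X \<union> Y))"
proof (rule matroid_closureI)
  fix X show "X \<subseteq> c (X \<union> Y)" using mc_ext[OF m] by blast
next
  fix X Z :: "'a set" assume "X \<subseteq> Z"
  then show "c (X \<union> Y) \<subseteq> c (Z \<union> Y)" by (intro mc_mono[OF m]) auto
next
  fix X show "c (c (X \<union> Y) \<union> Y) \<subseteq> c (X \<union> Y)"
    by (rule mc_sub[OF m]) (use mc_ext[OF m, of "X \<union> Y"] in auto)
next
  fix a b X assume "b \<in> c (insert a X \<union> Y)" "b \<notin> c (X \<union> Y)"
  then show "a \<in> c (insert b X \<union> Y)" using mc_exchange[OF m] by simp
next
  fix I X assume IX: "I \<subseteq> X" and I: "ind (\<lambda>X. c (X \<union> Y)) I"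
  obtain BY where BY: "BY \<subseteq> Y" "ind c BY" "Y \<subseteq> c BY" using mc_base_of[OF m] by blast
  have "ind c (I \<union> BY)" by (rule ind_contract_union[OF m I BY(2,1)])
  then obtain B where B: "I \<union> BY \<subseteq> B" "B \<subseteq> X \<union> BY" "ind c B" "X \<union> BY \<subseteq> c B"
    using mc_base[OF m, of "I \<union> BY" "X \<union> BY"] IX by blast
  have BYB: "B \<inter> Y \<subseteq> BY"
  proof
    fix y assume y: "y \<in> B \<inter> Y"
    show "y \<in> BY"
    proof (rule ccontr)
      assume "y \<notin> BY"
      then have "BY \<subseteq> B - {y}" using B(1) by blast
      then have "y \<in> c (B - {y})" using mc_monoD[OF m, of y BY] BY(3) y by blast
      then show False using indD[OF B(3)] y by blast
    qed
  qed
  have cY: "c BY = c Y" using BY mc_sub[OF m] mc_mono[OF m] by (metis subset_antisym)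
  have "I \<inter> Y = {}"
  proof (rule ccontr)
    assume "I \<inter> Y \<noteq> {}"
    then obtain x where "x \<in> I" "x \<in> Y" by blast
    then show False using indD[OF I] mc_in[OF m, of x "I - {x} \<union> Y"] by blast
  qed
  then have "I \<subseteq> B - Y" using B by blast
  moreover have "B - Y \<subseteq> X" using B BY by blast
  moreover have "ind (\<lambda>X. c (X \<union> Y)) (B - Y)"
    unfolding ind_def
  proof
    fix x assume x: "x \<in> B - Y"
    have "c (B - Y - {x} \<union> Y) = c (B - Y - {x} \<union> BY)"
      using mc_union_cong[OF m cY] by metis
    moreover have "B - Y - {x} \<union> BY = B - {x}" using BYB B(1) x BY(1) by blast
    ultimately show "x \<notin> c (B - Y - {x} \<union> Y)" using indD[OF B(3)] x by simp
  qed
  moreover have "X \<subseteq> c (B - Y \<union> Y)"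
    using B(4) mc_mono[OF m, of B "B - Y \<union> Y"] by blast
  ultimately show "\<exists>B. I \<subseteq> B \<and> B \<subseteq> X \<and> ind (\<lambda>X. c (X \<union> Y)) B \<and> X \<subseteq> c (B \<union> Y)" by blast
qed

text \<open>Deleting \<open>P\<close> and adding it back as loops preserves the common ground set:
  these elements are spanned for free and span nothing.\<close>

lemma matroid_closure_loops:
  assumes m: "matroid_closure c"
  shows "matroid_closure (\<lambda>X. c (X - P) \<union> P)"
proof (rule matroid_closureI)
  fix X show "X \<subseteq> c (X - P) \<union> P" using mc_ext[OF m, of "X - P"] by blast
next
  fix X Z :: "'a set" assume "X \<subseteq> Z"
  then show "c (X - P) \<union> P \<subseteq> c (Z - P) \<union> P" using mc_mono[OF m, of "X - P" "Z - P"] by blast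
next
  fix X
  have "c (c (X - P) \<union> P - P) \<subseteq> c (X - P)" by (rule mc_sub[OF m]) auto
  then show "c (c (X - P) \<union> P - P) \<union> P \<subseteq> c (X - P) \<union> P" by blast
next
  fix a b X assume b: "b \<in> c (insert a X - P) \<union> P" "b \<notin> c (X - P) \<union> P"
  then have aP: "a \<notin> P" by (auto simp: insert_Diff_if)
  then have "a \<in> c (insert b (X - P))"
    using b mc_exchange[OF m, of b a "X - P"] by (auto simp: insert_Diff_if)
  then show "a \<in> c (insert b X - P) \<union> P" using b by (auto simp: insert_Diff_if)
next
  fix I X assume IX: "I \<subseteq> X" and I: "ind (\<lambda>X. c (X - P) \<union> P) I"
  have IP: "I \<inter> P = {}" using I by (auto simp: ind_def)
  have eq: "ind (\<lambda>X. c (X - P) \<union> P) B \<longleftrightarrow> ind c B" if "B \<inter> P = {}" for B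
  proof -
    have "B - {x} - P = B - {x}" for x using that by blast
    then show ?thesis using that by (auto simp: ind_def)
  qed
  obtain B where B: "I \<subseteq> B" "B \<subseteq> X - P" "ind c B" "X - P \<subseteq> c B"
    using mc_base[OF m, of I "X - P"] eq[OF IP] I IX IP by blast
  have BP: "B \<inter> P = {}" "B - P = B" using B by auto
  show "\<exists>B. I \<subseteq> B \<and> B \<subseteq> X \<and> ind (\<lambda>X. c (X - P) \<union> P) B \<and> X \<subseteq> c (B - P) \<union> P"
    using B eq[OF BP(1)] BP(2) by (intro exI[of _ B]) auto
qed

text \<open>The circuit of \<open>x\<close> survives inside \<open>J'\<close>: if \<open>x\<close>
  were spanned without \<open>y\<close>, exchange along the circuit would make \<open>y\<close>
  spanned by the rest of the independent set \<open>J'\<close>.\<close>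

lemma fundamental_circuit_persists:
  assumes m: "matroid_closure c" and J: "ind c J" "x \<in> c J" and J': "ind c J'"
    and D: "{y \<in> J. x \<notin> c (J - {y})} \<subseteq> J'" and y: "y \<in> J" "x \<notin> c (J - {y})"
  shows "x \<notin> c (J' - {y})"
proof
  assume x': "x \<in> c (J' - {y})"
  define D where "D = {y \<in> J. x \<notin> c (J - {y})}"
  have yD: "y \<in> D" using y by (simp add: D_def)
  have "x \<in> c (insert y (D - {y}))"
    using fundamental_circuit[OF m J] yD by (simp add: D_def insert_absorb)
  moreover have "x \<notin> c (D - {y})" using y mc_monoD[OF m, of x "D - {y}" "J - {y}"]
    by (auto simp: D_def)
  ultimately have "y \<in> c (insert x (D - {y}))" by (rule mc_exchange[OF m])
  moreover have "insert x (D - {y}) \<subseteq> c (J' - {y})"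
    using x' D mc_ext[OF m, of "J' - {y}"] by (auto simp: D_def)
  ultimately have "y \<in> c (J' - {y})" by (rule mc_subD[OF m])
  then show False using indD[OF J'] yD D by (auto simp: D_def)
qed

section \<open>Packings and augmenting paths\<close>

definition packing :: "'i set \<Rightarrow> ('i \<Rightarrow> 'a set \<Rightarrow> 'a set) \<Rightarrow> 'a set \<Rightarrow> ('i \<Rightarrow> 'a set) \<Rightarrow> bool" where
  "packing \<Theta> C W S \<longleftrightarrow> (\<forall>k\<in>\<Theta>. S k \<subseteq> W \<and> W \<subseteq> C k (S k)) \<and> disjoint_family_on S \<Theta>"

definition unhindered :: "'i set \<Rightarrow> ('i \<Rightarrow> 'a set \<Rightarrow> 'a set) \<Rightarrow> 'a set \<Rightarrow> bool" where
  "unhindered \<Theta> C G \<longleftrightarrow> (\<forall>W S. W \<subseteq> G \<longrightarrow> packing \<Theta> C W S \<longrightarrow> W \<subseteq> (\<Union>k\<in>\<Theta>. S k))"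

lemma disjoint_familyD:
  "disjoint_family_on S \<Theta> \<Longrightarrow> j \<in> \<Theta> \<Longrightarrow> k \<in> \<Theta> \<Longrightarrow> x \<in> S j \<Longrightarrow> x \<in> S k \<Longrightarrow> j = k"
  by (auto simp: disjoint_family_on_def)

lemma disjoint_familyI:
  "(\<And>j k x. j \<in> \<Theta> \<Longrightarrow> k \<in> \<Theta> \<Longrightarrow> x \<in> S j \<Longrightarrow> x \<in> S k \<Longrightarrow> j = k) \<Longrightarrow> disjoint_family_on S \<Theta>"
  by (auto simp: disjoint_family_on_def)

lemma unhinderedD:
  "unhindered \<Theta> C G \<Longrightarrow> W \<subseteq> G \<Longrightarrow> packing \<Theta> C W S \<Longrightarrow> W \<subseteq> (\<Union>k\<in>\<Theta>. S k)"
  by (simp add: unhindered_def)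

lemma disjoint_family_on_mono:
  "disjoint_family_on S \<Theta> \<Longrightarrow> (\<And>k. k \<in> \<Theta> \<Longrightarrow> S' k \<subseteq> S k) \<Longrightarrow> disjoint_family_on S' \<Theta>"
  by (rule disjoint_familyI, rule disjoint_familyD[of S]) auto

lemma maximal_packing:
  fixes C :: "'i \<Rightarrow> 'a set \<Rightarrow> 'a set"
  assumes mc: "\<And>k. k \<in> \<Theta> \<Longrightarrow> matroid_closure (C k)"
  obtains W S where "W \<subseteq> G" "packing \<Theta> C W S"
    "\<And>W' S'. W' \<subseteq> G \<Longrightarrow> packing \<Theta> C W' S' \<Longrightarrow> W \<subseteq> W' \<Longrightarrow> (\<And>k. k \<in> \<Theta> \<Longrightarrow> S k \<subseteq> S' k) \<Longrightarrow> W' \<subseteq> W"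
proof -
  \<comment> \<open>Carrier and members are coded as one set of pairs, \<open>(x, None)\<close> for
    the carrier and \<open>(x, Some k)\<close> for the \<open>k\<close>-th member, so that Zorn's
    lemma for plain inclusion applies.\<close>
  define Wd where "Wd A = {x. (x, None) \<in> A}" for A :: "('a \<times> 'i option) set"
  define Sd where "Sd A k = {x. (x, Some k) \<in> A}" for A :: "('a \<times> 'i option) set" and k
  define \<A> where "\<A> = {A. Wd A \<subseteq> G \<and> packing \<Theta> C (Wd A) (Sd A)}"
  have "\<exists>M\<in>\<A>. \<forall>X\<in>\<A>. M \<subseteq> X \<longrightarrow> X = M"
  proof (rule subset_Zorn')
    fix \<C> assume ch: "subset.chain \<A> \<C>"
    have sub: "\<C> \<subseteq> \<A>" using ch by (simp add: subset_chain_def)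
    have Wd: "Wd (\<Union>\<C>) = (\<Union>A\<in>\<C>. Wd A)" and Sd: "Sd (\<Union>\<C>) k = (\<Union>A\<in>\<C>. Sd A k)" for k
      by (auto simp: Wd_def Sd_def)
    have pk: "packing \<Theta> C (Wd A) (Sd A)" "Wd A \<subseteq> G" if "A \<in> \<C>" for A
      using sub that by (auto simp: \<A>_def)
    have "packing \<Theta> C (Wd (\<Union>\<C>)) (Sd (\<Union>\<C>))"
      unfolding packing_def
    proof (intro conjI ballI)
      fix k assume k: "k \<in> \<Theta>"
      show "Sd (\<Union>\<C>) k \<subseteq> Wd (\<Union>\<C>)"
        unfolding Wd Sd using pk k by (fastforce simp: packing_def)
      show "Wd (\<Union>\<C>) \<subseteq> C k (Sd (\<Union>\<C>) k)"
      proof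
        fix x assume "x \<in> Wd (\<Union>\<C>)"
        then obtain A where A: "A \<in> \<C>" "x \<in> Wd A" unfolding Wd by blast
        then have "x \<in> C k (Sd A k)" using pk k by (auto simp: packing_def)
        moreover have "Sd A k \<subseteq> Sd (\<Union>\<C>) k" using A unfolding Sd by blast
        ultimately show "x \<in> C k (Sd (\<Union>\<C>) k)" using mc_monoD[OF mc[OF k]] by blast
      qed
    next
      show "disjoint_family_on (Sd (\<Union>\<C>)) \<Theta>"
      proof (rule disjoint_familyI)
        fix j k x assume jk: "j \<in> \<Theta>" "k \<in> \<Theta>" and x: "x \<in> Sd (\<Union>\<C>) j" "x \<in> Sd (\<Union>\<C>) k"
        then obtain A B where AB: "A \<in> \<C>" "B \<in> \<C>" "x \<in> Sd A j" "x \<in> Sd B k" unfolding Sd by blast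
        then have "A \<subseteq> B \<or> B \<subseteq> A" using ch by (auto simp: subset_chain_def)
        then obtain D where "D \<in> \<C>" "x \<in> Sd D j" "x \<in> Sd D k" using AB by (auto simp: Sd_def)
        then show "j = k" using pk jk disjoint_familyD by (metis packing_def)
      qed
    qed
    moreover have "Wd (\<Union>\<C>) \<subseteq> G" unfolding Wd using pk by blast
    ultimately show "\<Union>\<C> \<in> \<A>" by (simp add: \<A>_def)
  qed
  then obtain M where M: "M \<in> \<A>" and max: "\<And>X. X \<in> \<A> \<Longrightarrow> M \<subseteq> X \<Longrightarrow> X = M" by blast
  show ?thesis
  proof (rule that[of "Wd M" "Sd M"])
    show "Wd M \<subseteq> G" "packing \<Theta> C (Wd M) (Sd M)" using M by (auto simp: \<A>_def)
    fix W' S' assume W': "W' \<subseteq> G" "packing \<Theta> C W' S'" "Wd M \<subseteq> W'"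
      and S': "\<And>k. k \<in> \<Theta> \<Longrightarrow> Sd M k \<subseteq> S' k"
    \<comment> \<open>Outside \<open>\<Theta>\<close> nothing is known of \<open>S'\<close>; the old
      members are kept there so that \<open>M \<subseteq> X\<close> holds.\<close>
    define X where "X = {(x, o'). case o' of None \<Rightarrow> x \<in> W'
        | Some k \<Rightarrow> x \<in> (if k \<in> \<Theta> then S' k else Sd M k)}"
    have WX: "Wd X = W'" and SX: "Sd X k = (if k \<in> \<Theta> then S' k else Sd M k)" for k
      by (auto simp: Wd_def Sd_def X_def)
    have "packing \<Theta> C W' (Sd X)"
      using W'(2) unfolding packing_def SX disjoint_family_on_def by simp
    then have "X \<in> \<A>" using W' by (simp add: \<A>_def WX)
    moreover have "M \<subseteq> X"
    proof
      fix p assume p: "p \<in> M"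
      obtain x o' where po: "p = (x, o')" by (cases p)
      show "p \<in> X"
        using p po W'(3) S' by (cases o') (auto simp: X_def Wd_def Sd_def)
    qed
    ultimately have "X = M" using max by blast
    then show "W' \<subseteq> Wd M" using WX by blast
  qed
qed

text \<open>Trimming \<open>S k\<close> to a base keeps a packing; any element dropped would be left
  over, by disjointness.\<close>

lemma unhindered_packing_ind:
  assumes mc: "\<And>k. k \<in> \<Theta> \<Longrightarrow> matroid_closure (C k)"
    and u: "unhindered \<Theta> C G" and W: "W \<subseteq> G" and p: "packing \<Theta> C W S" and k: "k \<in> \<Theta>"
  shows "ind (C k) (S k)"
proof -
  obtain B where B: "B \<subseteq> S k" "ind (C k) B" "S k \<subseteq> C k B" using mc_base_of[OF mc[OF k]] by blast
  have "packing \<Theta> C W (S(k := B))"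
    unfolding packing_def
  proof (intro conjI ballI)
    fix j assume j: "j \<in> \<Theta>"
    show "(S(k := B)) j \<subseteq> W" using p j B by (auto simp: packing_def)
    show "W \<subseteq> C j ((S(k := B)) j)"
      using p j mc_sub[OF mc[OF k] B(3)] by (auto simp: packing_def)
  next
    show "disjoint_family_on (S(k := B)) \<Theta>"
      by (rule disjoint_family_on_mono[of S]) (use p B in \<open>auto simp: packing_def\<close>)
  qed
  then have un: "W \<subseteq> (\<Union>j\<in>\<Theta>. (S(k := B)) j)" by (rule unhinderedD[OF u W])
  have dj: "disjoint_family_on S \<Theta>" and SW: "S k \<subseteq> W" using p k by (auto simp: packing_def)
  have "x \<in> B" if x: "x \<in> S k" for x
  proof -
    obtain j where j: "j \<in> \<Theta>" "x \<in> (S(k := B)) j" using un SW x by blast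
    show ?thesis
    proof (cases "j = k")
      case True then show ?thesis using j by simp
    next
      case False
      then show ?thesis using disjoint_familyD[OF dj j(1) k _ x] j(2) by simp
    qed
  qed
  then have "S k \<subseteq> B" by blast
  then show ?thesis using B by (simp add: subset_antisym)
qed

text \<open>Deleting \<open>y\<close> from its set would let \<open>x\<close> enter. If
  \<open>J k\<close> spans \<open>x\<close>, these \<open>y\<close> form the fundamental circuit of
  \<open>x\<close>; otherwise every \<open>y\<close> in \<open>J k\<close> qualifies and
  \<open>x\<close> is itself \<open>free\<close>.\<close>

definition arc :: "'i set \<Rightarrow> ('i \<Rightarrow> 'a set \<Rightarrow> 'a set) \<Rightarrow> ('i \<Rightarrow> 'a set) \<Rightarrow> 'a \<Rightarrow> 'a \<Rightarrow> bool" where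
  "arc \<Theta> C J x y \<longleftrightarrow> (\<exists>k\<in>\<Theta>. y \<in> J k \<and> x \<notin> C k (J k - {y}))"

definition free :: "'i set \<Rightarrow> ('i \<Rightarrow> 'a set \<Rightarrow> 'a set) \<Rightarrow> ('i \<Rightarrow> 'a set) \<Rightarrow> 'a \<Rightarrow> bool" where
  "free \<Theta> C J x \<longleftrightarrow> (\<exists>k\<in>\<Theta>. x \<notin> C k (J k))"

definition reaches :: "'i set \<Rightarrow> ('i \<Rightarrow> 'a set \<Rightarrow> 'a set) \<Rightarrow> ('i \<Rightarrow> 'a set) \<Rightarrow> 'a \<Rightarrow> bool" where
  "reaches \<Theta> C J x \<longleftrightarrow> (\<exists>y. (arc \<Theta> C J)\<^sup>*\<^sup>* x y \<and> free \<Theta> C J y)"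

lemma reaches_arc: "arc \<Theta> C J x y \<Longrightarrow> reaches \<Theta> C J y \<Longrightarrow> reaches \<Theta> C J x"
  unfolding reaches_def by (blast intro: converse_rtranclp_into_rtranclp)

text \<open>Augmentation along a path, performing the last exchange first: it turns the target
  \<open>q\<close> into the index in which the previous path vertex was blocked, and the remaining initial
  segment (cut at its first vertex that is now insertable) is again a path. \<open>T\<close> records the
  spans to be attained.\<close>

lemma augment_path:
  fixes w :: "nat \<Rightarrow> 'a"
  assumes mc: "\<And>k. k \<in> \<Theta> \<Longrightarrow> matroid_closure (C k)"
    and "\<And>k. k \<in> \<Theta> \<Longrightarrow> ind (C k) (J k)" and "disjoint_family_on J \<Theta>"
    and "w 0 \<notin> (\<Union>k\<in>\<Theta>. J k)" and "q \<in> \<Theta>"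
    and "\<And>k. k \<in> \<Theta> \<Longrightarrow> k \<noteq> q \<Longrightarrow> C k (J k) = T k"
    and "\<And>a. a \<in> T q \<Longrightarrow> a \<notin> C q (J q) \<Longrightarrow> C q (insert a (J q)) = T q"
    and "w n \<in> T q" and "w n \<notin> C q (J q)"
    and "\<And>j. j < n \<Longrightarrow> \<exists>k\<in>\<Theta>. w (Suc j) \<in> J k \<and> w j \<in> T k \<and> w j \<notin> C k (J k - {w (Suc j)})"
  shows "\<exists>J'. (\<forall>k\<in>\<Theta>. ind (C k) (J' k) \<and> C k (J' k) = T k) \<and> disjoint_family_on J' \<Theta> \<and>
    (\<Union>k\<in>\<Theta>. J' k) = insert (w 0) (\<Union>k\<in>\<Theta>. J k) \<and>
    (\<forall>k\<in>\<Theta>. \<forall>x. (x \<in> J k) \<noteq> (x \<in> J' k) \<longrightarrow> x \<in> w ` {..n})"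
  using assms(2-)
proof (induction n arbitrary: J q rule: less_induct)
  case (less n)
  note ind = less.prems(1) and disj = less.prems(2) and w0 = less.prems(3) and q = less.prems(4)
    and TJ = less.prems(5) and Tq = less.prems(6) and wn = less.prems(7,8) and arcs = less.prems(9)
  define m where "m = (LEAST m. w m \<in> T q \<and> w m \<notin> C q (J q))"
  have m: "w m \<in> T q" "w m \<notin> C q (J q)" "m \<le> n"
    unfolding m_def using LeastI[of "\<lambda>m. w m \<in> T q \<and> w m \<notin> C q (J q)" n] wn
    by (auto intro: Least_le)
  have least: "w j \<in> C q (J q)" if "j < m" "w j \<in> T q" for j
    using not_less_Least[of j "\<lambda>m. w m \<in> T q \<and> w m \<notin> C q (J q)"] that by (auto simp: m_def)
  have wmq: "w m \<notin> J q" using m mc_in[OF mc[OF q]] by blast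
  show ?case
  proof (cases m)
    case 0
    define J' where "J' = J(q := insert (w 0) (J q))"
    have "\<forall>k\<in>\<Theta>. ind (C k) (J' k) \<and> C k (J' k) = T k"
      using ind TJ Tq m 0 q by (auto simp: J'_def intro!: ind_insert mc)
    moreover have "disjoint_family_on J' \<Theta>"
      using disj w0 q by (auto simp: J'_def disjoint_family_on_def)
    moreover have "(\<Union>k\<in>\<Theta>. J' k) = insert (w 0) (\<Union>k\<in>\<Theta>. J k)" using q by (auto simp: J'_def)
    moreover have "\<forall>k\<in>\<Theta>. \<forall>x. (x \<in> J k) \<noteq> (x \<in> J' k) \<longrightarrow> x \<in> w ` {..n}"
      by (auto simp: J'_def)
    ultimately show ?thesis by blast
  next
    case (Suc m')
    then have m': "m' < n" "m' < m" using m by auto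
    obtain p where p: "p \<in> \<Theta>" "w m \<in> J p" "w m' \<in> T p" "w m' \<notin> C p (J p - {w m})"
      using arcs[OF m'(1)] Suc by auto
    have pq: "p \<noteq> q" using p wmq by blast
    define J1 where "J1 = J(q := insert (w m) (J q), p := J p - {w m})"
    have J1: "J1 q = insert (w m) (J q)" "J1 p = J p - {w m}" "\<And>k. k \<noteq> q \<Longrightarrow> k \<noteq> p \<Longrightarrow> J1 k = J k"
      using pq by (auto simp: J1_def)
    have un: "(\<Union>k\<in>\<Theta>. J1 k) = (\<Union>k\<in>\<Theta>. J k)"
    proof
      show "(\<Union>k\<in>\<Theta>. J1 k) \<subseteq> (\<Union>k\<in>\<Theta>. J k)" using p by (auto simp: J1_def split: if_splits)
      show "(\<Union>k\<in>\<Theta>. J k) \<subseteq> (\<Union>k\<in>\<Theta>. J1 k)"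
      proof
        fix x assume "x \<in> (\<Union>k\<in>\<Theta>. J k)"
        then obtain k where k: "k \<in> \<Theta>" "x \<in> J k" by blast
        show "x \<in> (\<Union>k\<in>\<Theta>. J1 k)"
        proof (cases "x = w m")
          case True then show ?thesis using J1(1) q by auto
        next
          case False
          then have "x \<in> J1 k" using k by (auto simp: J1_def)
          then show ?thesis using k by blast
        qed
      qed
    qed
    have neq: "w j \<noteq> w m" if "j < m" for j using least[OF that] m by auto
    have "\<exists>J'. (\<forall>k\<in>\<Theta>. ind (C k) (J' k) \<and> C k (J' k) = T k) \<and> disjoint_family_on J' \<Theta> \<and>
      (\<Union>k\<in>\<Theta>. J' k) = insert (w 0) (\<Union>k\<in>\<Theta>. J1 k) \<and>
      (\<forall>k\<in>\<Theta>. \<forall>x. (x \<in> J1 k) \<noteq> (x \<in> J' k) \<longrightarrow> x \<in> w ` {..m'})"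
    proof (rule less.IH[OF m'(1), of J1 p])
      fix k assume k: "k \<in> \<Theta>"
      show "ind (C k) (J1 k)"
      proof (cases "k = q")
        case True
        then show ?thesis using ind_insert[OF mc[OF q] ind[OF q] m(2)] J1 by simp
      next
        case False
        then have "J1 k \<subseteq> J k" by (auto simp: J1_def)
        then show ?thesis using ind_subset[OF mc[OF k] ind[OF k]] by blast
      qed
    next
      show "disjoint_family_on J1 \<Theta>"
      proof (rule disjoint_familyI)
        fix j k x assume jk: "j \<in> \<Theta>" "k \<in> \<Theta>" and x: "x \<in> J1 j" "x \<in> J1 k"
        show "j = k"
        proof (cases "x = w m")
          case True
          have "l = q" if "l \<in> \<Theta>" "w m \<in> J1 l" for l
          proof (rule ccontr)
            assume "l \<noteq> q"
            then have "w m \<in> J l" "l \<noteq> p" using that by (auto simp: J1_def split: if_splits)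
            then show False using disjoint_familyD[OF disj that(1) p(1)] p(2) by blast
          qed
          then show ?thesis using jk x True by blast
        next
          case False
          then have "x \<in> J j" "x \<in> J k" using x by (auto simp: J1_def split: if_splits)
          then show ?thesis using disjoint_familyD[OF disj jk] by blast
        qed
      qed
    next
      show "w 0 \<notin> (\<Union>k\<in>\<Theta>. J1 k)" using w0 un by simp
      show "p \<in> \<Theta>" by (rule p(1))
    next
      fix k assume k: "k \<in> \<Theta>" "k \<noteq> p"
      show "C k (J1 k) = T k" using k J1 TJ Tq m by (cases "k = q") auto
    next
      \<comment> \<open>Without \<open>w m\<close> the span of \<open>J p\<close> drops by one
        dimension, so any element of \<open>T p\<close> outside the smaller span restores
        it.\<close>
      fix a assume a: "a \<in> T p" "a \<notin> C p (J1 p)"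
      have eq: "insert (w m) (J p - {w m}) = J p" using p by auto
      have "C p (insert a (J p - {w m})) = C p (insert (w m) (J p - {w m}))"
        by (rule span_insert_eq[OF mc[OF p(1)]]) (use a TJ[OF p(1) pq] J1 eq in auto)
      then show "C p (insert a (J1 p)) = T p" using eq J1 TJ[OF p(1) pq] by simp
    next
      show "w m' \<in> T p" "w m' \<notin> C p (J1 p)" using p J1 by auto
    next
      fix j assume j: "j < m'"
      then have jn: "j < n" "j < m" "Suc j < m" using m' Suc by auto
      obtain k where k: "k \<in> \<Theta>" "w (Suc j) \<in> J k" "w j \<in> T k" "w j \<notin> C k (J k - {w (Suc j)})"
        using arcs[OF jn(1)] by blast
      have mem: "w (Suc j) \<in> J1 k" using k neq[OF jn(3)] by (auto simp: J1_def)
      \<comment> \<open>Only the set at \<open>q\<close> gained an element. If \<open>w m\<close>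
        created a dependence there, exchange would put \<open>w m\<close> into the span of
        \<open>J q\<close>, because minimality of \<open>m\<close> keeps \<open>w j\<close> in that
        span.\<close>
      have "w j \<notin> C k (J1 k - {w (Suc j)})"
      proof (cases "k = q")
        case True
        show ?thesis
        proof
          assume "w j \<in> C k (J1 k - {w (Suc j)})"
          then have "w j \<in> C q (insert (w m) (J q - {w (Suc j)}))"
            using True J1 neq[OF jn(3)] by (simp add: insert_Diff_if)
          then have "w m \<in> C q (insert (w j) (J q - {w (Suc j)}))"
            using mc_exchange[OF mc[OF q]] k(4) True by blast
          moreover have "insert (w j) (J q - {w (Suc j)}) \<subseteq> C q (J q)"
            using least[OF jn(2)] k(3) True mc_ext[OF mc[OF q], of "J q"] by blast
          ultimately show False using m(2) mc_subD[OF mc[OF q]] by blast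
        qed
      next
        case False
        then have "J1 k - {w (Suc j)} \<subseteq> J k - {w (Suc j)}" by (auto simp: J1_def)
        then show ?thesis using k(4) mc_monoD[OF mc[OF k(1)]] by blast
      qed
      then show "\<exists>k\<in>\<Theta>. w (Suc j) \<in> J1 k \<and> w j \<in> T k \<and> w j \<notin> C k (J1 k - {w (Suc j)})"
        using k mem by blast
    qed
    then obtain J' where J': "\<forall>k\<in>\<Theta>. ind (C k) (J' k) \<and> C k (J' k) = T k" "disjoint_family_on J' \<Theta>"
      "(\<Union>k\<in>\<Theta>. J' k) = insert (w 0) (\<Union>k\<in>\<Theta>. J1 k)"
      "\<forall>k\<in>\<Theta>. \<forall>x. (x \<in> J1 k) \<noteq> (x \<in> J' k) \<longrightarrow> x \<in> w ` {..m'}" by blast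
    have "x \<in> w ` {..n}" if "k \<in> \<Theta>" "(x \<in> J k) \<noteq> (x \<in> J' k)" for k x
    proof (cases "x = w m")
      case True then show ?thesis using m(3) by blast
    next
      case False
      then have "(x \<in> J k) = (x \<in> J1 k)" by (auto simp: J1_def)
      then have "x \<in> w ` {..m'}" using J'(4) that by blast
      then show ?thesis using m'(1) by (auto simp: image_iff)
    qed
    then show ?thesis using J' un by (intro exI[of _ J']) simp
  qed
qed

text \<open>A shortest path to a free vertex is taken: its earlier vertices are not free, hence
  spanned by every member, as \<open>augment_path\<close> demands. The only span that grows is the
  one absorbing the end vertex.\<close>

lemma augment:
  assumes mc': "\<forall>k\<in>\<Theta>. matroid_closure (C k)"
    and ind': "\<forall>k\<in>\<Theta>. ind (C k) (J k)" and disj: "disjoint_family_on J \<Theta>"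
    and x: "x \<notin> (\<Union>k\<in>\<Theta>. J k)" and r: "reaches \<Theta> C J x"
  shows "\<exists>J' q w. q \<in> \<Theta> \<and> w \<notin> C q (J q) \<and> (arc \<Theta> C J)\<^sup>*\<^sup>* x w \<and>
    (\<forall>k\<in>\<Theta>. ind (C k) (J' k)) \<and> disjoint_family_on J' \<Theta> \<and>
    (\<Union>k\<in>\<Theta>. J' k) = insert x (\<Union>k\<in>\<Theta>. J k) \<and>
    (\<forall>k\<in>\<Theta>. k \<noteq> q \<longrightarrow> C k (J' k) = C k (J k)) \<and> C q (J' q) = C q (insert w (J q)) \<and>
    (\<forall>k\<in>\<Theta>. \<forall>z. (z \<in> J k) \<noteq> (z \<in> J' k) \<longrightarrow> reaches \<Theta> C J z)"
proof -
  note mc = mc'[rule_format] and ind = ind'[rule_format]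
  let ?P = "\<lambda>n. \<exists>f. f 0 = x \<and> (\<forall>i<n. arc \<Theta> C J (f i) (f (Suc i))) \<and> free \<Theta> C J (f n)"
  have "\<exists>n. ?P n"
    using r unfolding reaches_def by (metis rtranclp_imp_relpowp relpowp_fun_conv)
  define n where "n = (LEAST n. ?P n)"
  have "?P n" unfolding n_def by (rule LeastI_ex) fact
  then obtain f where f: "f 0 = x" "\<And>i. i < n \<Longrightarrow> arc \<Theta> C J (f i) (f (Suc i))" "free \<Theta> C J (f n)"
    by blast
  have nf: "\<not> free \<Theta> C J (f j)" if "j < n" for j
  proof
    assume "free \<Theta> C J (f j)"
    then have "?P j" using f that by (intro exI[of _ f]) auto
    then show False using that not_less_Least unfolding n_def by blast
  qed
  obtain q where q: "q \<in> \<Theta>" "f n \<notin> C q (J q)" using f(3) by (auto simp: free_def)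
  have path: "(arc \<Theta> C J)\<^sup>*\<^sup>* (f 0) (f n)"
    using f(2) by (metis relpowp_fun_conv relpowp_imp_rtranclp)
  have fr: "reaches \<Theta> C J (f j)" if "j \<le> n" for j
    using that
  proof (induction rule: inc_induct)
    case base then show ?case using f(3) by (auto simp: reaches_def)
  next
    case (step j) then show ?case using reaches_arc[OF f(2)] by blast
  qed
  define T where "T k = (if k = q then C q (insert (f n) (J q)) else C k (J k))" for k
  have sub: "C k (J k) \<subseteq> T k" if "k \<in> \<Theta>" for k
    using mc_mono[OF mc[OF that], of "J k" "insert (f n) (J k)"] by (auto simp: T_def)
  have "\<exists>J'. (\<forall>k\<in>\<Theta>. ind (C k) (J' k) \<and> C k (J' k) = T k) \<and> disjoint_family_on J' \<Theta> \<and>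
    (\<Union>k\<in>\<Theta>. J' k) = insert (f 0) (\<Union>k\<in>\<Theta>. J k) \<and>
    (\<forall>k\<in>\<Theta>. \<forall>x. (x \<in> J k) \<noteq> (x \<in> J' k) \<longrightarrow> x \<in> f ` {..n})"
  proof (rule augment_path[OF mc ind disj _ q(1)])
    show "f 0 \<notin> (\<Union>k\<in>\<Theta>. J k)" using x f by simp
    show "\<And>k. k \<in> \<Theta> \<Longrightarrow> k \<noteq> q \<Longrightarrow> C k (J k) = T k" by (simp add: T_def)
    show "C q (insert a (J q)) = T q" if "a \<in> T q" "a \<notin> C q (J q)" for a
      using that span_insert_eq[OF mc[OF q(1)], of a "f n" "J q"] by (simp add: T_def)
    show "f n \<in> T q" using mc_in[OF mc[OF q(1)]] by (simp add: T_def)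
    show "f n \<notin> C q (J q)" by (rule q(2))
    fix j assume j: "j < n"
    then obtain k where k: "k \<in> \<Theta>" "f (Suc j) \<in> J k" "f j \<notin> C k (J k - {f (Suc j)})"
      using f(2) by (auto simp: arc_def)
    moreover have "f j \<in> T k" using nf[OF j] k sub by (auto simp: free_def)
    ultimately show "\<exists>k\<in>\<Theta>. f (Suc j) \<in> J k \<and> f j \<in> T k \<and> f j \<notin> C k (J k - {f (Suc j)})" by blast
  qed
  then obtain J' where J': "\<And>k. k \<in> \<Theta> \<Longrightarrow> ind (C k) (J' k)" "\<And>k. k \<in> \<Theta> \<Longrightarrow> C k (J' k) = T k"
    "disjoint_family_on J' \<Theta>" "(\<Union>k\<in>\<Theta>. J' k) = insert x (\<Union>k\<in>\<Theta>. J k)"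
    "\<And>k z. k \<in> \<Theta> \<Longrightarrow> (z \<in> J k) \<noteq> (z \<in> J' k) \<Longrightarrow> z \<in> f ` {..n}" unfolding f(1) by blast
  show ?thesis
  proof (intro exI conjI ballI allI impI)
    show "q \<in> \<Theta>" "f n \<notin> C q (J q)" by fact+
    show "(arc \<Theta> C J)\<^sup>*\<^sup>* x (f n)" using path f by simp
    show "C k (J' k) = C k (J k)" if "k \<in> \<Theta>" "k \<noteq> q" for k using J'(2) that by (simp add: T_def)
    show "C q (J' q) = C q (insert (f n) (J q))" using J'(2)[OF q(1)] by (simp add: T_def)
    show "reaches \<Theta> C J z" if "k \<in> \<Theta>" "(z \<in> J k) \<noteq> (z \<in> J' k)" for k z
      using J'(5)[OF that] fr by auto
  qed (use J' in auto)
qed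

text \<open>Every element of the fundamental circuit of \<open>x\<close> is the target of an arc
  from \<open>x\<close>.\<close>

lemma arc_closed_span:
  assumes mc: "matroid_closure (C k)" and k: "k \<in> \<Theta>" and ind: "ind (C k) (J k)"
    and x: "x \<in> C k (J k)" and R: "\<And>y. arc \<Theta> C J x y \<Longrightarrow> y \<in> R"
  shows "x \<in> C k (J k \<inter> R)"
proof -
  have "{y \<in> J k. x \<notin> C k (J k - {y})} \<subseteq> J k \<inter> R" using R k by (auto simp: arc_def)
  then show ?thesis using mc_monoD[OF mc fundamental_circuit[OF mc ind x]] by blast
qed

text \<open>The leftover \<open>g\<close> pays for one missing dimension of matroid
  \<open>q\<close>. If \<open>g\<close> reaches a free vertex, the path can only end in that
  dimension, and augmenting fills it. Otherwise the elements reachable from \<open>g\<close> are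
  packed by the traces of the members with \<open>g\<close> left over, a hindrance. The second
  conclusion serves families whose packed sets consist of loops outside one index.\<close>

lemma almost_packing:
  assumes mc: "\<And>k. k \<in> \<Theta> \<Longrightarrow> matroid_closure (C k)"
    and u: "unhindered \<Theta> C G" and W: "W \<subseteq> G"
    and S: "\<And>k. k \<in> \<Theta> \<Longrightarrow> S k \<subseteq> W" and disj: "disjoint_family_on S \<Theta>" and q: "q \<in> \<Theta>"
    and sp: "\<And>k. k \<in> \<Theta> \<Longrightarrow> k \<noteq> q \<Longrightarrow> W \<subseteq> C k (S k)" and spq: "W \<subseteq> C q (insert x (S q))"
    and g: "g \<in> W" "g \<notin> (\<Union>k\<in>\<Theta>. S k)"
  shows "(\<exists>S'. packing \<Theta> C W S') \<and> \<not> W \<subseteq> C q {}"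
proof
  show "\<not> W \<subseteq> C q {}"
  proof
    assume "W \<subseteq> C q {}"
    then have "W \<subseteq> C q (S q)" using mc_mono[OF mc[OF q], of "{}" "S q"] by blast
    then have "W \<subseteq> C k (S k)" if "k \<in> \<Theta>" for k using sp[OF that] by (cases "k = q") auto
    then have "packing \<Theta> C W S" using S disj by (auto simp: packing_def)
    then show False using unhinderedD[OF u W] g by blast
  qed
  have "\<forall>k. \<exists>B. k \<in> \<Theta> \<longrightarrow> B \<subseteq> S k \<and> ind (C k) B \<and> S k \<subseteq> C k B" using mc_base_of[OF mc] by blast
  then obtain B where B: "\<And>k. k \<in> \<Theta> \<Longrightarrow> B k \<subseteq> S k" "\<And>k. k \<in> \<Theta> \<Longrightarrow> ind (C k) (B k)"
    "\<And>k. k \<in> \<Theta> \<Longrightarrow> S k \<subseteq> C k (B k)" by metis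
  have disjB: "disjoint_family_on B \<Theta>"
    by (rule disjoint_family_on_mono[OF disj B(1)])
  have mcB: "\<forall>k\<in>\<Theta>. matroid_closure (C k)" and indB: "\<forall>k\<in>\<Theta>. ind (C k) (B k)"
    using mc B(2) by blast+
  have gB: "g \<notin> (\<Union>k\<in>\<Theta>. B k)" using g B(1) by blast
  have BW: "B k \<subseteq> W" if "k \<in> \<Theta>" for k using B(1)[OF that] S[OF that] by blast
  have spB: "W \<subseteq> C k (B k)" if "k \<in> \<Theta>" "k \<noteq> q" for k
    using sp[OF that] mc_sub[OF mc[OF that(1)] B(3)[OF that(1)]] by blast
  have spBq: "W \<subseteq> C q (insert x (B q))"
  proof -
    have "insert x (S q) \<subseteq> C q (insert x (B q))"
      using B(3)[OF q] mc_mono[OF mc[OF q], of "B q" "insert x (B q)"] mc_in[OF mc[OF q], of x "insert x (B q)"]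
      by blast
    then show ?thesis using spq mc_sub[OF mc[OF q]] by blast
  qed
  define R where "R = {y. (arc \<Theta> C B)\<^sup>*\<^sup>* g y}"
  have RW: "R \<subseteq> W"
  proof
    fix y assume "y \<in> R"
    then have "(arc \<Theta> C B)\<^sup>*\<^sup>* g y" by (simp add: R_def)
    then show "y \<in> W" by (induction) (use g BW in \<open>auto simp: arc_def\<close>)
  qed
  show "\<exists>S'. packing \<Theta> C W S'"
  proof (cases "reaches \<Theta> C B g")
    case True
    obtain J' p w where J': "p \<in> \<Theta>" "w \<notin> C p (B p)" "(arc \<Theta> C B)\<^sup>*\<^sup>* g w"
      "disjoint_family_on J' \<Theta>" "(\<Union>k\<in>\<Theta>. J' k) = insert g (\<Union>k\<in>\<Theta>. B k)"
      "\<forall>k\<in>\<Theta>. k \<noteq> p \<longrightarrow> C k (J' k) = C k (B k)" "C p (J' p) = C p (insert w (B p))"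
      using augment[OF mcB indB disjB gB True] by (elim exE conjE) (rule that)
    have wW: "w \<in> W" using J'(3) RW by (auto simp: R_def)
    have pq: "p = q" using J'(1,2) spB[OF J'(1)] wW by blast
    have "C q (insert w (B q)) = C q (insert x (B q))"
      by (rule span_insert_eq[OF mc[OF q]]) (use spBq wW J'(2) pq in auto)
    then have "W \<subseteq> C k (J' k)" if "k \<in> \<Theta>" for k
      using J'(6,7) that pq spB spBq by (cases "k = q") auto
    moreover have "(\<Union>k\<in>\<Theta>. J' k) \<subseteq> W" unfolding J'(5) using g(1) BW by (simp add: UN_least)
    ultimately have "packing \<Theta> C W J'" using J'(4) by (simp add: packing_def UN_subset_iff)
    then show ?thesis by blast
  next
    case False
    have "packing \<Theta> C R (\<lambda>k. B k \<inter> R)"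
      unfolding packing_def
    proof (intro conjI ballI)
      fix k assume k: "k \<in> \<Theta>"
      show "R \<subseteq> C k (B k \<inter> R)"
      proof
        fix r assume r: "r \<in> R"
        then have "\<not> free \<Theta> C B r" using False by (auto simp: reaches_def R_def)
        then have "r \<in> C k (B k)" using k by (auto simp: free_def)
        then show "r \<in> C k (B k \<inter> R)"
        proof (rule arc_closed_span[where C = C and J = B, OF mc[OF k] k B(2)[OF k]])
          show "y \<in> R" if "arc \<Theta> C B r y" for y
            using r that by (auto simp: R_def)
        qed
      qed
    next
      show "disjoint_family_on (\<lambda>k. B k \<inter> R) \<Theta>" using disjB by (auto simp: disjoint_family_on_def)
    qed auto
    then have "R \<subseteq> (\<Union>k\<in>\<Theta>. B k \<inter> R)" using unhinderedD[OF u] RW W by blast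
    moreover have "g \<in> R" by (simp add: R_def)
    ultimately show ?thesis using gB by blast
  qed
qed

section \<open>Securing elements of a cofinitary matroid\<close>

locale distinguished_family =
  fixes \<Theta> :: "'i set" and C :: "'i \<Rightarrow> 'a set \<Rightarrow> 'a set" and i :: 'i and G :: "'a set"
  assumes mc: "\<And>k. k \<in> \<Theta> \<Longrightarrow> matroid_closure (C k)" and i: "i \<in> \<Theta>"
begin

text \<open>Nonempty packings may exist, but only among loops of all matroids other than
  \<open>i\<close>. This is what the absence of nonempty packings becomes when the set committed to
  \<open>i\<close> is released.\<close>

definition nice :: "('i \<Rightarrow> 'a set \<Rightarrow> 'a set) \<Rightarrow> 'a set \<Rightarrow> bool" where
  "nice D H \<longleftrightarrow> unhindered \<Theta> D H \<and>
     (\<forall>W S. W \<subseteq> H \<longrightarrow> packing \<Theta> D W S \<longrightarrow> (\<forall>k\<in>\<Theta> - {i}. W \<subseteq> D k {}))"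

abbreviation used :: "('i \<Rightarrow> 'a set) \<Rightarrow> 'a set" where
  "used J \<equiv> (\<Union>k\<in>\<Theta> - {i}. J k)"

text \<open>The span of \<open>used J\<close> in the dual of the \<open>i\<close>-th matroid restricted to \<open>G\<close>.\<close>

definition cospan :: "('i \<Rightarrow> 'a set) \<Rightarrow> 'a set" where
  "cospan J = {z \<in> G. z \<in> used J \<or> z \<notin> C i (G - used J - {z})}"

text \<open>What is left at stage \<open>J\<close>: elements given to \<open>k\<close> are
  contracted there, and they are deleted from the \<open>i\<close>-th matroid because the ground set
  shrinks to \<open>G - used J\<close>.\<close>

definition contr :: "('i \<Rightarrow> 'a set) \<Rightarrow> 'i \<Rightarrow> 'a set \<Rightarrow> 'a set" where
  "contr J k Y = (if k = i then C i Y else C k (Y \<union> J k))"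

text \<open>The last conjunct is independence of \<open>used J\<close> in the dual of the
  \<open>i\<close>-th matroid restricted to \<open>G\<close>: deleting it costs no rank.\<close>

definition prestate :: "('i \<Rightarrow> 'a set) \<Rightarrow> bool" where
  "prestate J \<longleftrightarrow> (\<forall>k\<in>\<Theta> - {i}. J k \<subseteq> G \<and> ind (C k) (J k)) \<and>
     disjoint_family_on J (\<Theta> - {i}) \<and> G \<subseteq> C i (G - used J)"

definition state :: "('i \<Rightarrow> 'a set) \<Rightarrow> bool" where
  "state J \<longleftrightarrow> prestate J \<and> nice (contr J) (G - used J)"

text \<open>Exchanges in the \<open>i\<close>-th matroid take place after contracting the complement of
  \<open>cospan J\<close>: there \<open>cospan J - used J\<close> is a base, and augmentations keep \<open>cospan J\<close> spanned.\<close>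

definition fam :: "('i \<Rightarrow> 'a set) \<Rightarrow> 'i \<Rightarrow> 'a set \<Rightarrow> 'a set" where
  "fam J k Y = (if k = i then C i (Y \<union> (G - cospan J)) else C k Y)"

text \<open>Index \<open>i\<close> receives the coloops of \<open>G - used J\<close>; with
  \<open>used J\<close> they fill exactly \<open>cospan J\<close>, so an augmentation can start at
  any vertex outside \<open>cospan J\<close>.\<close>

definition tot :: "('i \<Rightarrow> 'a set) \<Rightarrow> 'i \<Rightarrow> 'a set" where
  "tot J k = (if k = i then cospan J - used J else J k)"

definition safe :: "('i \<Rightarrow> 'a set) \<Rightarrow> 'a \<Rightarrow> bool" where
  "safe J x \<longleftrightarrow> \<not> reaches \<Theta> (fam J) (tot J) x"

text \<open>By the last conjunct the surviving part of the old base at \<open>i\<close> stays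
  independent over the old contraction. This makes \<open>cospan\<close> grow and lets arcs at
  \<open>i\<close> persist.\<close>

definition step :: "('i \<Rightarrow> 'a set) \<Rightarrow> ('i \<Rightarrow> 'a set) \<Rightarrow> bool" where
  "step J J' \<longleftrightarrow> state J \<and> state J' \<and>
     (\<forall>x k. safe J x \<longrightarrow> k \<in> \<Theta> - {i} \<longrightarrow> (x \<in> J k \<longleftrightarrow> x \<in> J' k)) \<and>
     ind (fam J i) (cospan J - used J')"

lemma mc_contr: "k \<in> \<Theta> \<Longrightarrow> matroid_closure (contr J k)"
  unfolding contr_def using mc matroid_closure_contract[OF mc] by (cases "k = i") auto

lemma mc_fam: "k \<in> \<Theta> \<Longrightarrow> matroid_closure (fam J k)"
  unfolding fam_def using mc matroid_closure_contract[OF mc] by (cases "k = i") auto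

lemma prestateD:
  assumes "prestate J"
  shows "k \<in> \<Theta> \<Longrightarrow> k \<noteq> i \<Longrightarrow> J k \<subseteq> G" "k \<in> \<Theta> \<Longrightarrow> k \<noteq> i \<Longrightarrow> ind (C k) (J k)"
    "disjoint_family_on J (\<Theta> - {i})" "G \<subseteq> C i (G - used J)" "used J \<subseteq> G"
  using assms unfolding prestate_def by auto

lemma cospan_sub: "cospan J \<subseteq> G"
  by (auto simp: cospan_def)

lemma used_sub_cospan: "prestate J \<Longrightarrow> used J \<subseteq> cospan J"
  using prestateD(5) by (auto simp: cospan_def)

lemma tot_Un: "prestate J \<Longrightarrow> (cospan J - used J) \<union> (G - cospan J) = G - used J"
  using used_sub_cospan cospan_sub by blast

lemma ind_fam_cospan:
  assumes "prestate J"
  shows "ind (fam J i) (cospan J - used J)"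
  unfolding ind_def
proof
  fix z assume z: "z \<in> cospan J - used J"
  have "cospan J - used J - {z} \<union> (G - cospan J) = G - used J - {z}"
    using tot_Un[OF assms] z by blast
  moreover have "z \<notin> C i (G - used J - {z})" using z by (auto simp: cospan_def)
  ultimately show "z \<notin> fam J i (cospan J - used J - {z})" by (simp add: fam_def)
qed

lemma ind_tot:
  assumes "prestate J" "k \<in> \<Theta>"
  shows "ind (fam J k) (tot J k)"
proof (cases "k = i")
  case True
  then show ?thesis using ind_fam_cospan[OF assms(1)] by (simp add: tot_def)
next
  case False
  then have "fam J k = C k" by (auto simp: fam_def)
  then show ?thesis using False prestateD(2)[OF assms False] by (simp add: tot_def)
qed

lemma disjoint_tot:
  assumes "prestate J"
  shows "disjoint_family_on (tot J) \<Theta>"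
proof (rule disjoint_familyI)
  fix j k x assume "j \<in> \<Theta>" "k \<in> \<Theta>" "x \<in> tot J j" "x \<in> tot J k"
  then show "j = k"
    using disjoint_familyD[OF prestateD(3)[OF assms], of j k x]
    by (cases "j = i"; cases "k = i") (auto simp: tot_def)
qed

lemma Union_tot:
  assumes "prestate J"
  shows "(\<Union>k\<in>\<Theta>. tot J k) = cospan J"
proof -
  have "(\<Union>k\<in>\<Theta>. tot J k) = tot J i \<union> (\<Union>k\<in>\<Theta> - {i}. tot J k)" using i by blast
  moreover have "(\<Union>k\<in>\<Theta> - {i}. tot J k) = used J" by (auto simp: tot_def)
  ultimately show ?thesis using used_sub_cospan[OF assms] by (auto simp: tot_def)
qed

lemma fam_tot_i: "prestate J \<Longrightarrow> fam J i (tot J i) = C i (G - used J)"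
  by (simp add: fam_def tot_def tot_Un)

text \<open>A circuit inside \<open>G - used J\<close> contains no coloop, so one through
  \<open>a\<close> avoids \<open>cospan J\<close>. In the proof, with the remaining elements outside
  \<open>cospan J\<close> contracted, the fundamental circuit of \<open>a\<close> over
  \<open>cospan J - used J\<close> turns out empty.\<close>

lemma outside_cospan_cyclic:
  assumes J: "prestate J" and a: "a \<in> G - cospan J"
  shows "a \<in> C i (G - cospan J - {a})"
proof -
  define c where "c = (\<lambda>Y. C i (Y \<union> (G - cospan J - {a})))"
  have m: "matroid_closure c" unfolding c_def by (rule matroid_closure_contract[OF mc[OF i]])
  define B where "B = cospan J - used J"
  have aB: "B \<union> (G - cospan J - {a}) = G - used J - {a}"
    using tot_Un[OF J] a by (auto simp: B_def)
  have "a \<in> C i (G - used J - {a})" using a by (auto simp: cospan_def)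
  then have aB': "a \<in> c B" by (simp add: c_def aB)
  have B: "y \<notin> c (insert a (B - {y}))" if "y \<in> B" for y
  proof -
    have "insert a (B - {y}) \<union> (G - cospan J - {a}) = B - {y} \<union> (G - cospan J)" using a by blast
    then show ?thesis using indD[OF ind_fam_cospan[OF J]] that by (simp add: c_def fam_def B_def)
  qed
  have "ind c B"
    unfolding ind_def using B mc_mono[OF m] by blast
  then have "a \<in> c {y \<in> B. a \<notin> c (B - {y})}" by (rule fundamental_circuit[OF m _ aB'])
  moreover have "{y \<in> B. a \<notin> c (B - {y})} = {}"
  proof -
    have "a \<in> c (B - {y})" if y: "y \<in> B" for y
    proof (rule ccontr)
      assume "a \<notin> c (B - {y})"
      moreover have "a \<in> c (insert y (B - {y}))" using aB' y by (simp add: insert_absorb)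
      ultimately show False using mc_exchange[OF m] B[OF y] by blast
    qed
    then show ?thesis by blast
  qed
  ultimately have "a \<in> c {}" by metis
  then show ?thesis by (simp add: c_def)
qed

lemma step_cospan_mono:
  assumes s: "step J J'"
  shows "cospan J \<subseteq> cospan J'"
proof
  fix z assume z: "z \<in> cospan J"
  show "z \<in> cospan J'"
  proof (cases "z \<in> used J'")
    case True
    then show ?thesis using z by (simp add: cospan_def)
  next
    case False
    then have "z \<notin> C i (cospan J - used J' - {z} \<union> (G - cospan J))"
      using s z indD[of "fam J i" "cospan J - used J'" z] by (simp add: step_def fam_def)
    moreover have "G - used J' - {z} \<subseteq> cospan J - used J' - {z} \<union> (G - cospan J)" by blast
    ultimately have "z \<notin> C i (G - used J' - {z})"
      using mc_monoD[OF mc[OF i]] by blast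
    then show ?thesis using z by (simp add: cospan_def)
  qed
qed

text \<open>In a packed \<open>H\<close> the elements of \<open>cospan J'\<close> are coloops for
  \<open>i\<close>, hence belong to \<open>T i\<close> and can be discarded; the rest avoids
  \<open>cospan J\<close> and lies in the old ground set. There the packing lacks at most one
  dimension of \<open>q\<close>, and by \<open>almost_packing\<close> the repaired set would not
  consist of loops of \<open>q\<close>, against \<open>nice\<close>.\<close>

lemma augmented_unhindered:
  assumes J: "state J" and J': "prestate J'" and V: "cospan J \<subseteq> cospan J'"
    and q: "q \<in> \<Theta>" "q \<noteq> i"
    and eq: "\<And>k. k \<in> \<Theta> \<Longrightarrow> k \<noteq> i \<Longrightarrow> k \<noteq> q \<Longrightarrow> C k (J' k) = C k (J k)"
    and eqq: "C q (J' q) = C q (insert w (J q))"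
  shows "unhindered \<Theta> (contr J') (G - used J')"
  unfolding unhindered_def
proof (intro allI impI, rule ccontr)
  fix H T assume H: "H \<subseteq> G - used J'" and p: "packing \<Theta> (contr J') H T"
    and "\<not> H \<subseteq> (\<Union>k\<in>\<Theta>. T k)"
  then obtain h where h: "h \<in> H" "h \<notin> (\<Union>k\<in>\<Theta>. T k)" by blast
  have pJ: "prestate J" and nJ: "nice (contr J) (G - used J)" using J by (auto simp: state_def)
  have T: "T k \<subseteq> H" "H \<subseteq> contr J' k (T k)" if "k \<in> \<Theta>" for k using p that by (auto simp: packing_def)
  have dT: "disjoint_family_on T \<Theta>" using p by (simp add: packing_def)
  define V' where "V' = cospan J'"
  have col: "z \<notin> C i (G - used J' - {z})" if "z \<in> V'" "z \<in> H" for z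
    using that H by (auto simp: V'_def cospan_def)
  have HV: "z \<in> T i" if "z \<in> V'" "z \<in> H" for z
  proof (rule ccontr)
    assume "z \<notin> T i"
    then have "T i \<subseteq> G - used J' - {z}" using T(1)[OF i] H by blast
    moreover have "z \<in> C i (T i)" using T(2)[OF i] that by (auto simp: contr_def)
    ultimately show False using mc_monoD[OF mc[OF i]] col[OF that] by blast
  qed
  define H1 where "H1 = H - V'"
  have TV: "T k \<subseteq> H1" if k: "k \<in> \<Theta>" "k \<noteq> i" for k
    using HV T(1)[OF k(1)] disjoint_familyD[OF dT k(1) i] k(2) unfolding H1_def by blast
  \<comment> \<open>Coloops lie on no circuit, so the fundamental circuit of \<open>x\<close>
    survives the removal of \<open>V'\<close>.\<close>
  have Hi: "H1 \<subseteq> C i (T i - V')"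
  proof
    fix x assume x: "x \<in> H1"
    obtain B where B: "B \<subseteq> T i" "ind (C i) B" "T i \<subseteq> C i B" using mc_base_of[OF mc[OF i]] by blast
    have "x \<in> C i (T i)" using x T(2)[OF i] by (auto simp: H1_def contr_def)
    then have xB: "x \<in> C i B" using mc_subD[OF mc[OF i] _ B(3)] by blast
    have "{y \<in> B. x \<notin> C i (B - {y})} \<subseteq> T i - V'"
    proof safe
      fix y assume y: "y \<in> B" "x \<notin> C i (B - {y})"
      then show "y \<in> T i" using B by blast
      assume yV: "y \<in> V'"
      have yH: "y \<in> H" using y B T(1)[OF i] by blast
      have "x \<in> C i (insert y (B - {y}))" using xB y by (simp add: insert_absorb)
      then have "y \<in> C i (insert x (B - {y}))" using mc_exchange[OF mc[OF i]] y by blast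
      moreover have "x \<noteq> y" using x yV by (auto simp: H1_def)
      then have "insert x (B - {y}) \<subseteq> G - used J' - {y}"
        using x B(1) T(1)[OF i] H by (auto simp: H1_def)
      ultimately show False using col[OF yV yH] mc_monoD[OF mc[OF i]] by blast
    qed
    then show "x \<in> C i (T i - V')"
      using mc_monoD[OF mc[OF i] fundamental_circuit[OF mc[OF i] B(2) xB]] by blast
  qed
  define S where "S k = (if k = i then T i - V' else T k)" for k
  \<comment> \<open>An augmentation may return elements of \<open>used J\<close> to index
    \<open>i\<close>. They all lie in \<open>cospan J\<close>, so discarding \<open>V'\<close> is
    what keeps \<open>H1\<close> disjoint from \<open>used J\<close>.\<close>
  have H1G: "H1 \<subseteq> G - used J"
    using H V used_sub_cospan[OF pJ] by (auto simp: H1_def V'_def)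
  have "(\<exists>S'. packing \<Theta> (contr J) H1 S') \<and> \<not> H1 \<subseteq> contr J q {}"
  proof (rule almost_packing[OF mc_contr _ H1G, where S = S and x = w])
    show "unhindered \<Theta> (contr J) (G - used J)" using nJ by (simp add: nice_def)
    show "S k \<subseteq> H1" if "k \<in> \<Theta>" for k using TV[OF that] T(1)[OF i] by (auto simp: S_def H1_def)
    show "disjoint_family_on S \<Theta>" by (rule disjoint_family_on_mono[OF dT]) (auto simp: S_def)
    show "q \<in> \<Theta>" by (rule q)
    show "H1 \<subseteq> contr J k (S k)" if k: "k \<in> \<Theta>" "k \<noteq> q" for k
    proof (cases "k = i")
      case True
      then show ?thesis using Hi by (simp add: contr_def S_def)
    next
      case False
      have "H1 \<subseteq> C k (T k \<union> J' k)" using T(2)[OF k(1)] False by (auto simp: contr_def H1_def)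
      then show ?thesis
        using mc_union_cong[OF mc[OF k(1)] eq[OF k(1) False k(2)], of "T k"] False
        by (simp add: contr_def S_def)
    qed
    have "H1 \<subseteq> C q (T q \<union> J' q)" using T(2)[OF q(1)] q(2) by (auto simp: contr_def H1_def)
    then show "H1 \<subseteq> contr J q (insert w (S q))"
      using mc_union_cong[OF mc[OF q(1)] eqq, of "T q"] q(2) by (simp add: contr_def S_def)
    show "h \<in> H1" using h HV i by (auto simp: H1_def)
    show "h \<notin> (\<Union>k\<in>\<Theta>. S k)" using h i by (auto simp: S_def split: if_splits)
  qed
  then show False using nJ H1G q unfolding nice_def by (meson DiffI singletonD)
qed

lemma extend_to_state:
  assumes J: "prestate J" and u: "unhindered \<Theta> (contr J) (G - used J)"
  shows "\<exists>J'. state J' \<and> (\<forall>k\<in>\<Theta> - {i}. J k \<subseteq> J' k) \<and>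
    (\<forall>k\<in>\<Theta> - {i}. \<forall>x\<in>J' k. x \<in> C k (J k) \<longrightarrow> x \<in> J k)"
proof -
  obtain W T where W: "W \<subseteq> G - used J" and p: "packing \<Theta> (contr J) W T"
    and max: "\<And>W' S'. W' \<subseteq> G - used J \<Longrightarrow> packing \<Theta> (contr J) W' S' \<Longrightarrow> W \<subseteq> W' \<Longrightarrow>
      (\<And>k. k \<in> \<Theta> \<Longrightarrow> T k \<subseteq> S' k) \<Longrightarrow> W' \<subseteq> W"
    by (rule maximal_packing[of \<Theta> "contr J" "G - used J", OF mc_contr]) blast+
  have T: "T k \<subseteq> W" "W \<subseteq> contr J k (T k)" if "k \<in> \<Theta>" for k using p that by (auto simp: packing_def)
  have dT: "disjoint_family_on T \<Theta>" using p by (simp add: packing_def)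
  have WT: "W \<subseteq> (\<Union>k\<in>\<Theta>. T k)" by (rule unhinderedD[OF u W p])
  have indT: "ind (\<lambda>X. C k (X \<union> J k)) (T k)" if k: "k \<in> \<Theta>" "k \<noteq> i" for k
  proof -
    have "ind (contr J k) (T k)" by (rule unhindered_packing_ind[OF mc_contr u W p k(1)])
    then show ?thesis using k by (simp add: contr_def ind_def)
  qed
  define J' where "J' k = J k \<union> T k" for k
  have X': "used J' = used J \<union> (\<Union>k\<in>\<Theta> - {i}. T k)" by (auto simp: J'_def)
  have Ti: "T i \<subseteq> G - used J'"
  proof
    fix x assume x: "x \<in> T i"
    then have "x \<notin> T k" if "k \<in> \<Theta> - {i}" for k using disjoint_familyD[OF dT i, of k x] that by blast
    moreover have "x \<in> G - used J" using x T(1)[OF i] W by blast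
    ultimately show "x \<in> G - used J'" unfolding X' by blast
  qed
  have GX: "G - used J \<subseteq> C i (G - used J')"
  proof
    fix x assume x: "x \<in> G - used J"
    show "x \<in> C i (G - used J')"
    proof (cases "x \<in> W")
      case True
      then have "x \<in> C i (T i)" using T(2)[OF i] by (auto simp: contr_def)
      then show ?thesis using mc_monoD[OF mc[OF i] _ Ti] by blast
    next
      case False
      then have "x \<in> G - used J'" using x T(1) by (auto simp: J'_def)
      then show ?thesis using mc_in[OF mc[OF i]] by blast
    qed
  qed
  have pre: "prestate J'"
    unfolding prestate_def
  proof (intro conjI ballI)
    fix k assume k: "k \<in> \<Theta> - {i}"
    then have k': "k \<in> \<Theta>" "k \<noteq> i" by auto
    show "J' k \<subseteq> G" using prestateD(1)[OF J k'] T(1)[OF k'(1)] W by (auto simp: J'_def)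
    show "ind (C k) (J' k)"
      unfolding J'_def by (rule ind_contract_self[OF mc[OF k'(1)] prestateD(2)[OF J k'] indT[OF k']])
  next
    show "disjoint_family_on J' (\<Theta> - {i})"
    proof (rule disjoint_familyI)
      fix j k x assume jk: "j \<in> \<Theta> - {i}" "k \<in> \<Theta> - {i}" and x: "x \<in> J' j" "x \<in> J' k"
      have TJ: "x \<notin> used J" if "l \<in> \<Theta>" "x \<in> T l" for l using T(1)[OF that(1)] W that by blast
      show "j = k"
      proof (cases "x \<in> used J")
        case True
        then have "x \<in> J j" "x \<in> J k" using x jk TJ by (auto simp: J'_def)
        then show ?thesis using disjoint_familyD[OF prestateD(3)[OF J] jk] by blast
      next
        case False
        then have "x \<in> T j" "x \<in> T k" using x jk by (auto simp: J'_def)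
        then show ?thesis using disjoint_familyD[OF dT, of j k] jk by blast
      qed
    qed
  next
    show "G \<subseteq> C i (G - used J')"
      using prestateD(4)[OF J] mc_sub[OF mc[OF i] GX] by blast
  qed
  have loops: "W' \<subseteq> W" if W': "W' \<subseteq> G - used J'" and P: "packing \<Theta> (contr J') W' P" for W' P
  proof -
    have P1: "P k \<subseteq> W'" "W' \<subseteq> contr J' k (P k)" if "k \<in> \<Theta>" for k
      using P that by (auto simp: packing_def)
    have dP: "disjoint_family_on P \<Theta>" using P by (simp add: packing_def)
    \<comment> \<open>A later packing may reuse elements of \<open>T i\<close>, which stay in the
      ground set. At other indices they are removed from \<open>P k\<close> without loss, since
      \<open>T k\<close> with \<open>J k\<close> already spans them.\<close>
    define S where "S k = (if k = i then T i \<union> P i else T k \<union> (P k - T i))" for k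
    have "packing \<Theta> (contr J) (W \<union> W') S"
      unfolding packing_def
    proof (intro conjI ballI)
      fix k assume k: "k \<in> \<Theta>"
      show "S k \<subseteq> W \<union> W'" using T(1) P1(1) k i by (auto simp: S_def)
      have "W \<subseteq> contr J k (S k)"
        using T(2)[OF k] mc_mono[OF mc_contr[OF k], of "T k" "S k"] by (force simp: S_def)
      moreover have "W' \<subseteq> contr J k (S k)"
      proof (cases "k = i")
        case True
        then show ?thesis
          using P1(2)[OF i] mc_mono[OF mc[OF i], of "P i" "T i \<union> P i"] by (auto simp: S_def contr_def)
      next
        case False
        have Tk: "T i \<subseteq> C k (S k \<union> J k)"
          using T(1)[OF i] \<open>W \<subseteq> contr J k (S k)\<close> False by (auto simp: contr_def)
        have "P k \<union> J' k \<subseteq> C k (S k \<union> J k)"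
          using Tk mc_ext[OF mc[OF k], of "S k \<union> J k"] False by (auto simp: S_def J'_def)
        then have "C k (P k \<union> J' k) \<subseteq> C k (S k \<union> J k)" by (rule mc_sub[OF mc[OF k]])
        then show ?thesis using P1(2)[OF k] False by (auto simp: contr_def)
      qed
      ultimately show "W \<union> W' \<subseteq> contr J k (S k)" by blast
    next
      show "disjoint_family_on S \<Theta>"
      proof (rule disjoint_familyI)
        fix j k x assume jk: "j \<in> \<Theta>" "k \<in> \<Theta>" and x: "x \<in> S j" "x \<in> S k"
        have TP: "l = i" if "l \<in> \<Theta>" "m \<in> \<Theta>" "x \<in> T l" "x \<in> P m" for l m
          using that P1(1)[OF that(2)] W' X' by blast
        show "j = k"
        proof (cases "x \<in> T j \<or> x \<in> T k")
          case True
          have *: "l = m" if "l \<in> \<Theta>" "m \<in> \<Theta>" "x \<in> S l" "x \<in> S m" "x \<in> T l" for l m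
          proof (cases "x \<in> T m")
            case True
            then show ?thesis using disjoint_familyD[OF dT] that by blast
          next
            case False
            then have "x \<in> P m" using that by (auto simp: S_def split: if_splits)
            then have "l = i" using TP that by blast
            then show ?thesis using that False by (auto simp: S_def split: if_splits)
          qed
          show ?thesis using True *[OF jk x] *[OF jk(2,1) x(2,1)] by blast
        next
          case False
          then have "x \<in> P j" "x \<in> P k" using x by (auto simp: S_def split: if_splits)
          then show ?thesis using disjoint_familyD[OF dP jk] by blast
        qed
      qed
    qed
    moreover have "W \<union> W' \<subseteq> G - used J" using W W' unfolding X' by blast
    ultimately have "W \<union> W' \<subseteq> W" by (intro max[of "W \<union> W'" S]) (auto simp: S_def)
    then show ?thesis by blast
  qed
  have "nice (contr J') (G - used J')"
    unfolding nice_def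
  proof (intro conjI allI impI ballI)
    show "unhindered \<Theta> (contr J') (G - used J')"
      unfolding unhindered_def
    proof (intro allI impI)
      fix W' P assume W': "W' \<subseteq> G - used J'" and P: "packing \<Theta> (contr J') W' P"
      have "P i \<subseteq> W' \<and> W' \<subseteq> contr J' i (P i)" using P i by (simp add: packing_def)
      then have P1: "P i \<subseteq> W'" "W' \<subseteq> C i (P i)" by (simp_all add: contr_def)
      have W'T: "W' \<subseteq> T i" using loops[OF W' P] WT W' X' by blast
      \<comment> \<open>Swapping \<open>W'\<close> for \<open>P i\<close> inside \<open>T i\<close>
        still packs \<open>W\<close>, so an element of \<open>W'\<close> missed by
        \<open>P i\<close> would be left over in the original family.\<close>
      define Q where "Q = T(i := (T i - W') \<union> P i)"
      have "packing \<Theta> (contr J) W Q"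
        unfolding packing_def
      proof (intro conjI ballI)
        fix k assume k: "k \<in> \<Theta>"
        show "Q k \<subseteq> W" using T(1)[OF k] P1 W'T T(1)[OF i] by (auto simp: Q_def)
        have "T i \<subseteq> C i ((T i - W') \<union> P i)"
          using P1(2) mc_mono[OF mc[OF i], of "P i" "(T i - W') \<union> P i"]
            mc_ext[OF mc[OF i], of "(T i - W') \<union> P i"] by blast
        then have "C i (T i) \<subseteq> C i ((T i - W') \<union> P i)" by (rule mc_sub[OF mc[OF i]])
        moreover have "W \<subseteq> C i (T i)" using T(2)[OF i] by (simp add: contr_def)
        ultimately show "W \<subseteq> contr J k (Q k)"
          using T(2)[OF k] by (cases "k = i") (simp_all add: Q_def contr_def)
      next
        show "disjoint_family_on Q \<Theta>"
          by (rule disjoint_family_on_mono[OF dT]) (use P1 W'T in \<open>auto simp: Q_def\<close>)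
      qed
      then have WQ: "W \<subseteq> (\<Union>k\<in>\<Theta>. Q k)" by (rule unhinderedD[OF u W])
      have "x \<in> P i" if x: "x \<in> W'" for x
      proof -
        obtain k where k: "k \<in> \<Theta>" "x \<in> Q k" using WQ W'T T(1)[OF i] x by blast
        have "k = i"
        proof (rule ccontr)
          assume "k \<noteq> i"
          then show False using k disjoint_familyD[OF dT k(1) i, of x] W'T x by (auto simp: Q_def)
        qed
        then show ?thesis using k x by (auto simp: Q_def)
      qed
      then show "W' \<subseteq> (\<Union>k\<in>\<Theta>. P k)" using i by blast
    qed
  next
    fix W' P k assume W': "W' \<subseteq> G - used J'" and P: "packing \<Theta> (contr J') W' P" and k: "k \<in> \<Theta> - {i}"
    show "W' \<subseteq> contr J' k {}"
      using loops[OF W' P] T(2)[of k] k by (auto simp: contr_def J'_def Un_commute)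
  qed
  then have "state J'" using pre by (simp add: state_def)
  moreover have "x \<in> J k" if "k \<in> \<Theta>" "k \<noteq> i" "x \<in> J' k" "x \<in> C k (J k)" for k x
  proof (rule ccontr)
    assume "x \<notin> J k"
    then have "x \<in> T k" using that by (auto simp: J'_def)
    then have "x \<notin> C k (T k - {x} \<union> J k)" using indD[OF indT[OF that(1,2)]] by blast
    then show False using that mc_monoD[OF mc[OF that(1)], of x "J k"] by blast
  qed
  moreover have "J k \<subseteq> J' k" for k by (auto simp: J'_def)
  ultimately show ?thesis by blast
qed

section \<open>Augmentation from unsafe elements\<close>

lemma safe_span: "safe J x \<Longrightarrow> k \<in> \<Theta> \<Longrightarrow> x \<in> fam J k (tot J k)"
  unfolding safe_def reaches_def free_def by blast

lemma safe_arc: "safe J x \<Longrightarrow> arc \<Theta> (fam J) (tot J) x y \<Longrightarrow> safe J y"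
  using reaches_arc[of \<Theta> "fam J" "tot J" x y] by (auto simp: safe_def)

text \<open>The augmentation from \<open>x\<close> must raise an index other than \<open>i\<close>,
  because index \<open>i\<close> already spans \<open>G\<close>. Elements outside
  \<open>cospan J\<close> are loops of the contracted \<open>i\<close>-th matroid, so
  \<open>x\<close> ends up committed elsewhere; absorbing a packing then restores
  \<open>state\<close>.\<close>

lemma unsafe_step:
  assumes J: "state J" and x: "x \<in> G - cospan J" and ns: "\<not> safe J x"
  shows "\<exists>J'. step J J' \<and> x \<in> cospan J'"
proof -
  have pJ: "prestate J" using J by (simp add: state_def)
  have famk: "fam J k = C k" "tot J k = J k" if "k \<noteq> i" for k
    using that by (auto simp: fam_def tot_def)
  have xt: "x \<notin> (\<Union>k\<in>\<Theta>. tot J k)" using x Union_tot[OF pJ] by simp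
  have r: "reaches \<Theta> (fam J) (tot J) x" using ns by (simp add: safe_def)
  have mcf: "\<forall>k\<in>\<Theta>. matroid_closure (fam J k)" and indf: "\<forall>k\<in>\<Theta>. ind (fam J k) (tot J k)"
    using mc_fam ind_tot[OF pJ] by blast+
  obtain J1 q w where q: "q \<in> \<Theta>" "w \<notin> fam J q (tot J q)" "(arc \<Theta> (fam J) (tot J))\<^sup>*\<^sup>* x w"
    and ind1: "\<forall>k\<in>\<Theta>. ind (fam J k) (J1 k)" and dis1: "disjoint_family_on J1 \<Theta>"
    and un1: "(\<Union>k\<in>\<Theta>. J1 k) = insert x (\<Union>k\<in>\<Theta>. tot J k)"
    and eq1: "\<forall>k\<in>\<Theta>. k \<noteq> q \<longrightarrow> fam J k (J1 k) = fam J k (tot J k)"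
    and eqq1: "fam J q (J1 q) = fam J q (insert w (tot J q))"
    and ch1: "\<forall>k\<in>\<Theta>. \<forall>z. (z \<in> tot J k) \<noteq> (z \<in> J1 k) \<longrightarrow> reaches \<Theta> (fam J) (tot J) z"
    using augment[OF mcf indf disjoint_tot[OF pJ] xt r]
    by (elim exE conjE) (rule that)
  have totG: "tot J k \<subseteq> G" if "k \<in> \<Theta>" for k
    using Union_tot[OF pJ] cospan_sub that by blast
  have "w \<in> G"
    using q(3) by (induction) (use x totG in \<open>auto simp: arc_def\<close>)
  then have qi: "q \<noteq> i" using q(2) fam_tot_i[OF pJ] prestateD(4)[OF pJ] by auto
  have un1': "(\<Union>k\<in>\<Theta>. J1 k) = insert x (cospan J)" using un1 Union_tot[OF pJ] by simp
  have J1G: "J1 k \<subseteq> insert x (cospan J)" if "k \<in> \<Theta>" for k using un1' that by blast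
  have J1i: "J1 i \<inter> (G - cospan J) = {}"
  proof -
    have "z \<notin> G - cospan J" if "z \<in> J1 i" for z
      using indD[OF ind1[rule_format, OF i] that] mc_in[OF mc[OF i], of z "J1 i - {z} \<union> (G - cospan J)"]
      by (auto simp: fam_def)
    then show ?thesis by blast
  qed
  have xJ1: "x \<in> used J1"
  proof -
    obtain k where "k \<in> \<Theta>" "x \<in> J1 k" using un1' by blast
    then show ?thesis using J1i x by blast
  qed
  have J1i_eq: "J1 i = cospan J - used J1"
  proof
    show "J1 i \<subseteq> cospan J - used J1"
    proof
      fix z assume z: "z \<in> J1 i"
      then have "z \<noteq> x" using J1i x by blast
      then have "z \<in> cospan J" using J1G[OF i] z by blast
      moreover have "z \<notin> J1 k" if "k \<in> \<Theta> - {i}" for k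
        using disjoint_familyD[OF dis1 i, of k z] z that by blast
      ultimately show "z \<in> cospan J - used J1" by blast
    qed
    show "cospan J - used J1 \<subseteq> J1 i" using un1' by blast
  qed
  have pre1: "prestate J1"
    unfolding prestate_def
  proof (intro conjI ballI)
    fix k assume k: "k \<in> \<Theta> - {i}"
    then show "J1 k \<subseteq> G" using J1G[of k] cospan_sub x by blast
    show "ind (C k) (J1 k)" using ind1 famk[of k] k by fastforce
  next
    show "disjoint_family_on J1 (\<Theta> - {i})" using dis1 by (auto simp: disjoint_family_on_def)
  next
    \<comment> \<open>Outside \<open>cospan J\<close> only \<open>x\<close> becomes used, and its
      loss is made up by a circuit outside \<open>cospan J\<close>.\<close>
    have "G - cospan J - {x} \<subseteq> G - used J1" using J1G by blast
    then have "x \<in> C i (G - used J1)"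
      using mc_monoD[OF mc[OF i] outside_cospan_cyclic[OF pJ x]] by blast
    moreover have "J1 i \<subseteq> G - used J1" using J1i_eq cospan_sub by blast
    ultimately have "J1 i \<union> (G - cospan J) \<subseteq> C i (G - used J1)"
      using mc_ext[OF mc[OF i], of "G - used J1"] \<open>G - cospan J - {x} \<subseteq> G - used J1\<close> by blast
    then have "fam J i (J1 i) \<subseteq> C i (G - used J1)"
      using mc_sub[OF mc[OF i]] by (simp add: fam_def)
    then show "G \<subseteq> C i (G - used J1)"
      using eq1[rule_format, OF i] qi fam_tot_i[OF pJ] prestateD(4)[OF pJ] by simp
  qed
  have V1: "cospan J \<subseteq> cospan J1"
  proof
    fix z assume z: "z \<in> cospan J"
    show "z \<in> cospan J1"
    proof (cases "z \<in> used J1")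
      case True
      then show ?thesis using z by (simp add: cospan_def)
    next
      case False
      then have "z \<notin> C i (J1 i - {z} \<union> (G - cospan J))"
        using indD[OF ind1[rule_format, OF i], of z] J1i_eq z by (simp add: fam_def)
      moreover have "G - used J1 - {z} \<subseteq> J1 i - {z} \<union> (G - cospan J)" using J1i_eq by blast
      ultimately have "z \<notin> C i (G - used J1 - {z})" using mc_monoD[OF mc[OF i]] by blast
      then show ?thesis using z by (simp add: cospan_def)
    qed
  qed
  have eqC: "C k (J1 k) = C k (J k)" if "k \<in> \<Theta>" "k \<noteq> i" "k \<noteq> q" for k
    using eq1[rule_format, OF that(1,3)] famk[OF that(2)] by simp
  have eqCq: "C q (J1 q) = C q (insert w (J q))" using eqq1 famk[OF qi] by simp
  have u1: "unhindered \<Theta> (contr J1) (G - used J1)"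
    by (rule augmented_unhindered[OF J pre1 V1 q(1) qi eqC eqCq])
  obtain J2 where J2: "state J2" "\<forall>k\<in>\<Theta> - {i}. J1 k \<subseteq> J2 k"
    "\<forall>k\<in>\<Theta> - {i}. \<forall>x\<in>J2 k. x \<in> C k (J1 k) \<longrightarrow> x \<in> J1 k"
    using extend_to_state[OF pre1 u1] by (elim exE conjE) (rule that)
  have used12: "used J1 \<subseteq> used J2" using J2(2) by blast
  have "step J J2"
    unfolding step_def
  proof (intro conjI allI impI)
    show "state J" "state J2" by fact+
    fix y k assume y: "safe J y" and k: "k \<in> \<Theta> - {i}"
    \<comment> \<open>Augmentation moves only elements that reach a free vertex, and the absorption
      adds nothing already spanned, whereas a safe \<open>y\<close> is spanned at every
      index.\<close>
    have same: "y \<in> J k \<longleftrightarrow> y \<in> J1 k" using ch1[rule_format, of k y] y k famk(2)[of k] by (auto simp: safe_def)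
    have "C k (J k) \<subseteq> C k (J1 k)"
      using eqC[of k] eqCq k mc_mono[OF mc[OF q(1)], of "J q" "insert w (J q)"] by (cases "k = q") auto
    then have "y \<in> C k (J1 k)" using safe_span[OF y, of k] famk[of k] k by auto
    then show "y \<in> J k \<longleftrightarrow> y \<in> J2 k" using same J2(2,3) k by blast
  next
    show "ind (fam J i) (cospan J - used J2)"
      by (rule ind_subset[OF mc_fam[OF i] ind1[rule_format, OF i]]) (use J1i_eq used12 in blast)
  qed
  moreover have "x \<in> cospan J2" using xJ1 used12 x by (auto simp: cospan_def)
  ultimately show ?thesis by blast
qed

lemma step_used:
  "step J J' \<Longrightarrow> safe J x \<Longrightarrow> x \<in> used J \<longleftrightarrow> x \<in> used J'"
  unfolding step_def by blast

text \<open>The fundamental circuit of a safe \<open>x\<close> consists of safe elements, which a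
  step does not move. At index \<open>i\<close> the new base and contracted set are compared with
  the surviving old base over the old contraction.\<close>

lemma arc_persists:
  assumes s: "step J J'" and x: "x \<in> G" "safe J x" and a: "arc \<Theta> (fam J) (tot J) x y"
  shows "arc \<Theta> (fam J') (tot J') x y"
proof -
  have pJ: "prestate J" and pJ': "prestate J'" using s by (auto simp: step_def state_def)
  obtain k where k: "k \<in> \<Theta>" "y \<in> tot J k" "x \<notin> fam J k (tot J k - {y})" using a by (auto simp: arc_def)
  define D where "D = {y \<in> tot J k. x \<notin> fam J k (tot J k - {y})}"
  have Ds: "safe J d" if "d \<in> D" for d
    by (rule safe_arc[OF x(2)]) (use that k in \<open>auto simp: D_def arc_def\<close>)
  have yD: "y \<in> D" using k by (simp add: D_def)
  show ?thesis
  proof (cases "k = i")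
    case False
    have f: "fam J k = C k" "fam J' k = C k" "tot J k = J k" "tot J' k = J' k"
      using False by (auto simp: fam_def tot_def)
    have D: "D \<subseteq> J' k"
    proof
      fix d assume "d \<in> D"
      then have "d \<in> J k" "safe J d" using Ds f by (auto simp: D_def)
      then show "d \<in> J' k" using s k False by (auto simp: step_def)
    qed
    have "x \<notin> C k (J' k - {y})"
      by (rule fundamental_circuit_persists[OF mc[OF k(1)] prestateD(2)[OF pJ k(1) False] _
            prestateD(2)[OF pJ' k(1) False]])
        (use safe_span[OF x(2) k(1)] D k f in \<open>auto simp: D_def\<close>)
    then show ?thesis unfolding arc_def using k(1) D yD f by (intro bexI[of _ k]) auto
  next
    case True
    define B where "B = cospan J - used J'"
    have indB: "ind (fam J i) B" using s by (simp add: step_def B_def)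
    have D: "D \<subseteq> B"
    proof
      fix d assume d: "d \<in> D"
      then have "d \<in> cospan J - used J" using True by (auto simp: D_def tot_def)
      then show "d \<in> B" using step_used[OF s Ds[OF d]] by (auto simp: B_def)
    qed
    have "x \<notin> fam J i (B - {y})"
      by (rule fundamental_circuit_persists[OF mc_fam[OF i] ind_tot[OF pJ i] safe_span[OF x(2) i] indB])
        (use D k True in \<open>auto simp: D_def\<close>)
    moreover have "tot J' i - {y} \<union> (G - cospan J') \<subseteq> B - {y} \<union> (G - cospan J)"
      using tot_Un[OF pJ'] step_cospan_mono[OF s] yD D cospan_sub[of J']
      by (auto simp: tot_def B_def)
    ultimately have "x \<notin> fam J' i (tot J' i - {y})"
      using mc_monoD[OF mc[OF i]] by (simp add: fam_def) blast
    moreover have "y \<in> tot J' i" using yD D step_cospan_mono[OF s] by (auto simp: tot_def B_def)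
    ultimately show ?thesis using i by (auto simp: arc_def)
  qed
qed

section \<open>Permanently safe elements\<close>

definition permanent :: "('i \<Rightarrow> 'a set) \<Rightarrow> 'a \<Rightarrow> bool" where
  "permanent J x \<longleftrightarrow> (\<forall>J'. step\<^sup>*\<^sup>* J J' \<longrightarrow> safe J' x)"

lemma permanent_mono: "permanent J x \<Longrightarrow> step\<^sup>*\<^sup>* J J' \<Longrightarrow> permanent J' x"
  unfolding permanent_def by (meson rtranclp_trans)

lemma permanent_safe: "permanent J x \<Longrightarrow> safe J x"
  unfolding permanent_def by blast

lemma permanent_mem:
  assumes "step\<^sup>*\<^sup>* J J'" "permanent J x" "k \<in> \<Theta> - {i}"
  shows "x \<in> J k \<longleftrightarrow> x \<in> J' k"
  using assms(1)
proof (induction rule: rtranclp_induct)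
  case (step J1 J2)
  then show ?case using assms(2,3) unfolding permanent_def step_def by blast
qed simp

lemma permanent_used:
  "step\<^sup>*\<^sup>* J J' \<Longrightarrow> permanent J x \<Longrightarrow> x \<in> used J \<longleftrightarrow> x \<in> used J'"
  using permanent_mem by blast

text \<open>Arcs out of a permanent element never disappear and always lead to safe elements. Being
  closed under arcs is what allows the permanent elements to carry a packing.\<close>

lemma permanent_arc:
  assumes p: "permanent J x" and x: "x \<in> G" and a: "arc \<Theta> (fam J) (tot J) x y"
  shows "permanent J y"
  unfolding permanent_def
proof (intro allI impI)
  fix J' assume s: "step\<^sup>*\<^sup>* J J'"
  have "arc \<Theta> (fam J') (tot J') x y"
    using s
  proof (induction rule: rtranclp_induct)
    case (step J1 J2)
    then show ?case using arc_persists[OF step(2) x] p unfolding permanent_def by blast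
  qed (rule a)
  then show "safe J' y" using p s safe_arc unfolding permanent_def by blast
qed

lemma steps_state: "step\<^sup>*\<^sup>* J J' \<Longrightarrow> state J \<Longrightarrow> state J'"
  by (induction rule: rtranclp_induct) (auto simp: step_def)

lemma steps_cospan_mono: "step\<^sup>*\<^sup>* J J' \<Longrightarrow> cospan J \<subseteq> cospan J'"
proof (induction rule: rtranclp_induct)
  case (step J1 J2)
  then show ?case using step_cospan_mono by blast
qed simp

text \<open>Passing to a successor state that minimises the part of \<open>F\<close> outside \<open>cospan\<close> makes all of
  that part permanent.\<close>

lemma cocircuit_met:
  assumes J: "state J" and e: "e \<in> G" and bad: "\<And>J'. step\<^sup>*\<^sup>* J J' \<Longrightarrow> e \<notin> cospan J'"
    and F: "finite F" "y \<in> G" "y \<notin> C i (G - F)" and y: "y = e \<or> y \<in> used J \<and> permanent J y"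
  shows "\<exists>J'. step\<^sup>*\<^sup>* J J' \<and> (\<exists>x\<in>F. x \<in> G \<and> permanent J' x \<and> x \<notin> used J' \<and> x \<noteq> e)"
proof -
  let ?P = "\<lambda>n. \<exists>J'. step\<^sup>*\<^sup>* J J' \<and> card (F \<inter> (G - cospan J')) = n"
  define n where "n = (LEAST n. ?P n)"
  have "?P n" unfolding n_def by (rule LeastI_ex) blast
  then obtain J' where J': "step\<^sup>*\<^sup>* J J'" and n: "card (F \<inter> (G - cospan J')) = n" by blast
  have min: "n \<le> card (F \<inter> (G - cospan J''))" if "step\<^sup>*\<^sup>* J' J''" for J''
    unfolding n_def by (rule Least_le) (use rtranclp_trans[OF J' that] in blast)
  have pJ': "prestate J'" using steps_state[OF J' J] by (simp add: state_def)
  have const: "x \<notin> cospan J''" if x: "x \<in> F" "x \<in> G" "x \<notin> cospan J'" and s: "step\<^sup>*\<^sup>* J' J''" for x J''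
  proof
    assume "x \<in> cospan J''"
    then have "F \<inter> (G - cospan J'') \<subset> F \<inter> (G - cospan J')" using x steps_cospan_mono[OF s] by blast
    then have "card (F \<inter> (G - cospan J'')) < card (F \<inter> (G - cospan J'))"
      by (rule psubset_card_mono[rotated]) (use F(1) in simp)
    then show False using min[OF s] n by simp
  qed
  have perm: "permanent J' x" if x: "x \<in> F" "x \<in> G" "x \<notin> cospan J'" for x
    unfolding permanent_def
  proof (intro allI impI, rule ccontr)
    fix J'' assume s: "step\<^sup>*\<^sup>* J' J''" and ns: "\<not> safe J'' x"
    have "state J''" using steps_state[OF s] steps_state[OF J' J] by blast
    moreover have "x \<in> G - cospan J''" using const[OF x s] x by blast
    ultimately obtain J3 where "step J'' J3" "x \<in> cospan J3" using unsafe_step[OF _ _ ns] by blast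
    then show False using const[OF x, of J3] s by (meson rtranclp.rtrancl_into_rtrancl)
  qed
  show ?thesis
  proof (cases "F \<inter> (G - cospan J') \<subseteq> {e}")
    case False
    then obtain x where x: "x \<in> F" "x \<in> G" "x \<notin> cospan J'" "x \<noteq> e" by blast
    then have "x \<notin> used J'" using used_sub_cospan[OF pJ'] by blast
    then show ?thesis using J' x perm[OF x(1-3)] by blast
  next
    case True
    then have AF: "G - cospan J' - {e} \<subseteq> G - F" by blast
    have eA: "e \<in> C i (G - cospan J' - {e})"
      by (rule outside_cospan_cyclic[OF pJ']) (use e bad[OF J'] in blast)
    show ?thesis
    proof (cases "y = e")
      case True
      then show ?thesis using eA F(3) mc_monoD[OF mc[OF i] _ AF] by blast
    next
      case False
      then have yp: "permanent J' y" and yu: "y \<in> used J'"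
        using y permanent_mono[OF _ J'] permanent_used[OF J'] by blast+
      define D where "D = {z \<in> tot J' i. y \<notin> fam J' i (tot J' i - {z})}"
      have "y \<in> fam J' i D"
        unfolding D_def
        by (rule fundamental_circuit[OF mc_fam[OF i] ind_tot[OF pJ' i] safe_span[OF permanent_safe[OF yp] i]])
      moreover have "D \<union> (G - cospan J') \<subseteq> C i (D \<union> (G - cospan J' - {e}))"
        using eA mc_mono[OF mc[OF i], of "G - cospan J' - {e}" "D \<union> (G - cospan J' - {e})"]
          mc_ext[OF mc[OF i], of "D \<union> (G - cospan J' - {e})"] by blast
      ultimately have "y \<in> C i (D \<union> (G - cospan J' - {e}))"
        using mc_subD[OF mc[OF i]] by (simp add: fam_def)
      then have "\<not> D \<union> (G - cospan J' - {e}) \<subseteq> G - F" using F(3) mc_monoD[OF mc[OF i]] by blast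
      moreover have DG: "D \<subseteq> cospan J' - used J'" by (auto simp: D_def tot_def)
      ultimately obtain z where z: "z \<in> D" "z \<in> F" using AF cospan_sub by blast
      have "arc \<Theta> (fam J') (tot J') y z" using z i by (auto simp: D_def arc_def)
      then have "permanent J' z" by (rule permanent_arc[OF yp F(2)])
      moreover have "z \<noteq> e" "z \<notin> used J'" "z \<in> G" using z DG bad[OF J'] cospan_sub by blast+
      ultimately show ?thesis using J' z by blast
    qed
  qed
qed

lemma cospan_attained:
  assumes cG: "countable G" and nice: "nice C G" and e: "e \<in> G"
    and cofin: "\<And>X z. z \<notin> C i X \<Longrightarrow> \<exists>F. finite F \<and> z \<in> F \<and> F \<inter> X = {} \<and> z \<notin> C i (- F)"
  shows "\<exists>J. state J \<and> e \<in> cospan J"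
proof (rule ccontr)
  assume nex: "\<not> (\<exists>J. state J \<and> e \<in> cospan J)"
  define J0 :: "'i \<Rightarrow> 'a set" where "J0 = (\<lambda>_. {})"
  have "contr J0 = C" by (auto simp: contr_def J0_def fun_eq_iff)
  then have st0: "state J0"
    using nice mc_ext[OF mc[OF i], of G]
    by (auto simp: state_def prestate_def J0_def disjoint_family_on_def)
  define \<T> where "\<T> = {(F, y). finite F \<and> F \<subseteq> G \<and> y \<in> F \<and> y \<notin> C i (G - F)}"
  have "\<T> \<subseteq> {F. finite F \<and> F \<subseteq> G} \<times> G" by (auto simp: \<T>_def)
  then have cT: "countable \<T>"
    using countable_subset countable_SIGMA countable_Collect_finite_subset cG by metis
  \<comment> \<open>Projecting \<open>prod_decode\<close> repeats each task at arbitrarily late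
    times, so a cocircuit is treated after its element has become permanent and used. The guard
    \<open>task t \<in> \<T>\<close> below covers an empty task set.\<close>
  define task where "task t = from_nat_into \<T> (fst (prod_decode t))" for t
  let ?Q = "\<lambda>t J J'. step\<^sup>*\<^sup>* J J' \<and> (task t \<in> \<T> \<longrightarrow>
      snd (task t) = e \<or> snd (task t) \<in> used J \<and> permanent J (snd (task t)) \<longrightarrow>
      (\<exists>x\<in>fst (task t). x \<in> G \<and> permanent J' x \<and> x \<notin> used J' \<and> x \<noteq> e))"
  have "\<exists>s. \<forall>t. step\<^sup>*\<^sup>* J0 (s t) \<and> ?Q t (s t) (s (Suc t))"
  proof (rule dependent_nat_choice)
    show "\<exists>J. step\<^sup>*\<^sup>* J0 J" by blast
    fix J t assume J: "step\<^sup>*\<^sup>* J0 J"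
    have stJ: "state J" using steps_state[OF J st0] .
    have "\<exists>J'. ?Q t J J'"
    proof (cases "task t \<in> \<T> \<and>
        (snd (task t) = e \<or> snd (task t) \<in> used J \<and> permanent J (snd (task t)))")
      case True
      have "\<exists>J'. step\<^sup>*\<^sup>* J J' \<and> (\<exists>x\<in>fst (task t). x \<in> G \<and> permanent J' x \<and> x \<notin> used J' \<and> x \<noteq> e)"
        by (rule cocircuit_met[OF stJ e, of _ "snd (task t)"])
          (use True nex steps_state[OF _ stJ] in \<open>auto simp: \<T>_def\<close>)
      then show ?thesis by blast
    next
      case False
      then show ?thesis by blast
    qed
    then show "\<exists>J'. step\<^sup>*\<^sup>* J0 J' \<and> ?Q t J J'" using J by (meson rtranclp_trans)
  qed
  then obtain s where s0: "\<And>t. step\<^sup>*\<^sup>* J0 (s t)" and s: "\<And>t. ?Q t (s t) (s (Suc t))" by blast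
  have mono: "step\<^sup>*\<^sup>* (s t) (s t')" if "t \<le> t'" for t t'
    using that
  proof (induction rule: dec_induct)
    case (step n)
    then show ?case using s[of n] by (meson rtranclp_trans)
  qed simp
  have pre: "prestate (s t)" for t using steps_state[OF s0 st0] by (auto simp: state_def)
  define R where "R = {x \<in> G. \<exists>t. permanent (s t) x}"
  define Y where "Y = {x. \<exists>t. x \<in> used (s t) \<and> permanent (s t) x}"
  \<comment> \<open>Index \<open>i\<close> takes the permanent elements that no other index uses,
    except \<open>e\<close>, which is the intended leftover.\<close>
  define S where "S k = (if k = i then R - Y - {e} else {x. \<exists>t. x \<in> s t k \<and> permanent (s t) x})" for k
  have eY: "e \<notin> used (s t)" for t
    using nex used_sub_cospan[OF pre] steps_state[OF s0 st0] by blast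
  have SY: "S k \<subseteq> Y" if "k \<in> \<Theta>" "k \<noteq> i" for k using that by (auto simp: S_def Y_def)
  have pk: "packing \<Theta> C R S"
    unfolding packing_def
  proof (intro conjI ballI)
    fix k assume k: "k \<in> \<Theta>"
    show "S k \<subseteq> R"
      using prestateD(1)[OF pre k] by (auto simp: S_def R_def)
    show "R \<subseteq> C k (S k)"
    proof
      fix x assume x: "x \<in> R"
      then obtain t where t: "x \<in> G" "permanent (s t) x" by (auto simp: R_def)
      show "x \<in> C k (S k)"
      proof (cases "k = i")
        case False
        have f: "fam (s t) k = C k" "tot (s t) k = s t k" using False by (auto simp: fam_def tot_def)
        have "x \<in> fam (s t) k (tot (s t) k \<inter> {y. permanent (s t) y})"
          by (rule arc_closed_span[where C = "fam (s t)" and J = "tot (s t)", OF mc_fam[OF k] k ind_tot[OF pre k]])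
            (use safe_span[OF permanent_safe[OF t(2)] k] permanent_arc[OF t(2,1)] in auto)
        then have "x \<in> C k (s t k \<inter> {y. permanent (s t) y})" using f by simp
        then show ?thesis
          by (rule mc_monoD[OF mc[OF k]]) (use False in \<open>auto simp: S_def\<close>)
      next
        case True
        show ?thesis
        proof (rule ccontr)
          assume nx: "x \<notin> C k (S k)"
          then obtain F where F: "finite F" "x \<in> F" "F \<inter> S i = {}" "x \<notin> C i (- F)"
            using cofin True by blast
          have "x \<notin> S i" using nx True mc_in[OF mc[OF i]] by blast
          then have xY: "x \<in> Y \<or> x = e" using x by (auto simp: S_def)
          have "x \<notin> C i (G - F \<inter> G)" using F(4) mc_monoD[OF mc[OF i], of x "G - F \<inter> G" "- F"] by blast
          then have inT: "(F \<inter> G, x) \<in> \<T>" using F t by (auto simp: \<T>_def)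
          then obtain n where n: "from_nat_into \<T> n = (F \<inter> G, x)"
            using cT by (metis from_nat_into_surj)
          obtain t0 where t0: "x = e \<or> x \<in> used (s t0) \<and> permanent (s t0) x"
            using xY by (auto simp: Y_def)
          define t1 where "t1 = prod_encode (n, t0)"
          have "t0 \<le> t1" by (simp add: t1_def le_prod_encode_2)
          then have st: "step\<^sup>*\<^sup>* (s t0) (s t1)" by (rule mono)
          have tk: "task t1 = (F \<inter> G, x)" by (simp add: task_def t1_def n)
          have "x = e \<or> x \<in> used (s t1) \<and> permanent (s t1) x"
            using t0 permanent_mono[OF _ st] permanent_used[OF st] by blast
          then obtain x' where x': "x' \<in> F" "x' \<in> G" "permanent (s (Suc t1)) x'"
            "x' \<notin> used (s (Suc t1))" "x' \<noteq> e"
            using s[of t1] inT tk by auto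
          have "x' \<notin> Y"
          proof
            assume "x' \<in> Y"
            then obtain t2 where t2: "x' \<in> used (s t2)" "permanent (s t2) x'" by (auto simp: Y_def)
            define m where "m = max t2 (Suc t1)"
            have "x' \<in> used (s m)" using permanent_used[OF mono t2(2), of m] t2(1) by (simp add: m_def)
            moreover have "x' \<notin> used (s m)"
              using permanent_used[OF mono x'(3), of m] x'(4) by (simp add: m_def)
            ultimately show False by blast
          qed
          then have "x' \<in> S i" using x' by (auto simp: S_def R_def)
          then show False using F x' by blast
        qed
      qed
    qed
  next
    show "disjoint_family_on S \<Theta>"
    proof (rule disjoint_familyI)
      fix j k x assume jk: "j \<in> \<Theta>" "k \<in> \<Theta>" and x: "x \<in> S j" "x \<in> S k"
      show "j = k"
      proof (cases "j = i \<or> k = i")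
        case True
        then have "x \<notin> Y" using x by (auto simp: S_def)
        then show ?thesis using SY jk x by blast
      next
        case False
        then obtain t t' where t: "x \<in> s t j" "permanent (s t) x" "x \<in> s t' k" "permanent (s t') x"
          using x by (auto simp: S_def)
        define m where "m = max t t'"
        have "x \<in> s m j" using permanent_mem[OF mono t(2), of m j] t(1) jk False by (simp add: m_def)
        moreover have "x \<in> s m k" using permanent_mem[OF mono t(4), of m k] t(3) jk False by (simp add: m_def)
        ultimately show ?thesis using disjoint_familyD[OF prestateD(3)[OF pre]] jk False by blast
      qed
    qed
  qed
  have RG: "R \<subseteq> G" by (auto simp: R_def)
  have "unhindered \<Theta> C G" using nice by (simp add: nice_def)
  then have RS: "R \<subseteq> (\<Union>k\<in>\<Theta>. S k)" by (rule unhinderedD[OF _ RG pk])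
  \<comment> \<open>As \<open>e\<close> lies outside every \<open>cospan\<close>, unsafety at any
    stage would allow a step bringing it into one.\<close>
  have "permanent J0 e"
    unfolding permanent_def
  proof (intro allI impI, rule ccontr)
    fix J' assume J': "step\<^sup>*\<^sup>* J0 J'" and ns: "\<not> safe J' e"
    have st: "state J'" using steps_state[OF J' st0] .
    then obtain J2 where "step J' J2" "e \<in> cospan J2" using unsafe_step[OF st _ ns] nex e by blast
    then show False using nex by (auto simp: step_def)
  qed
  then have "e \<in> R" using permanent_mono[OF _ s0] e by (auto simp: R_def)
  then obtain k where "k \<in> \<Theta>" "e \<in> S k" using RS by blast
  then show False using SY eY by (cases "k = i") (auto simp: S_def Y_def)
qed

end

section \<open>Coverings of countable sets\<close>

definition fin_closure :: "('a set \<Rightarrow> 'a set) \<Rightarrow> bool" where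
  "fin_closure c \<longleftrightarrow> (\<forall>X x. x \<in> c X \<longrightarrow> (\<exists>F. finite F \<and> F \<subseteq> X \<and> x \<in> c F))"

text \<open>Finiteness of the circuits of the dual: \<open>z \<notin> c (- F)\<close> means that
  \<open>F\<close> contains a cocircuit through \<open>z\<close>.\<close>

definition cofin_closure :: "('a set \<Rightarrow> 'a set) \<Rightarrow> bool" where
  "cofin_closure c \<longleftrightarrow>
     (\<forall>X z. z \<notin> c X \<longrightarrow> (\<exists>F. finite F \<and> z \<in> F \<and> F \<inter> X = {} \<and> z \<notin> c (- F)))"

section \<open>Partial coverings and their extension\<close>

locale matroid_family =
  fixes \<Theta> :: "'i set" and C :: "'i \<Rightarrow> 'a set \<Rightarrow> 'a set" and G :: "'a set"
  assumes mc: "\<And>k. k \<in> \<Theta> \<Longrightarrow> matroid_closure (C k)"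
begin

abbreviation cov :: "('i \<Rightarrow> 'a set) \<Rightarrow> 'a set" where
  "cov I \<equiv> (\<Union>k\<in>\<Theta>. I k)"

definition partial_cover :: "('i \<Rightarrow> 'a set) \<Rightarrow> bool" where
  "partial_cover I \<longleftrightarrow> (\<forall>k\<in>\<Theta>. I k \<subseteq> G \<and> ind (C k) (I k)) \<and> disjoint_family_on I \<Theta> \<and>
     (\<forall>W S. W \<subseteq> G - cov I \<longrightarrow> packing \<Theta> (\<lambda>k X. C k (X \<union> I k)) W S \<longrightarrow> W = {})"

lemma partial_coverD:
  assumes "partial_cover I"
  shows "k \<in> \<Theta> \<Longrightarrow> I k \<subseteq> G" "k \<in> \<Theta> \<Longrightarrow> ind (C k) (I k)" "disjoint_family_on I \<Theta>"
    "W \<subseteq> G - cov I \<Longrightarrow> packing \<Theta> (\<lambda>k X. C k (X \<union> I k)) W S \<Longrightarrow> W = {}"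
  using assms unfolding partial_cover_def by blast+

text \<open>Some matroid can still take \<open>e\<close>, for otherwise empty sets would pack
  \<open>{e}\<close>. The commitment creates no hindrance, since \<open>almost_packing\<close> would
  turn it into a nonempty packing of the old family. A maximal packing, now using all its elements,
  is then absorbed.\<close>

lemma cover_element:
  assumes I: "partial_cover I" and e: "e \<in> G - cov I"
  shows "\<exists>I'. partial_cover I' \<and> (\<forall>k\<in>\<Theta>. I k \<subseteq> I' k) \<and> e \<in> cov I'"
proof -
  have "\<exists>q\<in>\<Theta>. e \<notin> C q (I q)"
  proof (rule ccontr)
    assume "\<not> (\<exists>q\<in>\<Theta>. e \<notin> C q (I q))"
    then have "packing \<Theta> (\<lambda>k X. C k (X \<union> I k)) {e} (\<lambda>_. {})"
      by (auto simp: packing_def disjoint_family_on_def)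
    then show False using partial_coverD(4)[OF I, of "{e}"] e by blast
  qed
  then obtain q where q: "q \<in> \<Theta>" "e \<notin> C q (I q)" by blast
  define I1 where "I1 = I(q := insert e (I q))"
  have I1: "I k \<subseteq> I1 k" "I1 k \<subseteq> insert e (I k)" for k by (auto simp: I1_def)
  define c' where "c' k X = C k (X \<union> I k)" for k X
  define c1 where "c1 k X = C k (X \<union> I1 k)" for k X
  define H0 where "H0 = G - cov I - {e}"
  have mc': "matroid_closure (c' k)" and mc1: "matroid_closure (c1 k)" if "k \<in> \<Theta>" for k
    unfolding c'_def c1_def using matroid_closure_contract[OF mc[OF that]] by blast+
  have nopack: "W = {}" if "W \<subseteq> G - cov I" "packing \<Theta> c' W S" for W S
    using partial_coverD(4)[OF I that(1)] that(2) unfolding c'_def by blast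
  have u': "unhindered \<Theta> c' (G - cov I)" unfolding unhindered_def using nopack by blast
  have u1: "unhindered \<Theta> c1 H0"
    unfolding unhindered_def
  proof (intro allI impI, rule ccontr)
    fix H T assume H: "H \<subseteq> H0" and p: "packing \<Theta> c1 H T" and "\<not> H \<subseteq> (\<Union>k\<in>\<Theta>. T k)"
    then obtain h where h: "h \<in> H" "h \<notin> (\<Union>k\<in>\<Theta>. T k)" by blast
    have HG: "H \<subseteq> G - cov I" using H by (auto simp: H0_def)
    have T: "T k \<subseteq> H" "H \<subseteq> c1 k (T k)" if "k \<in> \<Theta>" for k using p that by (auto simp: packing_def)
    have "(\<exists>S'. packing \<Theta> c' H S') \<and> \<not> H \<subseteq> c' q {}"
    proof (rule almost_packing[OF mc' u' HG, where S = T and x = e])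
      show "disjoint_family_on T \<Theta>" using p by (simp add: packing_def)
      show "H \<subseteq> c' k (T k)" if "k \<in> \<Theta>" "k \<noteq> q" for k
        using T(2)[OF that(1)] that(2) by (simp add: c'_def c1_def I1_def)
      show "H \<subseteq> c' q (insert e (T q))"
        using T(2)[OF q(1)] by (simp add: c'_def c1_def I1_def)
    qed (use T h q in auto)
    then show False using nopack[OF HG] h by blast
  qed
  obtain W T where W: "W \<subseteq> H0" and p: "packing \<Theta> c1 W T"
    and max: "\<And>W' S'. W' \<subseteq> H0 \<Longrightarrow> packing \<Theta> c1 W' S' \<Longrightarrow> W \<subseteq> W' \<Longrightarrow>
      (\<And>k. k \<in> \<Theta> \<Longrightarrow> T k \<subseteq> S' k) \<Longrightarrow> W' \<subseteq> W"
    by (rule maximal_packing[of \<Theta> c1 H0, OF mc1]) blast+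
  have T: "T k \<subseteq> W" "W \<subseteq> c1 k (T k)" if "k \<in> \<Theta>" for k using p that by (auto simp: packing_def)
  have dT: "disjoint_family_on T \<Theta>" using p by (simp add: packing_def)
  have WT: "W \<subseteq> (\<Union>k\<in>\<Theta>. T k)" by (rule unhinderedD[OF u1 W p])
  define I' where "I' k = I1 k \<union> T k" for k
  have covI': "cov I' = insert e (cov I) \<union> W"
  proof
    show "cov I' \<subseteq> insert e (cov I) \<union> W" using I1(2) T(1) by (fastforce simp: I'_def)
    show "insert e (cov I) \<union> W \<subseteq> cov I'" using I1(1) WT q by (fastforce simp: I'_def I1_def)
  qed
  have "partial_cover I'"
    unfolding partial_cover_def
  proof (intro conjI ballI allI impI)
    fix k assume k: "k \<in> \<Theta>"
    show "I' k \<subseteq> G" using I1(2)[of k] T(1)[OF k] W partial_coverD(1)[OF I k] e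
      by (auto simp: I'_def H0_def)
    have "ind (C k) (I1 k)"
      using partial_coverD(2)[OF I] ind_insert[OF mc[OF q(1)] _ q(2)] k q by (auto simp: I1_def)
    moreover have "ind (\<lambda>X. C k (X \<union> I1 k)) (T k)"
      using unhindered_packing_ind[OF mc1 u1 W p k] by (simp add: c1_def ind_def)
    ultimately show "ind (C k) (I' k)" unfolding I'_def by (rule ind_contract_self[OF mc[OF k]])
  next
    show "disjoint_family_on I' \<Theta>"
    proof (rule disjoint_familyI)
      fix j k x assume jk: "j \<in> \<Theta>" "k \<in> \<Theta>" and x: "x \<in> I' j" "x \<in> I' k"
      show "j = k"
      proof (cases "x \<in> W")
        case True
        then have "x \<noteq> e" "x \<notin> cov I" using W by (auto simp: H0_def)
        then have "x \<in> T j" "x \<in> T k" using x jk I1(2) by (fastforce simp: I'_def)+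
        then show ?thesis using disjoint_familyD[OF dT jk] by blast
      next
        case False
        then have x1: "x \<in> I1 j" "x \<in> I1 k" using x jk T(1) by (auto simp: I'_def)
        show ?thesis
        proof (cases "x = e")
          case True
          then show ?thesis using x1 e jk by (auto simp: I1_def split: if_splits)
        next
          case False
          then have "x \<in> I j" "x \<in> I k" using x1 I1(2) by blast+
          then show ?thesis using disjoint_familyD[OF partial_coverD(3)[OF I] jk] by blast
        qed
      qed
    qed
  next
    fix W1 S1 assume W1: "W1 \<subseteq> G - cov I'" and p1: "packing \<Theta> (\<lambda>k X. C k (X \<union> I' k)) W1 S1"
    have S1: "S1 k \<subseteq> W1" "W1 \<subseteq> C k (S1 k \<union> I' k)" if "k \<in> \<Theta>" for k
      using p1 that by (auto simp: packing_def)
    have disj: "W \<inter> W1 = {}" using W1 covI' by blast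
    have "packing \<Theta> c1 (W \<union> W1) (\<lambda>k. T k \<union> S1 k)"
      unfolding packing_def
    proof (intro conjI ballI)
      fix k assume k: "k \<in> \<Theta>"
      show "T k \<union> S1 k \<subseteq> W \<union> W1" using T(1)[OF k] S1(1)[OF k] by blast
      have "W \<subseteq> c1 k (T k \<union> S1 k)" using T(2)[OF k] mc_mono[OF mc1[OF k], of "T k"] by blast
      moreover have "S1 k \<union> I' k = T k \<union> S1 k \<union> I1 k" by (auto simp: I'_def)
      then have "W1 \<subseteq> c1 k (T k \<union> S1 k)" using S1(2)[OF k] by (simp add: c1_def)
      ultimately show "W \<union> W1 \<subseteq> c1 k (T k \<union> S1 k)" by blast
    next
      show "disjoint_family_on (\<lambda>k. T k \<union> S1 k) \<Theta>"
      proof (rule disjoint_familyI)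
        fix j k x assume jk: "j \<in> \<Theta>" "k \<in> \<Theta>" and x: "x \<in> T j \<union> S1 j" "x \<in> T k \<union> S1 k"
        have dS: "disjoint_family_on S1 \<Theta>" using p1 by (simp add: packing_def)
        have "x \<in> T j \<and> x \<in> T k \<or> x \<in> S1 j \<and> x \<in> S1 k"
          using x disj T(1)[OF jk(1)] T(1)[OF jk(2)] S1(1)[OF jk(1)] S1(1)[OF jk(2)] by blast
        then show "j = k" using disjoint_familyD[OF dT jk] disjoint_familyD[OF dS jk] by blast
      qed
    qed
    moreover have "W \<union> W1 \<subseteq> H0" using W W1 covI' by (auto simp: H0_def)
    ultimately have "W \<union> W1 \<subseteq> W" by (intro max[of "W \<union> W1" "\<lambda>k. T k \<union> S1 k"]) auto
    then show "W1 = {}" using disj by blast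
  qed
  moreover have "\<forall>k\<in>\<Theta>. I k \<subseteq> I' k" using I1 by (auto simp: I'_def)
  moreover have "e \<in> cov I'" using covI' by blast
  ultimately show ?thesis by blast
qed

text \<open>Deleting what is committed elsewhere makes \<open>e\<close> a coloop of matroid
  \<open>i\<close>, and it stays one when later partial coverings commit more. The state is found
  with \<open>I i\<close> released as loops of the other matroids; afterwards a maximal packing of
  the rest goes entirely to \<open>i\<close> and recaptures \<open>I i\<close>.\<close>

lemma secure_element:
  assumes I: "partial_cover I" and cG: "countable G" and i: "i \<in> \<Theta>" and cofin: "cofin_closure (C i)"
    and e: "e \<in> I i"
  shows "\<exists>I'. partial_cover I' \<and> (\<forall>k\<in>\<Theta>. I k \<subseteq> I' k) \<and> e \<notin> C i (G - (cov I' - I' i) - {e})"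
proof -
  define P where "P = I i"
  \<comment> \<open>The other matroids contract what they already hold and treat \<open>P\<close> as
    loops, so they can never claim elements of \<open>P\<close>.\<close>
  define C0 where "C0 k X = (if k = i then C i X else C k ((X - P) \<union> I k) \<union> P)" for k X
  define G0 where "G0 = (G - cov I) \<union> P"
  have PG: "P \<subseteq> G" "P \<subseteq> cov I" using partial_coverD(1)[OF I i] i by (auto simp: P_def)
  have G0G: "G0 \<subseteq> G" using PG by (auto simp: G0_def)
  have C0i: "C0 i = C i" by (auto simp: C0_def)
  have C0k: "C0 k = (\<lambda>X. C k ((X - P) \<union> I k) \<union> P)" if "k \<noteq> i" for k using that by (auto simp: C0_def)
  have mc0: "matroid_closure (C0 k)" if k: "k \<in> \<Theta>" for k
  proof (cases "k = i")
    case True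
    then show ?thesis using C0i mc[OF k] by simp
  next
    case False
    show ?thesis unfolding C0k[OF False]
      by (rule matroid_closure_loops[OF matroid_closure_contract[OF mc[OF k]]])
  qed
  interpret DF: distinguished_family \<Theta> C0 i G0
    by unfold_locales (use mc0 i in auto)
  \<comment> \<open>Removing \<open>P\<close> from a packing leaves a packing of uncovered elements,
    which is empty by the invariant; at \<open>i\<close> the part removed from \<open>S i\<close>
    lies in the contracted \<open>I i\<close>.\<close>
  have WP: "W \<subseteq> P" if W: "W \<subseteq> G0" and p: "packing \<Theta> C0 W S" for W S
  proof -
    have S: "S k \<subseteq> W" "W \<subseteq> C0 k (S k)" if "k \<in> \<Theta>" for k using p that by (auto simp: packing_def)
    have "packing \<Theta> (\<lambda>k X. C k (X \<union> I k)) (W - P) (\<lambda>k. S k - P)"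
      unfolding packing_def
    proof (intro conjI ballI)
      fix k assume k: "k \<in> \<Theta>"
      show "S k - P \<subseteq> W - P" using S(1)[OF k] by blast
      show "W - P \<subseteq> C k (S k - P \<union> I k)"
      proof (cases "k = i")
        case True
        have "C i (S i) \<subseteq> C i (S i - P \<union> I i)" by (rule mc_mono[OF mc[OF i]]) (auto simp: P_def)
        moreover have "W \<subseteq> C i (S i)" using S(2)[OF i] C0i by simp
        ultimately show ?thesis unfolding True by blast
      next
        case False
        then show ?thesis using S(2)[OF k] C0k by auto
      qed
    next
      show "disjoint_family_on (\<lambda>k. S k - P) \<Theta>"
        by (rule disjoint_family_on_mono[of S]) (use p in \<open>auto simp: packing_def\<close>)
    qed
    then have "W - P = {}" by (rule partial_coverD(4)[OF I, rotated]) (use W in \<open>auto simp: G0_def\<close>)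
    then show ?thesis by blast
  qed
  have nice0: "DF.nice C0 G0"
    unfolding DF.nice_def
  proof (intro conjI allI impI ballI)
    show "unhindered \<Theta> C0 G0"
      unfolding unhindered_def
    proof (intro allI impI)
      fix W S assume W: "W \<subseteq> G0" and p: "packing \<Theta> C0 W S"
      have S: "S i \<subseteq> W" "W \<subseteq> C i (S i)" using p i C0i unfolding packing_def by metis+
      have "W \<subseteq> S i"
      proof
        fix x assume x: "x \<in> W"
        show "x \<in> S i"
        proof (rule ccontr)
          assume "x \<notin> S i"
          then have "S i \<subseteq> I i - {x}" using S(1) WP[OF W p] by (auto simp: P_def)
          then have "x \<in> C i (I i - {x})" using S(2) x mc_monoD[OF mc[OF i]] by blast
          then show False using indD[OF partial_coverD(2)[OF I i]] WP[OF W p] x by (auto simp: P_def)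
        qed
      qed
      then show "W \<subseteq> (\<Union>k\<in>\<Theta>. S k)" using i by blast
    qed
  next
    fix W S k assume W: "W \<subseteq> G0" "packing \<Theta> C0 W S" and k: "k \<in> \<Theta> - {i}"
    have "P \<subseteq> C0 k {}" using C0k[of k] k by simp
    then show "W \<subseteq> C0 k {}" using WP[OF W] by blast
  qed
  have cG0: "countable G0" using cG G0G by (rule countable_subset[rotated])
  have eG0: "e \<in> G0" using e by (simp add: G0_def P_def)
  have "\<exists>J. DF.state J \<and> e \<in> DF.cospan J"
    by (rule DF.cospan_attained[OF cG0 nice0 eG0]) (use cofin C0i in \<open>auto simp: cofin_closure_def\<close>)
  then obtain J where J: "DF.state J" "e \<in> DF.cospan J" by blast
  have pre: "DF.prestate J" and niceJ: "DF.nice (DF.contr J) (G0 - DF.used J)"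
    using J(1) by (auto simp: DF.state_def)
  define X where "X = DF.used J"
  have Xk: "J k \<subseteq> X" if "k \<in> \<Theta>" "k \<noteq> i" for k using that by (auto simp: X_def)
  have JP: "J k \<inter> P = {}" if k: "k \<in> \<Theta>" "k \<noteq> i" for k
    using DF.prestateD(2)[OF pre k] C0k[OF k(2)] by (auto simp: ind_def)
  have XP: "X \<inter> P = {}" using JP by (auto simp: X_def)
  have XG: "X \<subseteq> G - cov I" using DF.prestateD(5)[OF pre] XP by (auto simp: X_def G0_def)
  have contri: "DF.contr J i = C i" using C0i by (auto simp: DF.contr_def)
  have contrk: "DF.contr J k Y = C k ((Y \<union> J k - P) \<union> I k) \<union> P" if "k \<noteq> i" for k Y
    using that C0k[OF that] by (auto simp: DF.contr_def)
  have eX: "e \<notin> C i (G0 - X - {e})"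
    using J(2) e XP C0i by (auto simp: DF.cospan_def X_def P_def)
  have uJ: "unhindered \<Theta> (DF.contr J) (G0 - X)" using niceJ by (simp add: DF.nice_def X_def)
  obtain W T where W: "W \<subseteq> G0 - X" and p: "packing \<Theta> (DF.contr J) W T"
    and max: "\<And>W' S'. W' \<subseteq> G0 - X \<Longrightarrow> packing \<Theta> (DF.contr J) W' S' \<Longrightarrow> W \<subseteq> W' \<Longrightarrow>
      (\<And>k. k \<in> \<Theta> \<Longrightarrow> T k \<subseteq> S' k) \<Longrightarrow> W' \<subseteq> W"
    by (rule maximal_packing[of \<Theta> "DF.contr J" "G0 - X", OF DF.mc_contr]) blast+
  have T: "T k \<subseteq> W" "W \<subseteq> DF.contr J k (T k)" if "k \<in> \<Theta>" for k using p that by (auto simp: packing_def)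
  have dT: "disjoint_family_on T \<Theta>" using p by (simp add: packing_def)
  have Wk: "W \<subseteq> DF.contr J k {}" if "k \<in> \<Theta>" "k \<noteq> i" for k
    using niceJ W p that unfolding DF.nice_def X_def by blast
  \<comment> \<open>The other matroids see only loops in \<open>W\<close>, so empty members suffice
    there; unhinderedness then forces \<open>T i\<close> to be all of \<open>W\<close>.\<close>
  have "packing \<Theta> (DF.contr J) W (\<lambda>k. if k = i then T i else {})"
    using T Wk by (auto simp: packing_def disjoint_family_on_def)
  then have "W \<subseteq> (\<Union>k\<in>\<Theta>. if k = i then T i else {})" by (rule unhinderedD[OF uJ W])
  then have Ti: "T i = W" using T(1)[OF i] by (auto split: if_splits)
  have Tk: "T k = {}" if "k \<in> \<Theta>" "k \<noteq> i" for k
    using disjoint_familyD[OF dT that(1) i] T(1)[OF that(1)] Ti that(2) by blast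
  \<comment> \<open>Loops at the other indices can be added to the member of \<open>i\<close>;
    maximality yields \<open>P \<subseteq> W\<close>, so nothing committed to \<open>i\<close> is
    lost.\<close>
  have "packing \<Theta> (DF.contr J) (W \<union> P) (\<lambda>k. if k = i then W \<union> P else {})"
    using Wk mc_ext[OF mc[OF i], of "W \<union> P"] contri contrk
    by (auto simp: packing_def disjoint_family_on_def)
  then have "W \<union> P \<subseteq> W"
    by (rule max[rotated]) (use W XP Ti Tk in \<open>auto simp: G0_def\<close>)
  then have PW: "P \<subseteq> W" by blast
  have indW: "ind (C i) W"
    using unhindered_packing_ind[OF DF.mc_contr uJ W p i] Ti contri by simp
  define I' where "I' k = (if k = i then W else I k \<union> J k)" for k
  have covI': "cov I \<union> X \<union> W \<subseteq> cov I'"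
    using PW i Xk by (auto simp: I'_def X_def P_def split: if_splits)
  have pc: "partial_cover I'"
    unfolding partial_cover_def
  proof (intro conjI ballI allI impI)
    fix k assume k: "k \<in> \<Theta>"
    show "I' k \<subseteq> G"
    proof (cases "k = i")
      case True
      then show ?thesis using W G0G by (auto simp: I'_def)
    next
      case False
      then have "I' k = I k \<union> J k" by (simp add: I'_def)
      then show ?thesis using partial_coverD(1)[OF I k] XG Xk[OF k False] by blast
    qed
    show "ind (C k) (I' k)"
    proof (cases "k = i")
      case True
      then show ?thesis using indW by (simp add: I'_def)
    next
      case False
      have "ind (\<lambda>X. C k (X \<union> I k)) (J k)"
        unfolding ind_def
      proof
        fix x assume x: "x \<in> J k"
        have "x \<notin> C0 k (J k - {x})" using indD[OF DF.prestateD(2)[OF pre k False] x] .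
        moreover have "J k - {x} - P = J k - {x}" using JP[OF k False] by blast
        ultimately show "x \<notin> C k (J k - {x} \<union> I k)" using C0k[OF False] by simp
      qed
      then show ?thesis
        using ind_contract_self[OF mc[OF k] partial_coverD(2)[OF I k]] False by (simp add: I'_def)
    qed
  next
    show "disjoint_family_on I' \<Theta>"
    proof (rule disjoint_familyI)
      have WI: "x \<notin> I' k" if "k \<in> \<Theta>" "k \<noteq> i" "x \<in> W" for x k
      proof
        assume "x \<in> I' k"
        then have "x \<in> I k \<or> x \<in> J k" using that by (simp add: I'_def)
        moreover have "x \<notin> J k" using W that Xk by blast
        ultimately have "x \<in> I k" by blast
        then have "x \<in> I i" using W that by (auto simp: G0_def P_def)
        then show False
          using disjoint_familyD[OF partial_coverD(3)[OF I] that(1) i \<open>x \<in> I k\<close>] that(2) by blast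
      qed
      fix j k x assume jk: "j \<in> \<Theta>" "k \<in> \<Theta>" and x: "x \<in> I' j" "x \<in> I' k"
      show "j = k"
      proof (cases "j = i \<or> k = i")
        case True
        then show ?thesis using WI x jk by (metis I'_def)
      next
        case False
        then have x': "x \<in> I j \<or> x \<in> J j" "x \<in> I k \<or> x \<in> J k" using x by (auto simp: I'_def)
        show ?thesis
        proof (cases "x \<in> cov I")
          case True
          then have "x \<notin> X" using XG by blast
          then have "x \<in> I j" "x \<in> I k" using x' Xk jk False by blast+
          then show ?thesis using disjoint_familyD[OF partial_coverD(3)[OF I] jk] by blast
        next
          case False
          then have "x \<in> J j" "x \<in> J k" using x' jk by blast+
          then show ?thesis
            using disjoint_familyD[OF DF.prestateD(3)[OF pre], of j k x] jk \<open>\<not> (j = i \<or> k = i)\<close> by blast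
        qed
      qed
    qed
  next
    fix W1 S1 assume W1: "W1 \<subseteq> G - cov I'" and p1: "packing \<Theta> (\<lambda>k X. C k (X \<union> I' k)) W1 S1"
    have S1: "S1 k \<subseteq> W1" "W1 \<subseteq> C k (S1 k \<union> I' k)" if "k \<in> \<Theta>" for k
      using p1 that by (auto simp: packing_def)
    have dS: "disjoint_family_on S1 \<Theta>" using p1 by (simp add: packing_def)
    have W1': "W1 \<inter> W = {}" "W1 \<inter> cov I = {}" "W1 \<inter> X = {}" "W1 \<subseteq> G" using W1 covI' by blast+
    define S' where "S' k = (if k = i then W \<union> S1 i else S1 k)" for k
    have "packing \<Theta> (DF.contr J) (W \<union> W1) S'"
      unfolding packing_def
    proof (intro conjI ballI)
      fix k assume k: "k \<in> \<Theta>"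
      show "S' k \<subseteq> W \<union> W1" using S1(1)[OF k] by (auto simp: S'_def)
      show "W \<union> W1 \<subseteq> DF.contr J k (S' k)"
      proof (cases "k = i")
        case True
        have "W1 \<subseteq> C i (W \<union> S1 i)" using S1(2)[OF i] by (simp add: I'_def Un_commute)
        then show ?thesis using True contri mc_ext[OF mc[OF i], of "W \<union> S1 i"] by (auto simp: S'_def)
      next
        case False
        have "W \<subseteq> DF.contr J k (S' k)"
          using Wk[OF k False] mc_mono[OF DF.mc_contr[OF k], of "{}" "S' k"] by blast
        moreover have "(S1 k \<union> J k - P) \<union> I k = S1 k \<union> (I k \<union> J k)"
          using JP[OF k False] S1(1)[OF k] W1'(1) PW by blast
        then have "W1 \<subseteq> DF.contr J k (S' k)"
          using S1(2)[OF k] contrk[OF False] False by (auto simp: S'_def I'_def)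
        ultimately show ?thesis by blast
      qed
    next
      show "disjoint_family_on S' \<Theta>"
      proof (rule disjoint_familyI)
        fix j k x assume jk: "j \<in> \<Theta>" "k \<in> \<Theta>" and x: "x \<in> S' j" "x \<in> S' k"
        show "j = k"
        proof (cases "x \<in> W")
          case True
          then have "x \<notin> S1 l" if "l \<in> \<Theta>" for l using S1(1)[OF that] W1'(1) by blast
          then show ?thesis using x jk by (auto simp: S'_def split: if_splits)
        next
          case False
          then have "x \<in> S1 j" "x \<in> S1 k" using x by (auto simp: S'_def split: if_splits)
          then show ?thesis using disjoint_familyD[OF dS jk] by blast
        qed
      qed
    qed
    moreover have "W \<union> W1 \<subseteq> G0 - X" using W W1' by (auto simp: G0_def)
    ultimately have "W \<union> W1 \<subseteq> W"
      by (intro max[of "W \<union> W1" S']) (use Ti Tk in \<open>auto simp: S'_def\<close>)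
    then show "W1 = {}" using W1'(1) by blast
  qed
  have "G - (cov I' - I' i) - {e} \<subseteq> G0 - X - {e}"
  proof
    fix x assume x: "x \<in> G - (cov I' - I' i) - {e}"
    show "x \<in> G0 - X - {e}"
    proof (cases "x \<in> W")
      case True
      then show ?thesis using W x by blast
    next
      case False
      then have "x \<notin> cov I'" using x by (auto simp: I'_def)
      then have "x \<notin> cov I" "x \<notin> X" using covI' by blast+
      then show ?thesis using x by (auto simp: G0_def)
    qed
  qed
  then have "e \<notin> C i (G - (cov I' - I' i) - {e})" using eX mc_monoD[OF mc[OF i]] by blast
  moreover have "\<forall>k\<in>\<Theta>. I k \<subseteq> I' k" using PW by (auto simp: I'_def P_def)
  ultimately show ?thesis using pc by blast
qed

lemma finite_subset_chain:
  assumes "finite F" "F \<subseteq> (\<Union>n::nat. A n)" "\<And>m n. m \<le> n \<Longrightarrow> A m \<subseteq> A n"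
  shows "\<exists>n. F \<subseteq> A n"
  using assms(1,2)
proof (induction F)
  case (insert x F)
  then obtain m n where "F \<subseteq> A m" "x \<in> A n" by blast
  then have "insert x F \<subseteq> A (max m n)" using assms(3)[of m "max m n"] assms(3)[of n "max m n"] by auto
  then show ?case by blast
qed simp

text \<open>Each element is covered at its turn and, if its matroid is cofinitary, secured in the
  same turn. A dependence in the limit uses finitely many elements in a finitary matroid. In a
  cofinitary one, the limit set without \<open>x\<close> lies inside the set certified not to span
  \<open>x\<close>.\<close>

theorem covering_exists:
  assumes cG: "countable G" and fc: "\<And>k. k \<in> \<Theta> \<Longrightarrow> fin_closure (C k) \<or> cofin_closure (C k)"
    and np: "\<And>W S. W \<subseteq> G \<Longrightarrow> packing \<Theta> C W S \<Longrightarrow> W = {}"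
  shows "\<exists>I. (\<forall>k\<in>\<Theta>. I k \<subseteq> G \<and> ind (C k) (I k)) \<and> cov I = G"
proof (cases "G = {}")
  case True
  then show ?thesis by (intro exI[of _ "\<lambda>_. {}"]) auto
next
  case False
  have pc0: "partial_cover (\<lambda>_. {})"
    using np by (auto simp: partial_cover_def disjoint_family_on_def)
  define g where "g = from_nat_into G"
  have gG: "g n \<in> G" for n using from_nat_into[OF False] by (simp add: g_def)
  let ?wit = "\<lambda>I x k. x \<notin> C k (G - (cov I - I k) - {x})"
  let ?Q = "\<lambda>n I I'. (\<forall>k\<in>\<Theta>. I k \<subseteq> I' k) \<and> g n \<in> cov I' \<and>
     (\<forall>k\<in>\<Theta>. g n \<in> I' k \<longrightarrow> cofin_closure (C k) \<longrightarrow> ?wit I' (g n) k)"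
  have "\<exists>s. \<forall>n. partial_cover (s n) \<and> ?Q n (s n) (s (Suc n))"
  proof (rule dependent_nat_choice)
    show "\<exists>I. partial_cover I" using pc0 by blast
    fix I n assume I: "partial_cover I"
    obtain I1 where I1: "partial_cover I1" "\<forall>k\<in>\<Theta>. I k \<subseteq> I1 k" "g n \<in> cov I1"
      using cover_element[OF I, of "g n"] gG[of n] I by blast
    obtain i where i: "i \<in> \<Theta>" "g n \<in> I1 i" using I1(3) by blast
    have uniq: "k = i" if "k \<in> \<Theta>" "partial_cover I2" "g n \<in> I2 k" "g n \<in> I2 i" for k I2
      using disjoint_familyD[OF partial_coverD(3)[OF that(2)] that(1) i(1) that(3,4)] .
    show "\<exists>I'. partial_cover I' \<and> ?Q n I I'"
    proof (cases "cofin_closure (C i)")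
      case True
      obtain I2 where I2: "partial_cover I2" "\<forall>k\<in>\<Theta>. I1 k \<subseteq> I2 k" "?wit I2 (g n) i"
        using secure_element[OF I1(1) cG i(1) True i(2)] by blast
      have "g n \<in> I2 i" using I2(2) i by blast
      then have "?Q n I I2" using I1(2) I2 uniq[OF _ I2(1)] i(1) by blast
      then show ?thesis using I2(1) by blast
    next
      case False
      then have "?Q n I I1" using I1 uniq[OF _ I1(1)] i by blast
      then show ?thesis using I1(1) by blast
    qed
  qed
  then obtain s where pc: "\<And>n. partial_cover (s n)" and s: "\<And>n. ?Q n (s n) (s (Suc n))" by blast
  have mono: "s m k \<subseteq> s n k" if "m \<le> n" "k \<in> \<Theta>" for m n k
    using that(1) by (induction rule: dec_induct) (use s that(2) in blast)+
  define L where "L k = (\<Union>n. s n k)" for k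
  have LG: "L k \<subseteq> G" if "k \<in> \<Theta>" for k using partial_coverD(1)[OF pc that] by (auto simp: L_def)
  \<comment> \<open>A covered element never changes its matroid: a later stage would otherwise hold
    it twice.\<close>
  have stab: "x \<in> s n k" if k: "k \<in> \<Theta>" and xL: "x \<in> L k" and xc: "x \<in> cov (s n)" for x n k
  proof -
    obtain m where m: "x \<in> s m k" using xL unfolding L_def by blast
    obtain j where j: "j \<in> \<Theta>" "x \<in> s n j" using xc by blast
    have "x \<in> s (max m n) k" "x \<in> s (max m n) j"
      using mono[of m "max m n" k] mono[of n "max m n" j] m j k by auto
    then have "j = k" using disjoint_familyD[OF partial_coverD(3)[OF pc] j(1) k] by blast
    then show ?thesis using j by simp
  qed
  have "ind (C k) (L k)" if k: "k \<in> \<Theta>" for k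
    unfolding ind_def
  proof (intro ballI notI)
    fix x assume x: "x \<in> L k" and xc: "x \<in> C k (L k - {x})"
    consider "fin_closure (C k)" | "cofin_closure (C k)" using fc[OF k] by blast
    then show False
    proof cases
      case 1
      then obtain F where F: "finite F" "F \<subseteq> L k - {x}" "x \<in> C k F"
        using xc unfolding fin_closure_def by blast
      have "insert x F \<subseteq> (\<Union>n. s n k)" using F x by (auto simp: L_def)
      then obtain n where n: "insert x F \<subseteq> s n k"
        using finite_subset_chain[of "insert x F" "\<lambda>n. s n k"] F(1) mono[OF _ k] by blast
      then have "F \<subseteq> s n k - {x}" using F(2) by blast
      then have "x \<in> C k (s n k - {x})" using F(3) mc_monoD[OF mc[OF k]] by blast
      then show False using indD[OF partial_coverD(2)[OF pc k]] n by blast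
    next
      case 2
      have "x \<in> G" using x LG[OF k] by blast
      then obtain n where n: "x = g n" using from_nat_into_surj[OF cG] by (metis g_def)
      have "x \<in> cov (s (Suc n))" using s[of n] n by blast
      then have xs: "x \<in> s (Suc n) k" using stab[OF k x] by blast
      then have w: "?wit (s (Suc n)) x k" using s[of n] n k 2 by blast
      have "L k - {x} \<subseteq> G - (cov (s (Suc n)) - s (Suc n) k) - {x}"
        using stab[OF k] LG[OF k] by blast
      then show False using w xc mc_monoD[OF mc[OF k]] by blast
    qed
  qed
  moreover have "cov L = G"
  proof
    show "cov L \<subseteq> G" using LG by blast
    show "G \<subseteq> cov L"
    proof
      fix x assume "x \<in> G"
      then obtain n where "x = g n" using from_nat_into_surj[OF cG] by (metis g_def)
      then have "x \<in> cov (s (Suc n))" using s[of n] by blast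
      then show "x \<in> cov L" by (auto simp: L_def)
    qed
  qed
  ultimately show ?thesis using LG by blast
qed

end

section \<open>From independence systems to closure operators\<close>

text \<open>Closure operators live on the whole type: elements outside the ground set are loops.\<close>

definition closure_of :: "'a set set \<Rightarrow> 'a set \<Rightarrow> 'a set" where
  "closure_of \<I> X = {e. e \<in> X \<or> (\<exists>J\<in>\<I>. J \<subseteq> X \<and> insert e J \<notin> \<I>)}"

lemma matroidD:
  assumes "matroid E \<I>"
  shows "I \<in> \<I> \<Longrightarrow> I \<subseteq> E" "{} \<in> \<I>" "I \<in> \<I> \<Longrightarrow> J \<subseteq> I \<Longrightarrow> J \<in> \<I>"
    "I \<in> \<I> \<Longrightarrow> is_maximal_in \<I> J \<Longrightarrow> \<not> is_maximal_in \<I> I \<Longrightarrow> \<exists>e\<in>J - I. insert e I \<in> \<I>"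
proof -
  show "I \<in> \<I> \<Longrightarrow> I \<subseteq> E" "{} \<in> \<I>" "I \<in> \<I> \<Longrightarrow> J \<subseteq> I \<Longrightarrow> J \<in> \<I>"
    using assms by (simp_all add: matroid_def)
  assume I: "I \<in> \<I>" and J: "is_maximal_in \<I> J" "\<not> is_maximal_in \<I> I"
  have "J \<in> \<I>" using J by (simp add: is_maximal_in_def)
  moreover have "\<forall>I\<in>\<I>. \<forall>J\<in>\<I>. is_maximal_in \<I> J \<and> \<not> is_maximal_in \<I> I \<longrightarrow>
      (\<exists>e\<in>J - I. insert e I \<in> \<I>)"
    using assms unfolding matroid_def by (elim conjE)
  ultimately show "\<exists>e\<in>J - I. insert e I \<in> \<I>" using I J by blast
qed

lemma matroid_extend:
  assumes m: "matroid E \<I>" and I: "I \<in> \<I>" "I \<subseteq> X"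
  shows "\<exists>B. I \<subseteq> B \<and> is_maximal_in {J \<in> \<I>. J \<subseteq> X} B"
proof -
  have "\<forall>X. X \<subseteq> E \<longrightarrow> (\<forall>I\<in>\<I>. I \<subseteq> X \<longrightarrow>
      (\<exists>B. I \<subseteq> B \<and> is_maximal_in {J \<in> \<I>. J \<subseteq> X} B))"
    using m unfolding matroid_def by (elim conjE)
  then have "\<exists>B. I \<subseteq> B \<and> is_maximal_in {J \<in> \<I>. J \<subseteq> X \<inter> E} B"
    using I matroidD(1)[OF m I(1)] by (meson Int_lower2 le_inf_iff)
  moreover have "{J \<in> \<I>. J \<subseteq> X \<inter> E} = {J \<in> \<I>. J \<subseteq> X}" using matroidD(1)[OF m] by blast
  ultimately show ?thesis by simp
qed

lemma maximal_inD:
  assumes "is_maximal_in {J \<in> \<I>. J \<subseteq> X} B"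
  shows "B \<in> \<I>" "B \<subseteq> X" "\<And>e. e \<in> X \<Longrightarrow> insert e B \<in> \<I> \<Longrightarrow> e \<in> B"
proof -
  show B: "B \<in> \<I>" "B \<subseteq> X" using assms by (simp_all add: is_maximal_in_def)
  fix e assume "e \<in> X" "insert e B \<in> \<I>"
  then have "insert e B \<in> {J \<in> \<I>. J \<subseteq> X}" using B by blast
  moreover have "\<forall>J\<in>{J \<in> \<I>. J \<subseteq> X}. B \<subseteq> J \<longrightarrow> J = B" using assms by (simp add: is_maximal_in_def)
  ultimately have "insert e B = B" by blast
  then show "e \<in> B" by blast
qed

lemma maximal_inI:
  assumes m: "matroid E \<I>" and "B \<in> \<I>" "B \<subseteq> X" "\<And>e. e \<in> X \<Longrightarrow> insert e B \<in> \<I> \<Longrightarrow> e \<in> B"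
  shows "is_maximal_in {J \<in> \<I>. J \<subseteq> X} B"
  unfolding is_maximal_in_def
proof (intro conjI ballI impI)
  show "B \<in> {J \<in> \<I>. J \<subseteq> X}" using assms by blast
  fix J assume J: "J \<in> {J \<in> \<I>. J \<subseteq> X}" "B \<subseteq> J"
  have "e \<in> B" if "e \<in> J" for e
    using assms(4)[of e] matroidD(3)[OF m, of J "insert e B"] J that by blast
  then show "J = B" using J by blast
qed

lemma maximal_in_spanning:
  assumes m: "matroid E \<I>" and B: "is_maximal_in \<I> B" and L: "is_maximal_in {J \<in> \<I>. J \<subseteq> X} L"
    and BX: "B \<subseteq> X"
  shows "is_maximal_in \<I> L"
proof (rule ccontr)
  assume "\<not> is_maximal_in \<I> L"
  then obtain e where e: "e \<in> B - L" "insert e L \<in> \<I>"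
    using matroidD(4)[OF m maximal_inD(1)[OF L] B] by blast
  then show False using maximal_inD(3)[OF L, of e] BX by blast
qed

text \<open>Extending to bases of the whole matroid, a failure would let some \<open>B + e\<close> with \<open>e \<in> X\<close> be
  independent.\<close>

lemma restricted_exchange:
  assumes m: "matroid E \<I>" and B: "is_maximal_in {J \<in> \<I>. J \<subseteq> X} B" and I: "I \<in> \<I>" "I \<subseteq> X"
    and x: "x \<in> X" "x \<notin> I" "insert x I \<in> \<I>"
  shows "\<exists>e\<in>B - I. insert e I \<in> \<I>"
proof (rule ccontr)
  assume no: "\<not> (\<exists>e\<in>B - I. insert e I \<in> \<I>)"
  obtain B' where B': "B \<subseteq> B'" "is_maximal_in {J \<in> \<I>. J \<subseteq> UNIV} B'"
    using matroid_extend[OF m maximal_inD(1)[OF B], of UNIV] by blast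
  then have B'm: "is_maximal_in \<I> B'" "B' \<in> \<I>" by (auto simp: is_maximal_in_def)
  have B'X: "B' \<inter> X = B"
  proof
    show "B \<subseteq> B' \<inter> X" using B' maximal_inD(2)[OF B] by blast
    show "B' \<inter> X \<subseteq> B"
    proof
      fix e assume e: "e \<in> B' \<inter> X"
      then have "insert e B \<in> \<I>" using matroidD(3)[OF m B'm(2), of "insert e B"] B' by blast
      then show "e \<in> B" using maximal_inD(3)[OF B] e by blast
    qed
  qed
  obtain I' where I': "I \<subseteq> I'" "is_maximal_in {J \<in> \<I>. J \<subseteq> I \<union> B'} I'"
    using matroid_extend[OF m I(1), of "I \<union> B'"] by blast
  have I'm: "is_maximal_in \<I> I'" by (rule maximal_in_spanning[OF m B'm(1) I'(2)]) blast
  \<comment> \<open>With no exchange from \<open>B\<close> available, completing \<open>I\<close> to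
    a basis adds only elements outside \<open>X\<close>.\<close>
  have I'X: "I' \<inter> X \<subseteq> I"
  proof
    fix e assume e: "e \<in> I' \<inter> X"
    show "e \<in> I"
    proof (rule ccontr)
      assume "e \<notin> I"
      then have "e \<in> B - I" using e maximal_inD(2)[OF I'(2)] B'X by blast
      moreover have "insert e I \<in> \<I>"
        using matroidD(3)[OF m maximal_inD(1)[OF I'(2)], of "insert e I"] e I' by blast
      ultimately show False using no by blast
    qed
  qed
  define K where "K = I' - I"
  have K: "K \<subseteq> B' - X" "I' = I \<union> K" using I'X I' maximal_inD(2)[OF I'(2)] by (auto simp: K_def)
  \<comment> \<open>This basis contains \<open>x\<close> and stays inside
    \<open>insert x I'\<close>, so it must give up some \<open>y\<close> of
    \<open>K\<close>.\<close>
  obtain L where L: "insert x I \<subseteq> L" "is_maximal_in {J \<in> \<I>. J \<subseteq> insert x I'} L"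
    using matroid_extend[OF m x(3), of "insert x I'"] I' by blast
  have Lm: "is_maximal_in \<I> L" by (rule maximal_in_spanning[OF m I'm L(2)]) blast
  have "x \<notin> I'" using x I'X by blast
  have "\<not> K \<subseteq> L"
  proof
    assume "K \<subseteq> L"
    then have "I' \<subseteq> L" using K L by blast
    then have "L = I'" using I'm maximal_inD(1)[OF L(2)] unfolding is_maximal_in_def by blast
    then show False using L \<open>x \<notin> I'\<close> by blast
  qed
  then obtain y where y: "y \<in> K" "y \<notin> L" by blast
  \<comment> \<open>As \<open>insert y N\<close> is independent, \<open>N\<close> is no basis and
    gains an element of \<open>L\<close>. That element cannot come from \<open>K\<close>, so it lies
    in \<open>X\<close> and contradicts maximality of \<open>B\<close>.\<close>
  define N where "N = B \<union> (K \<inter> L)"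
  have "insert y N \<subseteq> B'" using K B' y by (auto simp: N_def)
  then have N: "N \<in> \<I>" "insert y N \<in> \<I>" using matroidD(3)[OF m B'm(2)] by blast+
  have yN: "y \<notin> N" using K y maximal_inD(2)[OF B] by (auto simp: N_def)
  have "\<not> is_maximal_in \<I> N" using N yN unfolding is_maximal_in_def by blast
  then obtain e where e: "e \<in> L - N" "insert e N \<in> \<I>" using matroidD(4)[OF m N(1) Lm] by blast
  have "e \<in> X" using e maximal_inD(2)[OF L(2)] K x I by (auto simp: N_def)
  moreover have "insert e B \<in> \<I>" using matroidD(3)[OF m e(2), of "insert e B"] by (auto simp: N_def)
  ultimately show False using maximal_inD(3)[OF B, of e] e by (auto simp: N_def)
qed

text \<open>One maximal independent subset decides membership: if \<open>e\<close> were blocked by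
  another one but not by \<open>B\<close>, \<open>restricted_exchange\<close> inside
  \<open>insert e X\<close> would enlarge \<open>B\<close> within \<open>X\<close>.\<close>

lemma closure_of_base:
  assumes m: "matroid E \<I>" and B: "is_maximal_in {J \<in> \<I>. J \<subseteq> X} B"
  shows "e \<in> closure_of \<I> X \<longleftrightarrow> e \<in> X \<or> insert e B \<notin> \<I>"
proof
  assume "e \<in> X \<or> insert e B \<notin> \<I>"
  then show "e \<in> closure_of \<I> X"
    using maximal_inD(1,2)[OF B] unfolding closure_of_def by blast
next
  assume e: "e \<in> closure_of \<I> X"
  show "e \<in> X \<or> insert e B \<notin> \<I>"
  proof (rule ccontr)
    assume "\<not> (e \<in> X \<or> insert e B \<notin> \<I>)"
    then have eX: "e \<notin> X" and eB: "insert e B \<in> \<I>" by auto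
    then obtain J where J: "J \<in> \<I>" "J \<subseteq> X" "insert e J \<notin> \<I>"
      using e unfolding closure_of_def by blast
    obtain J' where J': "J \<subseteq> J'" "is_maximal_in {J \<in> \<I>. J \<subseteq> X} J'"
      using matroid_extend[OF m J(1,2)] by blast
    have "insert e J' \<notin> \<I>" using matroidD(3)[OF m, of "insert e J'" "insert e J"] J J' by blast
    then have "is_maximal_in {J \<in> \<I>. J \<subseteq> insert e X} J'"
      using maximal_inD[OF J'(2)] by (intro maximal_inI[OF m]) auto
    then obtain f where f: "f \<in> J' - B" "insert f B \<in> \<I>"
      using restricted_exchange[OF m, of "insert e X" J' B e] maximal_inD[OF B] eX eB by blast
    then show False using maximal_inD(3)[OF B, of f] maximal_inD(2)[OF J'(2)] by blast
  qed
qed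

lemma ind_closure_of:
  assumes m: "matroid E \<I>"
  shows "ind (closure_of \<I>) I \<longleftrightarrow> I \<in> \<I>"
proof
  assume I: "I \<in> \<I>"
  show "ind (closure_of \<I>) I"
    unfolding ind_def
  proof
    fix x assume x: "x \<in> I"
    have "I - {x} \<in> \<I>" by (rule matroidD(3)[OF m I]) auto
    then have "is_maximal_in {J \<in> \<I>. J \<subseteq> I - {x}} (I - {x})" by (intro maximal_inI[OF m]) auto
    then show "x \<notin> closure_of \<I> (I - {x})"
      using closure_of_base[OF m] I x by (simp add: insert_absorb)
  qed
next
  assume i: "ind (closure_of \<I>) I"
  obtain B where B: "is_maximal_in {J \<in> \<I>. J \<subseteq> I} B"
    using matroid_extend[OF m matroidD(2)[OF m], of I] by blast
  have "x \<in> B" if x: "x \<in> I" for x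
  proof (rule ccontr)
    assume xB: "x \<notin> B"
    then have "insert x B \<notin> \<I>" using maximal_inD(3)[OF B x] by blast
    moreover have "B \<subseteq> I - {x}" using maximal_inD(2)[OF B] xB by blast
    ultimately have "x \<in> closure_of \<I> (I - {x})"
      using maximal_inD(1)[OF B] unfolding closure_of_def by blast
    then show False using indD[OF i x] by blast
  qed
  then have "B = I" using maximal_inD(2)[OF B] by blast
  then show "I \<in> \<I>" using maximal_inD(1)[OF B] by simp
qed

lemma matroid_closure_closure_of:
  assumes m: "matroid E \<I>"
  shows "matroid_closure (closure_of \<I>)"
proof (rule matroid_closureI)
  fix X show "X \<subseteq> closure_of \<I> X" by (auto simp: closure_of_def)
next
  fix X Y :: "'a set" assume "X \<subseteq> Y"
  then show "closure_of \<I> X \<subseteq> closure_of \<I> Y" unfolding closure_of_def by blast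
next
  fix X
  obtain B where B: "is_maximal_in {J \<in> \<I>. J \<subseteq> X} B"
    using matroid_extend[OF m matroidD(2)[OF m], of X] by blast
  have "is_maximal_in {J \<in> \<I>. J \<subseteq> closure_of \<I> X} B"
  proof (rule maximal_inI[OF m maximal_inD(1)[OF B]])
    show "B \<subseteq> closure_of \<I> X" using maximal_inD(2)[OF B] by (auto simp: closure_of_def)
    show "e \<in> B" if "e \<in> closure_of \<I> X" "insert e B \<in> \<I>" for e
      using that closure_of_base[OF m B] maximal_inD(3)[OF B] by blast
  qed
  then show "closure_of \<I> (closure_of \<I> X) \<subseteq> closure_of \<I> X"
    using closure_of_base[OF m] B by blast
next
  fix a b X assume b: "b \<in> closure_of \<I> (insert a X)" "b \<notin> closure_of \<I> X"
  obtain B where B: "is_maximal_in {J \<in> \<I>. J \<subseteq> X} B"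
    using matroid_extend[OF m matroidD(2)[OF m], of X] by blast
  have bB: "insert b B \<in> \<I>" "b \<notin> X" using b(2) closure_of_base[OF m B] by blast+
  show "a \<in> closure_of \<I> (insert b X)"
  proof (cases "a = b")
    case True
    then show ?thesis by (auto simp: closure_of_def)
  next
    case False
    obtain B1 where B1: "B \<subseteq> B1" "is_maximal_in {J \<in> \<I>. J \<subseteq> insert a X} B1"
      using matroid_extend[OF m maximal_inD(1)[OF B], of "insert a X"] maximal_inD(2)[OF B] by blast
    have "B1 \<subseteq> insert a B"
    proof
      fix e assume e: "e \<in> B1"
      have "insert e B \<in> \<I>" using matroidD(3)[OF m maximal_inD(1)[OF B1(2)], of "insert e B"] B1 e by blast
      then show "e \<in> insert a B" using maximal_inD(3)[OF B, of e] maximal_inD(2)[OF B1(2)] e by blast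
    qed
    moreover have "insert b B1 \<notin> \<I>" using b(1) closure_of_base[OF m B1(2), of b] bB False by auto
    ultimately have "insert b (insert a B) \<notin> \<I>"
      using matroidD(3)[OF m, of "insert b (insert a B)" "insert b B1"] by blast
    then have "insert a (insert b B) \<notin> \<I>" by (simp add: insert_commute)
    moreover have "insert b B \<subseteq> insert b X" using maximal_inD(2)[OF B] by blast
    ultimately show ?thesis using bB unfolding closure_of_def by blast
  qed
next
  fix I X assume IX: "I \<subseteq> X" and "ind (closure_of \<I>) I"
  then have "I \<in> \<I>" using ind_closure_of[OF m] by simp
  then obtain B where B: "I \<subseteq> B" "is_maximal_in {J \<in> \<I>. J \<subseteq> X} B"
    using matroid_extend[OF m _ IX] by blast
  have "X \<subseteq> closure_of \<I> B"
    using maximal_inD[OF B(2)] unfolding closure_of_def by blast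
  then show "\<exists>B. I \<subseteq> B \<and> B \<subseteq> X \<and> ind (closure_of \<I>) B \<and> X \<subseteq> closure_of \<I> B"
    using B(1) maximal_inD(1,2)[OF B(2)] ind_closure_of[OF m, of B] by blast
qed

text \<open>The circuit is \<open>e\<close> with its fundamental set \<open>D\<close> over a base
  \<open>B\<close> of \<open>X\<close>. A proper subset containing \<open>e\<close> misses some
  \<open>y\<close> of \<open>D\<close>, and \<open>B - {y}\<close> does not span
  \<open>e\<close>.\<close>

lemma closure_of_circuit:
  assumes m: "matroid E \<I>" and e: "e \<in> closure_of \<I> X" "e \<notin> X" "e \<in> E"
  shows "\<exists>K\<in>circuits E \<I>. e \<in> K \<and> K - {e} \<subseteq> X"
proof -
  note mc = matroid_closure_closure_of[OF m]
  obtain B where B: "B \<subseteq> X" "ind (closure_of \<I>) B" "X \<subseteq> closure_of \<I> B"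
    using mc_base_of[OF mc, of X] by blast
  have eB: "e \<in> closure_of \<I> B" using mc_subD[OF mc e(1) B(3)] .
  define D where "D = {y \<in> B. e \<notin> closure_of \<I> (B - {y})}"
  have eD: "e \<in> closure_of \<I> D" unfolding D_def by (rule fundamental_circuit[OF mc B(2) eB])
  have DB: "D \<subseteq> B" "e \<notin> D" using e(2) B(1) by (auto simp: D_def)
  have "B \<in> \<I>" using B(2) ind_closure_of[OF m] by simp
  then have DI: "D \<in> \<I>" using matroidD(3)[OF m _ DB(1)] by simp
  have "insert e D \<notin> \<I>"
  proof
    assume "insert e D \<in> \<I>"
    then have "ind (closure_of \<I>) (insert e D)" using ind_closure_of[OF m] by simp
    then have "e \<notin> closure_of \<I> (insert e D - {e})" by (auto dest: indD)
    then show False using eD DB by simp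
  qed
  moreover have "N \<in> \<I>" if N: "N \<subset> insert e D" for N
  proof (cases "e \<in> N")
    case False
    then show ?thesis using N DI matroidD(3)[OF m, of D N] by blast
  next
    case True
    then obtain y where y: "y \<in> D" "y \<notin> N" using N by blast
    have "ind (closure_of \<I>) (insert e (B - {y}))"
      by (rule ind_insert[OF mc ind_subset[OF mc B(2)]]) (use y in \<open>auto simp: D_def\<close>)
    then have "insert e (B - {y}) \<in> \<I>" using ind_closure_of[OF m] by simp
    then show ?thesis by (rule matroidD(3)[OF m]) (use N y DB in blast)
  qed
  moreover have "insert e D \<subseteq> E" using e matroidD(1)[OF m DI] by blast
  ultimately have "insert e D \<in> circuits E \<I>" by (simp add: circuits_def)
  then show ?thesis using DB B(1) by blast
qed

section \<open>Restriction, spanning and contraction in terms of closures\<close>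

lemma matroid_restr:
  assumes m: "matroid E \<I>" and A: "A \<subseteq> E"
  shows "matroid A (restr_indep \<I> A)"
  unfolding matroid_def
proof (intro conjI ballI allI impI)
  fix I J assume I: "I \<in> restr_indep \<I> A" and J: "J \<in> restr_indep \<I> A"
    and max: "is_maximal_in (restr_indep \<I> A) J \<and> \<not> is_maximal_in (restr_indep \<I> A) I"
  have Jm: "is_maximal_in {J \<in> \<I>. J \<subseteq> A} J" using max by (simp add: restr_indep_def)
  have I': "I \<in> \<I>" "I \<subseteq> A" using I by (auto simp: restr_indep_def)
  have "\<not> is_maximal_in {J \<in> \<I>. J \<subseteq> A} I" using max by (simp add: restr_indep_def)
  then obtain x where x: "x \<in> A" "insert x I \<in> \<I>" "x \<notin> I"
    using maximal_inI[OF m I'] by blast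
  obtain e where "e \<in> J - I" "insert e I \<in> \<I>"
    using restricted_exchange[OF m Jm I' x(1,3,2)] by blast
  then show "\<exists>e\<in>J - I. insert e I \<in> restr_indep \<I> A"
    using J I by (auto simp: restr_indep_def)
next
  fix X I assume X: "X \<subseteq> A" and I: "I \<in> restr_indep \<I> A" "I \<subseteq> X"
  have "{J \<in> restr_indep \<I> A. J \<subseteq> X} = {J \<in> \<I>. J \<subseteq> X}" using X by (auto simp: restr_indep_def)
  then show "\<exists>B. I \<subseteq> B \<and> is_maximal_in {J \<in> restr_indep \<I> A. J \<subseteq> X} B"
    using matroid_extend[OF m _ I(2)] I(1) by (auto simp: restr_indep_def)
qed (use matroidD[OF m] in \<open>auto simp: restr_indep_def\<close>)

lemma closure_of_restr:
  assumes "x \<in> A" "X \<subseteq> A"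
  shows "x \<in> closure_of (restr_indep \<I> A) X \<longleftrightarrow> x \<in> closure_of \<I> X"
  unfolding closure_of_def restr_indep_def using assms by auto

lemma spanning_restr:
  assumes m: "matroid E \<I>" and F: "F \<subseteq> E" and S: "S \<subseteq> F" "F \<subseteq> closure_of \<I> S"
  shows "spanning F (restr_indep \<I> F) S"
proof -
  have "span F (restr_indep \<I> F) S \<subseteq> F" using S by (auto simp: span_def circuits_def)
  moreover have "F \<subseteq> span F (restr_indep \<I> F) S"
  proof
    fix x assume x: "x \<in> F"
    then have "x \<in> closure_of (restr_indep \<I> F) S" using closure_of_restr[OF x S(1)] S(2) by blast
    then show "x \<in> span F (restr_indep \<I> F) S"
      using closure_of_circuit[OF matroid_restr[OF m F] _ _ x] by (auto simp: span_def)
  qed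
  ultimately show ?thesis by (auto simp: spanning_def)
qed

lemma closure_basis:
  assumes B: "basis \<I> B"
  shows "closure_of \<I> B = UNIV"
proof -
  have "e \<in> B \<or> insert e B \<notin> \<I>" for e using B unfolding basis_def is_maximal_in_def by blast
  moreover have "B \<in> \<I>" using B by (simp add: basis_def is_maximal_in_def)
  ultimately show ?thesis unfolding closure_of_def by blast
qed

lemma basisI:
  assumes m: "matroid E \<I>" and B: "ind (closure_of \<I>) B" "E \<subseteq> closure_of \<I> B"
  shows "basis \<I> B"
  unfolding basis_def is_maximal_in_def
proof (intro conjI ballI impI)
  show "B \<in> \<I>" using B(1) ind_closure_of[OF m] by simp
  fix J assume J: "J \<in> \<I>" "B \<subseteq> J"
  have "x \<in> B" if x: "x \<in> J" for x
  proof (rule ccontr)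
    assume "x \<notin> B"
    then have "B \<subseteq> J - {x}" using J by blast
    then have "x \<in> closure_of \<I> (J - {x})"
      using B(2) matroidD(1)[OF m J(1)] x mc_monoD[OF matroid_closure_closure_of[OF m]] by blast
    then show False using indD[of "closure_of \<I>" J x] ind_closure_of[OF m] J(1) x by simp
  qed
  then show "J = B" using J by blast
qed

text \<open>A base \<open>B0\<close> of the contracted set is joined to \<open>J\<close> and
  completed to a basis \<open>B\<close>. Since \<open>B\<close> spans \<open>E - F\<close> from
  within, \<open>F - B\<close> is a basis of the restricted dual, and \<open>J\<close> avoids
  it.\<close>

lemma dot_indepI:
  assumes m: "matroid E \<I>" and F: "F \<subseteq> E" and J: "J \<subseteq> F"
    and i: "ind (\<lambda>X. closure_of \<I> (X \<union> (E - F))) J"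
  shows "J \<in> dot_indep E \<I> F"
proof -
  note mc = matroid_closure_closure_of[OF m]
  obtain B0 where B0: "B0 \<subseteq> E - F" "ind (closure_of \<I>) B0" "E - F \<subseteq> closure_of \<I> B0"
    using mc_base_of[OF mc, of "E - F"] by blast
  have JB0: "ind (closure_of \<I>) (J \<union> B0)" by (rule ind_contract_union[OF mc i B0(2,1)])
  obtain B where B: "J \<union> B0 \<subseteq> B" "B \<subseteq> E" "ind (closure_of \<I>) B" "E \<subseteq> closure_of \<I> B"
    using mc_base[OF mc JB0, of E] J F B0 by blast
  have bB: "basis \<I> B" by (rule basisI[OF m B(3,4)])
  have EF: "E - (E - F) = F" using F by blast
  have "basis (restr_indep (dual_indep E \<I>) F) (F - B)"
    unfolding basis_def is_maximal_in_def
  proof (intro conjI ballI impI)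
    show "F - B \<in> restr_indep (dual_indep E \<I>) F"
      using bB F by (auto simp: restr_indep_def dual_indep_def)
    fix J' assume J': "J' \<in> restr_indep (dual_indep E \<I>) F" "F - B \<subseteq> J'"
    then obtain B' where B': "basis \<I> B'" "J' \<subseteq> E - B'" "J' \<subseteq> F"
      by (auto simp: restr_indep_def dual_indep_def)
    have "z \<in> F - B" if z: "z \<in> J'" for z
    proof (rule ccontr)
      assume "z \<notin> F - B"
      then have zB: "z \<in> B" using z B' by blast
      have "B' \<subseteq> E" using B'(1) matroidD(1)[OF m] by (auto simp: basis_def is_maximal_in_def)
      \<comment> \<open>A dual-independent set containing \<open>F - B\<close> and also
        \<open>z\<close> would yield a basis \<open>B'\<close> spanned by \<open>B - {z}\<close>,
        because \<open>B0\<close> accounts for all of \<open>E - F\<close>.\<close>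
      then have "B' \<subseteq> (E - F) \<union> (B - {z})" using B' J'(2) z by blast
      moreover have "B0 \<subseteq> B - {z}" using B(1) B0(1) z B'(3) by blast
      then have "E - F \<subseteq> closure_of \<I> (B - {z})" using B0(3) mc_mono[OF mc] by blast
      ultimately have "B' \<subseteq> closure_of \<I> (B - {z})" using mc_ext[OF mc, of "B - {z}"] by blast
      then have "z \<in> closure_of \<I> (B - {z})"
        using closure_basis[OF B'(1)] mc_sub[OF mc] by blast
      then show False using indD[OF B(3) zB] by blast
    qed
    then show "J' = F - B" using J'(2) by blast
  qed
  moreover have "J \<subseteq> F - (F - B)" using J B(1) by blast
  ultimately show ?thesis
    unfolding dot_indep_def contr_indep_def EF dual_indep_def[of F] using J by blast
qed

section \<open>Finite circuits and finite cocircuits\<close>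

lemma finitary_closure:
  assumes m: "matroid E \<I>" and f: "finitary E \<I>" and x: "x \<in> closure_of \<I> X" "x \<in> E"
  shows "\<exists>F. finite F \<and> F \<subseteq> X \<and> x \<in> closure_of \<I> F"
proof (cases "x \<in> X")
  case True
  then show ?thesis by (intro exI[of _ "{x}"]) (auto simp: closure_of_def)
next
  case False
  then obtain K where K: "K \<in> circuits E \<I>" "x \<in> K" "K - {x} \<subseteq> X"
    using closure_of_circuit[OF m x(1) _ x(2)] by blast
  have "K - {x} \<in> \<I>" "insert x (K - {x}) \<notin> \<I>" using K by (auto simp: circuits_def insert_absorb)
  then have "x \<in> closure_of \<I> (K - {x})" unfolding closure_of_def by blast
  moreover have "finite (K - {x})" using f K by (auto simp: finitary_def)
  ultimately show ?thesis using K by blast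
qed

text \<open>The witness is the complement of a hyperplane \<open>H\<close> that contains \<open>X\<close> and avoids \<open>z\<close>.\<close>

lemma cofinitary_closure:
  assumes m: "matroid E \<I>" and f: "cofinitary E \<I>" and z: "z \<notin> closure_of \<I> X"
  shows "\<exists>F. finite F \<and> F \<subseteq> E \<and> z \<in> F \<and> F \<inter> X = {} \<and> z \<notin> closure_of \<I> (- F)"
proof -
  note mc = matroid_closure_closure_of[OF m]
  have out: "x \<in> closure_of \<I> Y" if "x \<notin> E" for x Y
    using matroidD(1)[OF m, of "{x}"] matroidD(2)[OF m] that unfolding closure_of_def by blast
  have zE: "z \<in> E" using out z by blast
  obtain BX where BX: "BX \<subseteq> X" "ind (closure_of \<I>) BX" "X \<subseteq> closure_of \<I> BX"
    using mc_base_of[OF mc, of X] by blast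
  have "z \<notin> closure_of \<I> BX" using z mc_monoD[OF mc _ BX(1)] by blast
  then have "ind (closure_of \<I>) (insert z BX)" by (rule ind_insert[OF mc BX(2)])
  then obtain B where B: "insert z BX \<subseteq> B" "ind (closure_of \<I>) B" "UNIV \<subseteq> closure_of \<I> B"
    using mc_base[OF mc, of "insert z BX" UNIV] by blast
  define H where "H = closure_of \<I> (B - {z})"
  define F where "F = - H"
  have zH: "z \<notin> H" unfolding H_def using indD[OF B(2)] B(1) by blast
  have FE: "F \<subseteq> E" using out by (auto simp: F_def H_def)
  have "z \<notin> BX" using \<open>z \<notin> closure_of \<I> BX\<close> mc_in[OF mc] by blast
  then have "BX \<subseteq> B - {z}" using B(1) by blast
  then have XH: "X \<subseteq> H" unfolding H_def using BX(3) mc_mono[OF mc] by blast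
  have HH: "closure_of \<I> H = H" unfolding H_def by (rule mc_idem[OF mc])
  have "F \<in> circuits E (dual_indep E \<I>)"
    unfolding circuits_def
  proof (intro CollectI conjI allI impI)
    show "F \<subseteq> E" by fact
    show "F \<notin> dual_indep E \<I>"
    proof
      assume "F \<in> dual_indep E \<I>"
      then obtain B' where "basis \<I> B'" "F \<subseteq> E - B'" by (auto simp: dual_indep_def)
      then have "B' \<subseteq> H" "closure_of \<I> B' = UNIV" using closure_basis by (auto simp: F_def)
      then have "H = UNIV" using HH mc_mono[OF mc, of B' H] by blast
      then show False using zH by blast
    qed
    \<comment> \<open>Any \<open>w\<close> in \<open>F\<close> but not in \<open>D\<close> lies
      outside the hyperplane and completes \<open>B - {z}\<close> to a basis that avoids
      \<open>D\<close>; hence \<open>F\<close> is minimally dependent in the dual.\<close>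
    fix D assume D: "D \<subset> F"
    then obtain w where w: "w \<in> F" "w \<notin> D" by blast
    then have wH: "w \<notin> closure_of \<I> (B - {z})" by (simp add: F_def H_def)
    have "ind (closure_of \<I>) (insert w (B - {z}))"
      by (rule ind_insert[OF mc ind_subset[OF mc B(2)] wH]) blast
    moreover have eq: "insert z (B - {z}) = B" using B(1) by blast
    have "closure_of \<I> (insert w (B - {z})) = closure_of \<I> (insert z (B - {z}))"
      by (rule span_insert_eq[OF mc _ wH]) (use B(3) eq in auto)
    then have "E \<subseteq> closure_of \<I> (insert w (B - {z}))" using B(3) eq by auto
    ultimately have bw: "basis \<I> (insert w (B - {z}))" by (rule basisI[OF m])
    have "B - {z} \<subseteq> H" unfolding H_def by (rule mc_ext[OF mc])
    then have "D \<subseteq> E - insert w (B - {z})" using D w FE by (auto simp: F_def)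
    then show "D \<in> dual_indep E \<I>" using bw by (auto simp: dual_indep_def)
  qed
  then have "finite F" using f by (auto simp: cofinitary_def finitary_def)
  moreover have "z \<notin> closure_of \<I> (- F)" using HH zH by (simp add: F_def)
  ultimately show ?thesis using FE zH XH by (intro exI[of _ F]) (auto simp: F_def)
qed

section \<open>The packing/covering theorem\<close>

lemma fin_closure_contract:
  assumes m: "matroid_closure c" and f: "fin_closure c"
  shows "fin_closure (\<lambda>X. c (X \<union> W))"
  unfolding fin_closure_def
proof (intro allI impI)
  fix X x assume "x \<in> c (X \<union> W)"
  then obtain F where F: "finite F" "F \<subseteq> X \<union> W" "x \<in> c F" using f unfolding fin_closure_def by blast
  have "x \<in> c (F \<inter> X \<union> W)" by (rule mc_monoD[OF m F(3)]) (use F(2) in blast)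
  then show "\<exists>F. finite F \<and> F \<subseteq> X \<and> x \<in> c (F \<union> W)" using F(1) by (intro exI[of _ "F \<inter> X"]) auto
qed

text \<open>A witness for \<open>X \<union> W\<close> avoids \<open>W\<close>, so adding
  \<open>W\<close> to its complement changes nothing.\<close>

lemma cofin_closure_contract:
  assumes f: "cofin_closure c"
  shows "cofin_closure (\<lambda>X. c (X \<union> W))"
  unfolding cofin_closure_def
proof (intro allI impI)
  fix X z assume "z \<notin> c (X \<union> W)"
  then obtain F where F: "finite F" "z \<in> F" "F \<inter> (X \<union> W) = {}" "z \<notin> c (- F)"
    using f unfolding cofin_closure_def by blast
  then have "- F \<union> W = - F" by blast
  then show "\<exists>F. finite F \<and> z \<in> F \<and> F \<inter> X = {} \<and> z \<notin> c (- F \<union> W)"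
    using F by (intro exI[of _ F]) auto
qed

lemma packing_covering:
  fixes C :: "'i \<Rightarrow> 'a set \<Rightarrow> 'a set"
  assumes cE: "countable E" and mc: "\<And>k. k \<in> \<Theta> \<Longrightarrow> matroid_closure (C k)"
    and fc: "\<And>k. k \<in> \<Theta> \<Longrightarrow> fin_closure (C k) \<or> cofin_closure (C k)"
  shows "\<exists>W S I. W \<subseteq> E \<and> packing \<Theta> C W S \<and>
    (\<forall>k\<in>\<Theta>. I k \<subseteq> E - W \<and> ind (\<lambda>X. C k (X \<union> W)) (I k)) \<and> (\<Union>k\<in>\<Theta>. I k) = E - W"
proof -
  obtain W S where W: "W \<subseteq> E" and p: "packing \<Theta> C W S"
    and max: "\<And>W' S'. W' \<subseteq> E \<Longrightarrow> packing \<Theta> C W' S' \<Longrightarrow> W \<subseteq> W' \<Longrightarrow>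
      (\<And>k. k \<in> \<Theta> \<Longrightarrow> S k \<subseteq> S' k) \<Longrightarrow> W' \<subseteq> W"
    by (rule maximal_packing[of \<Theta> C E, OF mc]) blast+
  have S: "S k \<subseteq> W" "W \<subseteq> C k (S k)" if "k \<in> \<Theta>" for k using p that by (auto simp: packing_def)
  have dS: "disjoint_family_on S \<Theta>" using p by (simp add: packing_def)
  interpret MF: matroid_family \<Theta> "\<lambda>k X. C k (X \<union> W)" "E - W"
    by unfold_locales (rule matroid_closure_contract[OF mc])
  \<comment> \<open>Each \<open>S k\<close> spans \<open>W\<close>, so a packing found after
    contracting \<open>W\<close> merges with \<open>S\<close> into a larger one.\<close>
  have np: "W1 = {}" if W1: "W1 \<subseteq> E - W" and p1: "packing \<Theta> (\<lambda>k X. C k (X \<union> W)) W1 S1" for W1 S1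
  proof -
    have S1: "S1 k \<subseteq> W1" "W1 \<subseteq> C k (S1 k \<union> W)" if "k \<in> \<Theta>" for k
      using p1 that by (auto simp: packing_def)
    have dS1: "disjoint_family_on S1 \<Theta>" using p1 by (simp add: packing_def)
    have "packing \<Theta> C (W \<union> W1) (\<lambda>k. S k \<union> S1 k)"
      unfolding packing_def
    proof (intro conjI ballI)
      fix k assume k: "k \<in> \<Theta>"
      show "S k \<union> S1 k \<subseteq> W \<union> W1" using S(1)[OF k] S1(1)[OF k] by blast
      have "W \<subseteq> C k (S k \<union> S1 k)" using S(2)[OF k] mc_mono[OF mc[OF k], of "S k" "S k \<union> S1 k"] by blast
      moreover have "S1 k \<union> W \<subseteq> C k (S k \<union> S1 k)"
        using calculation mc_ext[OF mc[OF k], of "S k \<union> S1 k"] by blast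
      then have "W1 \<subseteq> C k (S k \<union> S1 k)" using S1(2)[OF k] mc_sub[OF mc[OF k]] by blast
      ultimately show "W \<union> W1 \<subseteq> C k (S k \<union> S1 k)" by blast
    next
      show "disjoint_family_on (\<lambda>k. S k \<union> S1 k) \<Theta>"
      proof (rule disjoint_familyI)
        fix j k x assume jk: "j \<in> \<Theta>" "k \<in> \<Theta>" and x: "x \<in> S j \<union> S1 j" "x \<in> S k \<union> S1 k"
        have "x \<in> S j \<and> x \<in> S k \<or> x \<in> S1 j \<and> x \<in> S1 k"
          using x W1 S(1)[OF jk(1)] S(1)[OF jk(2)] S1(1)[OF jk(1)] S1(1)[OF jk(2)] by blast
        then show "j = k" using disjoint_familyD[OF dS jk] disjoint_familyD[OF dS1 jk] by blast
      qed
    qed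
    then have "W \<union> W1 \<subseteq> W" by (rule max[rotated]) (use W W1 in auto)
    then show ?thesis using W1 by blast
  qed
  have "\<exists>I. (\<forall>k\<in>\<Theta>. I k \<subseteq> E - W \<and> ind (\<lambda>X. C k (X \<union> W)) (I k)) \<and> (\<Union>k\<in>\<Theta>. I k) = E - W"
  proof (rule MF.covering_exists)
    show "countable (E - W)" using cE by auto
    show "fin_closure (\<lambda>X. C k (X \<union> W)) \<or> cofin_closure (\<lambda>X. C k (X \<union> W))" if "k \<in> \<Theta>" for k
      using fc[OF that] fin_closure_contract[OF mc[OF that]] cofin_closure_contract by blast
  qed (rule np)
  then show ?thesis using W p by blast
qed

section \<open>The two summands of a direct sum\<close>

lemma direct_sum_closure:
  assumes m: "matroid E \<I>" and AB: "A \<inter> B = {}" "A \<union> B = E"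
    and sum: "\<And>J. J \<subseteq> E \<Longrightarrow> J \<in> \<I> \<longleftrightarrow> J \<inter> A \<in> \<I> \<and> J \<inter> B \<in> \<I>"
    and x: "x \<in> A" "x \<in> closure_of \<I> X"
  shows "x \<in> closure_of \<I> (X \<inter> A)"
proof (cases "x \<in> X")
  case True
  then show ?thesis using x by (auto simp: closure_of_def)
next
  case False
  then obtain J where J: "J \<in> \<I>" "J \<subseteq> X" "insert x J \<notin> \<I>" using x by (auto simp: closure_of_def)
  have JE: "insert x J \<subseteq> E" "J \<subseteq> E" using matroidD(1)[OF m J(1)] x AB by blast+
  have "insert x J \<inter> A = insert x (J \<inter> A)" "insert x J \<inter> B = J \<inter> B" using x AB by blast+
  then have "insert x (J \<inter> A) \<notin> \<I>" using sum[OF JE(1)] sum[OF JE(2)] J by simp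
  moreover have "J \<inter> A \<in> \<I>" using sum[OF JE(2)] J(1) by blast
  ultimately show ?thesis using J(2) unfolding closure_of_def by blast
qed

text \<open>In a direct sum, contracting \<open>B\<close> is restricting to \<open>A\<close> with
  \<open>B\<close> as loops; in this form the summands of all matroids share one ground set.\<close>

lemma direct_sum_finitary_part:
  assumes m: "matroid E \<I>" and AB: "A \<inter> B = {}" "A \<union> B = E"
    and sum: "\<And>J. J \<subseteq> E \<Longrightarrow> J \<in> \<I> \<longleftrightarrow> J \<inter> A \<in> \<I> \<and> J \<inter> B \<in> \<I>"
    and f: "finitary A (restr_indep \<I> A)"
  shows "fin_closure (\<lambda>X. closure_of \<I> (X \<union> B))"
  unfolding fin_closure_def
proof (intro allI impI)
  fix X x assume x: "x \<in> closure_of \<I> (X \<union> B)"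
  note mc = matroid_closure_closure_of[OF m]
  have mA: "matroid A (restr_indep \<I> A)" by (rule matroid_restr[OF m]) (use AB in blast)
  show "\<exists>F. finite F \<and> F \<subseteq> X \<and> x \<in> closure_of \<I> (F \<union> B)"
  proof (cases "x \<in> A")
    case True
    have "x \<in> closure_of \<I> ((X \<union> B) \<inter> A)" by (rule direct_sum_closure[OF m AB sum True x])
    then have "x \<in> closure_of (restr_indep \<I> A) ((X \<union> B) \<inter> A)"
      using closure_of_restr[OF True, of "(X \<union> B) \<inter> A"] by simp
    then obtain F where F: "finite F" "F \<subseteq> (X \<union> B) \<inter> A" "x \<in> closure_of (restr_indep \<I> A) F"
      using finitary_closure[OF mA f _ True] by blast
    then have "x \<in> closure_of \<I> F" using closure_of_restr[OF True, of F] by simp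
    then have "x \<in> closure_of \<I> (F \<union> B)" using mc_monoD[OF mc] by blast
    then show ?thesis using F AB by (intro exI[of _ F]) auto
  next
    case False
    have "x \<in> closure_of \<I> ({} \<union> B)"
    proof (cases "x \<in> B")
      case True
      then show ?thesis by (simp add: closure_of_def)
    next
      case nB: False
      then have "{x} \<notin> \<I>" using matroidD(1)[OF m, of "{x}"] AB False by blast
      then show ?thesis using matroidD(2)[OF m] unfolding closure_of_def by blast
    qed
    then show ?thesis by (intro exI[of _ "{}"]) auto
  qed
qed

lemma direct_sum_cofinitary_part:
  assumes m: "matroid E \<I>" and AB: "A \<inter> B = {}" "A \<union> B = E"
    and sum: "\<And>J. J \<subseteq> E \<Longrightarrow> J \<in> \<I> \<longleftrightarrow> J \<inter> A \<in> \<I> \<and> J \<inter> B \<in> \<I>"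
    and f: "cofinitary B (restr_indep \<I> B)"
  shows "cofin_closure (\<lambda>X. closure_of \<I> (X \<union> A))"
  unfolding cofin_closure_def
proof (intro allI impI)
  fix X z assume z: "z \<notin> closure_of \<I> (X \<union> A)"
  note mc = matroid_closure_closure_of[OF m]
  have mB: "matroid B (restr_indep \<I> B)" by (rule matroid_restr[OF m]) (use AB in blast)
  have "z \<notin> A" using z mc_in[OF mc] by blast
  moreover have "z \<in> E"
  proof (rule ccontr)
    assume "z \<notin> E"
    then have "{z} \<notin> \<I>" using matroidD(1)[OF m, of "{z}"] by blast
    then show False using z matroidD(2)[OF m] unfolding closure_of_def by blast
  qed
  ultimately have zB: "z \<in> B" using AB by blast
  have BA: "B \<inter> A = {}" "B \<union> A = E" using AB by blast+
  have sum': "J \<in> \<I> \<longleftrightarrow> J \<inter> B \<in> \<I> \<and> J \<inter> A \<in> \<I>" if "J \<subseteq> E" for J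
    using sum[OF that] by blast
  have "z \<notin> closure_of \<I> (X \<inter> B)" using z mc_monoD[OF mc, of z "X \<inter> B" "X \<union> A"] by blast
  then have nz: "z \<notin> closure_of (restr_indep \<I> B) (X \<inter> B)"
    using closure_of_restr[OF zB, of "X \<inter> B"] by simp
  obtain F where F: "finite F" "F \<subseteq> B" "z \<in> F" "F \<inter> (X \<inter> B) = {}"
    "z \<notin> closure_of (restr_indep \<I> B) (- F)"
    using cofinitary_closure[OF mB f nz] by (elim exE conjE) (rule that)
  have "z \<notin> closure_of \<I> (- F \<union> A)"
  proof
    assume zF: "z \<in> closure_of \<I> (- F \<union> A)"
    have "z \<in> closure_of \<I> ((- F \<union> A) \<inter> B)" by (rule direct_sum_closure[OF m BA sum' zB zF])
    then have "z \<in> closure_of (restr_indep \<I> B) ((- F \<union> A) \<inter> B)"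
      using closure_of_restr[OF zB, of "(- F \<union> A) \<inter> B"] by simp
    moreover have "(- F \<union> A) \<inter> B \<subseteq> - F" using AB by blast
    ultimately show False
      using F(5) mc_monoD[OF matroid_closure_closure_of[OF mB]] by blast
  qed
  then show "\<exists>F. finite F \<and> z \<in> F \<and> F \<inter> X = {} \<and> z \<notin> closure_of \<I> (- F \<union> A)"
    using F(1-4) by (intro exI[of _ F]) auto
qed

theorem mainTheorem1:
  fixes E :: "'a set" and \<Theta> :: "'i set" and M :: "'i \<Rightarrow> 'a set set"
  assumes "countable E"
    and "\<forall>i\<in>\<Theta>. matroid E (M i)"
    and "\<forall>i\<in>\<Theta>. in_F_plus_Fstar E (M i)"
  shows "\<exists>Ep Ec. Ep \<inter> Ec = {} \<and> Ep \<union> Ec = E \<and>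
           has_packing \<Theta> Ep (\<lambda>i. restr_indep (M i) Ep) \<and>
           has_covering \<Theta> Ec (\<lambda>i. dot_indep E (M i) Ec)"
proof -
  have m: "matroid E (M i)" if "i \<in> \<Theta>" for i using assms(2) that by blast
  define P where "P i A B \<longleftrightarrow> A \<inter> B = {} \<and> A \<union> B = E \<and>
      (\<forall>J. J \<subseteq> E \<longrightarrow> (J \<in> M i \<longleftrightarrow> J \<inter> A \<in> M i \<and> J \<inter> B \<in> M i)) \<and>
      finitary A (restr_indep (M i) A) \<and> cofinitary B (restr_indep (M i) B)" for i A B
  have "\<forall>i\<in>\<Theta>. \<exists>A B. P i A B" using assms(3) unfolding in_F_plus_Fstar_def P_def .
  then obtain A B where "\<forall>i\<in>\<Theta>. P i (A i) (B i)" by metis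
  then have AB: "A i \<inter> B i = {}" "A i \<union> B i = E"
    and sum: "\<And>J. J \<subseteq> E \<Longrightarrow> J \<in> M i \<longleftrightarrow> J \<inter> A i \<in> M i \<and> J \<inter> B i \<in> M i"
    and fA: "finitary (A i) (restr_indep (M i) (A i))"
    and fB: "cofinitary (B i) (restr_indep (M i) (B i))" if "i \<in> \<Theta>" for i
    using that by (simp_all add: P_def)
  \<comment> \<open>Each matroid becomes two: index \<open>(i, True)\<close> contracts
    \<open>B i\<close> and keeps the finitary summand, \<open>(i, False)\<close> contracts
    \<open>A i\<close> and keeps the cofinitary one.\<close>
  define C where "C p X = closure_of (M (fst p)) (X \<union> (if snd p then B (fst p) else A (fst p)))"
    for p :: "'i \<times> bool" and X
  define \<Theta>' where "\<Theta>' = \<Theta> \<times> (UNIV :: bool set)"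
  have mcM: "matroid_closure (closure_of (M i))" if "i \<in> \<Theta>" for i
    by (rule matroid_closure_closure_of[OF m[OF that]])
  have mcC: "matroid_closure (C p)" if "p \<in> \<Theta>'" for p
    unfolding C_def by (rule matroid_closure_contract[OF mcM]) (use that in \<open>auto simp: \<Theta>'_def\<close>)
  have fc: "fin_closure (C p) \<or> cofin_closure (C p)" if "p \<in> \<Theta>'" for p
  proof -
    obtain i b where p: "p = (i, b)" by (cases p)
    then have i: "i \<in> \<Theta>" using that by (simp add: \<Theta>'_def)
    show ?thesis
    proof (cases b)
      case True
      then have "C p = (\<lambda>X. closure_of (M i) (X \<union> B i))" using p by (auto simp: C_def)
      then show ?thesis using direct_sum_finitary_part[OF m[OF i] AB[OF i] sum[OF i] fA[OF i]] by simp
    next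
      case False
      then have "C p = (\<lambda>X. closure_of (M i) (X \<union> A i))" using p by (auto simp: C_def)
      then show ?thesis using direct_sum_cofinitary_part[OF m[OF i] AB[OF i] sum[OF i] fB[OF i]] by simp
    qed
  qed
  have "\<exists>W S I. W \<subseteq> E \<and> packing \<Theta>' C W S \<and>
    (\<forall>k\<in>\<Theta>'. I k \<subseteq> E - W \<and> ind (\<lambda>X. C k (X \<union> W)) (I k)) \<and> (\<Union>k\<in>\<Theta>'. I k) = E - W"
    by (rule packing_covering[OF assms(1) mcC fc])
  then obtain W S I where W: "W \<subseteq> E" and p: "packing \<Theta>' C W S"
    and I: "\<forall>k\<in>\<Theta>'. I k \<subseteq> E - W \<and> ind (\<lambda>X. C k (X \<union> W)) (I k)" and cov: "(\<Union>k\<in>\<Theta>'. I k) = E - W"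
    by (elim exE conjE) (rule that)
  have S: "S k \<subseteq> W" "W \<subseteq> C k (S k)" if "k \<in> \<Theta>'" for k using p that by (auto simp: packing_def)
  have dS: "disjoint_family_on S \<Theta>'" using p by (simp add: packing_def)
  have in': "(i, b) \<in> \<Theta>'" if "i \<in> \<Theta>" for i b using that by (simp add: \<Theta>'_def)
  have "has_packing \<Theta> W (\<lambda>i. restr_indep (M i) W)"
    unfolding has_packing_def
  proof (intro exI[of _ "\<lambda>i. S (i, True) \<union> S (i, False)"] conjI ballI impI)
    fix i assume i: "i \<in> \<Theta>"
    let ?S = "S (i, True) \<union> S (i, False)"
    show SW: "?S \<subseteq> W" using S(1)[OF in'[OF i, of True]] S(1)[OF in'[OF i, of False]] by blast
    \<comment> \<open>An element is spanned at the index keeping its own summand; by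
      \<open>direct_sum_closure\<close> the contracted summand contributes nothing to this.\<close>
    have "W \<subseteq> closure_of (M i) ?S"
    proof
      fix x assume x: "x \<in> W"
      have BA: "B i \<inter> A i = {}" "B i \<union> A i = E" using AB[OF i] by blast+
      have sum': "J \<in> M i \<longleftrightarrow> J \<inter> B i \<in> M i \<and> J \<inter> A i \<in> M i" if "J \<subseteq> E" for J
        using sum[OF i that] by blast
      have T: "x \<in> closure_of (M i) (S (i, True) \<union> B i)" and F: "x \<in> closure_of (M i) (S (i, False) \<union> A i)"
        using S(2)[OF in'[OF i, of True]] S(2)[OF in'[OF i, of False]] x by (auto simp: C_def)
      consider "x \<in> A i" | "x \<in> B i" using AB(2)[OF i] W x by blast
      then show "x \<in> closure_of (M i) ?S"
      proof cases
        case 1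
        then have "x \<in> closure_of (M i) ((S (i, True) \<union> B i) \<inter> A i)"
          by (intro direct_sum_closure[OF m[OF i] AB[OF i] sum[OF i] _ T])
        then show ?thesis by (rule mc_monoD[OF mcM[OF i]]) (use AB(1)[OF i] in blast)
      next
        case 2
        then have "x \<in> closure_of (M i) ((S (i, False) \<union> A i) \<inter> B i)"
          by (intro direct_sum_closure[OF m[OF i] BA sum' _ F])
        then show ?thesis by (rule mc_monoD[OF mcM[OF i]]) (use AB(1)[OF i] in blast)
      qed
    qed
    then show "spanning W (restr_indep (M i) W) ?S" by (rule spanning_restr[OF m[OF i] W SW])
  next
    fix i j assume ij: "i \<in> \<Theta>" "j \<in> \<Theta>" "i \<noteq> j"
    have "S (i, a) \<inter> S (j, b) = {}" for a b
      using dS in'[OF ij(1)] in'[OF ij(2)] ij(3) by (auto simp: disjoint_family_on_def)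
    then show "(S (i, True) \<union> S (i, False)) \<inter> (S (j, True) \<union> S (j, False)) = {}" by blast
  qed
  moreover have "has_covering \<Theta> (E - W) (\<lambda>i. dot_indep E (M i) (E - W))"
    unfolding has_covering_def
  proof (intro exI[of _ "\<lambda>i. I (i, True) \<union> I (i, False)"] conjI ballI)
    fix i assume i: "i \<in> \<Theta>"
    have IE: "I (i, b) \<subseteq> E - W" for b using I in'[OF i, of b] by blast
    have indI: "x \<notin> closure_of (M i) (I (i, b) - {x} \<union> W \<union> (if b then B i else A i))"
      if "x \<in> I (i, b)" for x b
    proof -
      have "ind (\<lambda>X. C (i, b) (X \<union> W)) (I (i, b))" using I in'[OF i, of b] by blast
      then show ?thesis using that by (auto simp: ind_def C_def)
    qed
    \<comment> \<open>Contracted elements are loops, so an independent set at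
      \<open>(i, True)\<close> cannot contain elements of \<open>B i\<close>.\<close>
    have IA: "I (i, True) \<subseteq> A i"
    proof
      fix x assume x: "x \<in> I (i, True)"
      have "x \<notin> B i" using indI[OF x] mc_in[OF mcM[OF i], of x "I (i, True) - {x} \<union> W \<union> B i"] by auto
      then show "x \<in> A i" using IE[of True] x AB(2)[OF i] by blast
    qed
    have IB: "I (i, False) \<subseteq> B i"
    proof
      fix x assume x: "x \<in> I (i, False)"
      have "x \<notin> A i" using indI[OF x] mc_in[OF mcM[OF i], of x "I (i, False) - {x} \<union> W \<union> A i"] by auto
      then show "x \<in> B i" using IE[of False] x AB(2)[OF i] by blast
    qed
    let ?I = "I (i, True) \<union> I (i, False)"
    have EW: "E - (E - W) = W" using W by blast
    show "?I \<in> dot_indep E (M i) (E - W)"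
    proof (rule dot_indepI[OF m[OF i]])
      show "?I \<subseteq> E - W" using IE by blast
      show "ind (\<lambda>X. closure_of (M i) (X \<union> (E - (E - W)))) ?I"
        unfolding ind_def EW
      proof
        fix x assume "x \<in> ?I"
        then consider "x \<in> I (i, True)" | "x \<in> I (i, False)" by blast
        then show "x \<notin> closure_of (M i) (?I - {x} \<union> W)"
        proof cases
          case 1
          \<comment> \<open>The other piece of \<open>?I\<close> lies in the summand contracted at
            this index, so independence at the index already covers it.\<close>
          have "?I - {x} \<union> W \<subseteq> I (i, True) - {x} \<union> W \<union> B i" using IB by blast
          then show ?thesis using indI[OF 1] mc_monoD[OF mcM[OF i], of x "?I - {x} \<union> W"] by auto
        next
          case 2
          have "?I - {x} \<union> W \<subseteq> I (i, False) - {x} \<union> W \<union> A i" using IA by blast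
          then show ?thesis using indI[OF 2] mc_monoD[OF mcM[OF i], of x "?I - {x} \<union> W"] by auto
        qed
      qed
    qed blast
  next
    have "(\<Union>i\<in>\<Theta>. I (i, True) \<union> I (i, False)) = (\<Union>k\<in>\<Theta>'. I k)"
    proof
      show "(\<Union>i\<in>\<Theta>. I (i, True) \<union> I (i, False)) \<subseteq> (\<Union>k\<in>\<Theta>'. I k)"
        by (auto simp: \<Theta>'_def)
      show "(\<Union>k\<in>\<Theta>'. I k) \<subseteq> (\<Union>i\<in>\<Theta>. I (i, True) \<union> I (i, False))"
      proof
        fix x assume "x \<in> (\<Union>k\<in>\<Theta>'. I k)"
        then obtain i b where "i \<in> \<Theta>" "x \<in> I (i, b)" by (auto simp: \<Theta>'_def)
        then show "x \<in> (\<Union>i\<in>\<Theta>. I (i, True) \<union> I (i, False))" by (cases b) auto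
      qed
    qed
    then show "(\<Union>i\<in>\<Theta>. I (i, True) \<union> I (i, False)) = E - W" using cov by simp
  qed
  ultimately show ?thesis using W by (intro exI[of _ W] exI[of _ "E - W"]) auto
qed

end
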